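(* Let $(M,L)$ be a Finsler manifold with Cartan connection $\nabla$ and Berwald connection $D^{\circ}$. Let $K$, $\beta$, $T$ and $\widehat{P}$ be respectively the connection map, the horizontal map, the (h)hv-torsion and the (v)hv-torsion of $\nabla$. Then $D^{\circ}$ is explicitly expressed in terms of $\nabla$ by $$D^{\circ}_{X}\overline{Y}=\nabla_{X}\overline{Y}+\widehat{P}(\rho X,\overline{Y})-T(KX,\overline{Y})$$ for all $X\in\mathfrak{X}(\mathcal{T}M)$ and $\overline{Y}\in\mathfrak{X}(\pi(M))$. In particular, for all $\overline{X},\overline{Y}\in\mathfrak{X}(\pi(M))$: (a) $D^{\circ}_{\gamma\overline{X}}\overline{Y}=\nabla_{\gamma\overline{X}}\overline{Y}-T(\overline{X},\overline{Y})=\rho[\gamma\overline{X},\beta\overline{Y}]$; (b) $D^{\circ}_{\beta\overline{X}}\overline{Y}=\nabla_{\beta\overline{X}}\overline{Y}+\widehat{P}(\overline{X},\overline{Y})=K[\beta\overline{X},\gamma\overline{Y}]$.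
   Context: Pullback formalism. $M$ is a real $C^\infty$ manifold of finite dimension; all objects are $C^\infty$. $\pi_M:TM\to M$ is the tangent bundle, $\pi:\mathcal{T}M\to M$ its open subbundle of nonzero tangent vectors, and $\pi^{-1}(TM)\to\mathcal{T}M$ is the pullback of $TM$ by $\pi$ (fibre over $u$: pairs $(u,v)$ with $v\in T_{\pi(u)}M$). $\mathfrak{X}(\mathcal{T}M)$ denotes the vector fields on $\mathcal{T}M$, and $\mathfrak{X}(\pi(M))$ the smooth sections of $\pi^{-1}(TM)$, written with bars. The fundamental section is $\overline{\eta}(u)=(u,u)$. The bundle morphisms $\rho:T(\mathcal{T}M)\to\pi^{-1}(TM)$ and $\gamma:\pi^{-1}(TM)\to T(\mathcal{T}M)$ are $\rho(X)=(u,d\pi(X))$ for $X\in T_u(\mathcal{T}M)$ and $\gamma(u,v)=\frac{d}{dt}\big|_{t=0}(u+tv)$; the image of $\gamma$ is $\ker\rho=V(\mathcal{T}M)$, the vertical bundle. Put $J:=\gamma\circ\rho$. Regular connections. For a linear connection $D$ on the vector bundle $\pi^{-1}(TM)$, the connection map is $K(X)=D_X\overline{\eta}$, and the horizontal space at $u$ is $H_u(\mathcal{T}M)=\{X\in T_u(\mathcal{T}M):K(X)=0\}$. $D$ is regular if $T_u(\mathcal{T}M)=V_u(\mathcal{T}M)\oplus H_u(\mathcal{T}M)$ for all $u\in\mathcal{T}M$. Then $\rho|_{H(\mathcal{T}M)}$ is an isomorphism onto $\pi^{-1}(TM)$, with inverse $\beta:=(\rho|_{H(\mathcal{T}M)})^{-1}$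 (the horizontal map of $D$), and the horizontal projector of $D$ is $h=\beta\circ\rho$. Torsions and curvature. For $X,Y,Z\in\mathfrak{X}(\mathcal{T}M)$: $\mathbf{T}(X,Y)=D_X\rho Y-D_Y\rho X-\rho[X,Y]$ and $\mathbf{K}(X,Y)\rho Z=-D_XD_Y\rho Z+D_YD_X\rho Z+D_{[X,Y]}\rho Z$. The horizontal ((h)h-) torsion is $Q(\overline{X},\overline{Y})=\mathbf{T}(\beta\overline{X},\beta\overline{Y})$, the mixed ((h)hv-) torsion is $T(\overline{X},\overline{Y})=\mathbf{T}(\gamma\overline{X},\beta\overline{Y})$, and the (v)hv-torsion is $\widehat{P}(\overline{X},\overline{Y})=\mathbf{K}(\beta\overline{X},\gamma\overline{Y})\overline{\eta}$. Finsler structure. $(M,L)$ is a Finsler manifold: $L:TM\to\mathbb{R}$ is continuous, $C^\infty$ and positive on $\mathcal{T}M$, positively homogeneous of degree 1 on fibres, and with $E:=\frac12L^2$ the fibrewise Hessian of $E$ on $\mathcal{T}M$ is positive definite. The Finsler metric $g$ on $\pi^{-1}(TM)$ is this Hessian, i.e. $g(\rho X,\rho Y)=\Omega(JX,Y)$ with $\Omega:=dd_JE$, $d_JE:=dE\circ J$. Cartan connection $\nabla$: the unique regular connection on $\pi^{-1}(TM)$ with $\nabla g=0$, $Q=0$, and $g(T(\overline{X},\overline{Y}),\overline{Z})=g(T(\overline{X},\overline{Z}),\overline{Y})$. Berwald connection $D^{\circ}$: the unique regular connection on $\pi^{-1}(TM)$ with $h^{\circ}X\cdot L=0$ for all $X$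 ($h^{\circ}$ its horizontal projector), $\mathbf{T}^{\circ}=0$ and $\widehat{P}^{\circ}=0$. *)

theory Defs
  imports "HOL-Analysis.Analysis" "HOL-Library.Function_Algebras"
begin

section \<open>Smooth functions on open subsets of Euclidean spaces\<close>

text \<open>In finite dimension, a function on an open set is of class $C^{k+1}$ iff it is differentiable
  and all its directional derivatives (for constant directions) are of class $C^k$.\<close>

primrec Ck_on :: "nat \<Rightarrow> 'a::euclidean_space set \<Rightarrow> ('a \<Rightarrow> 'b::euclidean_space) \<Rightarrow> bool" where
  "Ck_on 0 S f \<longleftrightarrow> continuous_on S f"
| "Ck_on (Suc k) S f \<longleftrightarrow> (\<forall>x\<in>S. f differentiable (at x)) \<and>
     (\<forall>v. Ck_on k S (\<lambda>x. frechet_derivative f (at x) v))"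

definition smooth_on :: "'a::euclidean_space set \<Rightarrow> ('a \<Rightarrow> 'b::euclidean_space) \<Rightarrow> bool" where
  "smooth_on S f \<longleftrightarrow> (\<forall>k. Ck_on k S f)"


section \<open>Smooth manifolds\<close>

text \<open>A manifold is given by an indexed atlas: the chart with index \<open>i\<close> is \<open>cmap M i\<close>, defined on
  \<open>cdom M i\<close>. The underlying set is the union of the chart domains and the topology is the one
  generated by the charts. Chart domains may be empty, so that indexing by a whole type is no
  restriction.\<close>

record ('i, 'm, 'e) atlas =
  cdom :: "'i \<Rightarrow> 'm set"
  cmap :: "'i \<Rightarrow> 'm \<Rightarrow> 'e"

definition mcarrier :: "('i, 'm, 'e) atlas \<Rightarrow> 'm set" where
  "mcarrier M = (\<Union>i. cdom M i)"

definition mtop :: "('i, 'm, 'e::euclidean_space) atlas \<Rightarrow> 'm topology" where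
  "mtop M = topology (\<lambda>U. U \<subseteq> mcarrier M \<and> (\<forall>i. open (cmap M i ` (U \<inter> cdom M i))))"

definition cinv :: "('i, 'm, 'e) atlas \<Rightarrow> 'i \<Rightarrow> 'e \<Rightarrow> 'm" where
  "cinv M i = inv_into (cdom M i) (cmap M i)"

definition transition :: "('i, 'm, 'e) atlas \<Rightarrow> 'i \<Rightarrow> 'i \<Rightarrow> 'e \<Rightarrow> 'e" where
  "transition M i j = cmap M j \<circ> cinv M i"

definition smooth_manifold :: "('i, 'm, 'e::euclidean_space) atlas \<Rightarrow> bool" where
  "smooth_manifold M \<longleftrightarrow>
     (\<forall>i. inj_on (cmap M i) (cdom M i)) \<and>
     (\<forall>i j. open (cmap M i ` (cdom M i \<inter> cdom M j))) \<and>
     (\<forall>i j. smooth_on (cmap M i ` (cdom M i \<inter> cdom M j)) (transition M i j)) \<and>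
     Hausdorff_space (mtop M) \<and> second_countable (mtop M)"

definition smooth_fun :: "('i, 'm, 'e::euclidean_space) atlas \<Rightarrow> ('m \<Rightarrow> real) \<Rightarrow> bool" where
  "smooth_fun M f \<longleftrightarrow> (\<forall>i. smooth_on (cmap M i ` cdom M i) (f \<circ> cinv M i))"

definition smooth_map ::
  "('i, 'm, 'e::euclidean_space) atlas \<Rightarrow> ('j, 'n, 'f::euclidean_space) atlas \<Rightarrow> ('m \<Rightarrow> 'n) \<Rightarrow> bool" where
  "smooth_map M N F \<longleftrightarrow> F ` mcarrier M \<subseteq> mcarrier N \<and>
     (\<forall>i j. open (cmap M i ` (cdom M i \<inter> F -` cdom N j)) \<and>
            smooth_on (cmap M i ` (cdom M i \<inter> F -` cdom N j)) (cmap N j \<circ> F \<circ> cinv M i))"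

definition open_submanifold :: "('i, 'm, 'e) atlas \<Rightarrow> 'm set \<Rightarrow> ('i, 'm, 'e) atlas" where
  "open_submanifold M U = \<lparr>cdom = (\<lambda>i. cdom M i \<inter> U), cmap = cmap M\<rparr>"


section \<open>Tangent vectors, differentials, vector fields\<close>

text \<open>A tangent vector at \<open>p\<close> is the family of its components in the charts around \<open>p\<close>, subject to
  the transformation law under changes of charts; the components in charts whose domain does not
  contain \<open>p\<close> are 0. Addition of tangent vectors (and of fields) is the pointwise one of
  \<^theory>\<open>HOL-Library.Function_Algebras\<close>.\<close>

definition tangent_space :: "('i, 'm, 'e::euclidean_space) atlas \<Rightarrow> 'm \<Rightarrow> ('i \<Rightarrow> 'e) set" where
  "tangent_space M p = {v. (\<forall>i. p \<notin> cdom M i \<longrightarrow> v i = 0) \<and>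
     (\<forall>i j. p \<in> cdom M i \<inter> cdom M j \<longrightarrow>
        v j = frechet_derivative (transition M i j) (at (cmap M i p)) (v i))}"

definition scl :: "real \<Rightarrow> ('i \<Rightarrow> 'e::real_vector) \<Rightarrow> 'i \<Rightarrow> 'e" where
  "scl a v = (\<lambda>i. a *\<^sub>R v i)"

definition chart_at :: "('i, 'm, 'e) atlas \<Rightarrow> 'm \<Rightarrow> 'i" where
  "chart_at M p = (SOME i. p \<in> cdom M i)"

definition differential :: "('i, 'm, 'e::euclidean_space) atlas \<Rightarrow> ('j, 'n, 'f::euclidean_space) atlas
    \<Rightarrow> ('m \<Rightarrow> 'n) \<Rightarrow> 'm \<Rightarrow> ('i \<Rightarrow> 'e) \<Rightarrow> 'j \<Rightarrow> 'f" where
  "differential M N F p v = (\<lambda>j. if F p \<in> cdom N j then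
     (let i = chart_at M p in
       frechet_derivative (cmap N j \<circ> F \<circ> cinv M i) (at (cmap M i p)) (v i)) else 0)"

definition fun_differential :: "('i, 'm, 'e::euclidean_space) atlas \<Rightarrow> ('m \<Rightarrow> real)
    \<Rightarrow> 'm \<Rightarrow> ('i \<Rightarrow> 'e) \<Rightarrow> real" where
  "fun_differential M f p v =
     (let i = chart_at M p in frechet_derivative (f \<circ> cinv M i) (at (cmap M i p)) (v i))"

definition velocity :: "('i, 'm, 'e::euclidean_space) atlas \<Rightarrow> (real \<Rightarrow> 'm) \<Rightarrow> real \<Rightarrow> 'i \<Rightarrow> 'e" where
  "velocity M c t = (\<lambda>i. if c t \<in> cdom M i
     then vector_derivative (\<lambda>s. cmap M i (c s)) (at t) else 0)"

definition tangent_bundle :: "('i, 'm, 'e::euclidean_space) atlas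
    \<Rightarrow> ('i, 'm \<times> ('i \<Rightarrow> 'e), 'e \<times> 'e) atlas" where
  "tangent_bundle M =
     \<lparr>cdom = (\<lambda>i. {(p, v). p \<in> cdom M i \<and> v \<in> tangent_space M p}),
      cmap = (\<lambda>i (p, v). (cmap M i p, v i))\<rparr>"

text \<open>Fields are extended by 0 outside the manifold, so that equality of fields is equality of
  functions.\<close>

definition vector_fields :: "('i, 'm, 'e::euclidean_space) atlas \<Rightarrow> ('m \<Rightarrow> 'i \<Rightarrow> 'e) set" where
  "vector_fields M = {X. smooth_map M (tangent_bundle M) (\<lambda>p. (p, X p)) \<and>
     (\<forall>p. p \<notin> mcarrier M \<longrightarrow> X p = 0)}"

text \<open>The Lie bracket, $[X,Y] = dY(X) - dX(Y)$ in any chart.\<close>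

definition bracket :: "('i, 'm, 'e::euclidean_space) atlas
    \<Rightarrow> ('m \<Rightarrow> 'i \<Rightarrow> 'e) \<Rightarrow> ('m \<Rightarrow> 'i \<Rightarrow> 'e) \<Rightarrow> 'm \<Rightarrow> 'i \<Rightarrow> 'e" where
  "bracket M X Y = (\<lambda>p i. if p \<in> cdom M i then
       frechet_derivative (\<lambda>x. Y (cinv M i x) i) (at (cmap M i p)) (X p i)
     - frechet_derivative (\<lambda>x. X (cinv M i x) i) (at (cmap M i p)) (Y p i) else 0)"


section \<open>The pullback bundle over the slit tangent bundle\<close>

text \<open>A point of the slit tangent bundle is a pair \<open>(p, y)\<close> with \<open>y \<noteq> 0\<close> tangent at \<open>p\<close>; the
  projection onto the manifold is \<^term>\<open>fst\<close>.\<close>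

type_synonym ('i, 'm, 'e) tpoint = "'m \<times> ('i \<Rightarrow> 'e)"

text \<open>An element \<open>(u, v)\<close> of the fibre over \<open>u\<close> of the pullback bundle is represented by \<open>v\<close>.\<close>

type_synonym ('i, 'm, 'e) psection = "('i, 'm, 'e) tpoint \<Rightarrow> 'i \<Rightarrow> 'e"

type_synonym ('i, 'm, 'e) tfield = "('i, 'm, 'e) tpoint \<Rightarrow> 'i \<Rightarrow> 'e \<times> 'e"

text \<open>A linear connection $D$ is represented by \<open>\<lambda>Y u \<xi>. D\<^bsub>\<xi>\<^esub> Y\<close>, with \<open>\<xi>\<close> tangent at \<open>u\<close>.\<close>

type_synonym ('i, 'm, 'e) connection =
  "('i, 'm, 'e) psection \<Rightarrow> ('i, 'm, 'e) tpoint \<Rightarrow> ('i \<Rightarrow> 'e \<times> 'e) \<Rightarrow> 'i \<Rightarrow> 'e"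

definition slit :: "('i, 'm, 'e::euclidean_space) atlas
    \<Rightarrow> ('i, ('i, 'm, 'e) tpoint, 'e \<times> 'e) atlas" where
  "slit M = open_submanifold (tangent_bundle M) {u. snd u \<noteq> 0}"

definition pullback_bundle :: "('i, 'm, 'e::euclidean_space) atlas
    \<Rightarrow> ('i, ('i, 'm, 'e) tpoint \<times> ('i \<Rightarrow> 'e), ('e \<times> 'e) \<times> 'e) atlas" where
  "pullback_bundle M =
     \<lparr>cdom = (\<lambda>i. {(u, v). u \<in> cdom (slit M) i \<and> v \<in> tangent_space M (fst u)}),
      cmap = (\<lambda>i (u, v). (cmap (slit M) i u, v i))\<rparr>"

definition psections :: "('i, 'm, 'e::euclidean_space) atlas \<Rightarrow> ('i, 'm, 'e) psection set" where
  "psections M = {Y. smooth_map (slit M) (pullback_bundle M) (\<lambda>u. (u, Y u)) \<and>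
     (\<forall>u. u \<notin> mcarrier (slit M) \<longrightarrow> Y u = 0)}"

text \<open>Application of a fibrewise map to a field.\<close>

definition fieldwise :: "('i, 'm, 'e::euclidean_space) atlas
    \<Rightarrow> (('i, 'm, 'e) tpoint \<Rightarrow> 'a \<Rightarrow> 'b) \<Rightarrow> (('i, 'm, 'e) tpoint \<Rightarrow> 'a) \<Rightarrow> ('i, 'm, 'e) tpoint \<Rightarrow> 'b::zero" where
  "fieldwise M B X = (\<lambda>u. if u \<in> mcarrier (slit M) then B u (X u) else 0)"

definition fundamental_section :: "('i, 'm, 'e::euclidean_space) atlas \<Rightarrow> ('i, 'm, 'e) psection" where
  "fundamental_section M = (\<lambda>u. if u \<in> mcarrier (slit M) then snd u else 0)"

definition rho :: "('i, 'm, 'e::euclidean_space) atlas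
    \<Rightarrow> ('i, 'm, 'e) tpoint \<Rightarrow> ('i \<Rightarrow> 'e \<times> 'e) \<Rightarrow> 'i \<Rightarrow> 'e" where
  "rho M u = differential (slit M) M fst u"

definition gam :: "('i, 'm, 'e::euclidean_space) atlas
    \<Rightarrow> ('i, 'm, 'e) tpoint \<Rightarrow> ('i \<Rightarrow> 'e) \<Rightarrow> 'i \<Rightarrow> 'e \<times> 'e" where
  "gam M u v = velocity (slit M) (\<lambda>t. (fst u, snd u + scl t v)) 0"


section \<open>Regular connections\<close>

text \<open>A linear connection is a map from sections to smooth sections of
  $\mathrm{Hom}(T(\mathcal{T}M), \pi^{-1}(TM))$, i.e. to fibrewise linear smooth bundle maps, which is
  additive and satisfies the Leibniz rule.\<close>

definition linear_connection :: "('i, 'm, 'e::euclidean_space) atlas \<Rightarrow> ('i, 'm, 'e) connection \<Rightarrow> bool" where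
  "linear_connection M D \<longleftrightarrow>
     (\<forall>Y\<in>psections M.
        smooth_map (tangent_bundle (slit M)) (pullback_bundle M) (\<lambda>(u, \<xi>). (u, D Y u \<xi>)) \<and>
        (\<forall>u\<in>mcarrier (slit M). \<forall>\<xi>\<in>tangent_space (slit M) u.
           (\<forall>\<zeta>\<in>tangent_space (slit M) u. D Y u (\<xi> + \<zeta>) = D Y u \<xi> + D Y u \<zeta>) \<and>
           (\<forall>a. D Y u (scl a \<xi>) = scl a (D Y u \<xi>)) \<and>
           (\<forall>Z\<in>psections M. D (Y + Z) u \<xi> = D Y u \<xi> + D Z u \<xi>) \<and>
           (\<forall>f. smooth_fun (slit M) f \<longrightarrow>
              D (\<lambda>u. scl (f u) (Y u)) u \<xi> =
                scl (fun_differential (slit M) f u \<xi>) (Y u) + scl (f u) (D Y u \<xi>))))"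

definition cov :: "('i, 'm, 'e::euclidean_space) atlas \<Rightarrow> ('i, 'm, 'e) connection
    \<Rightarrow> ('i, 'm, 'e) tfield \<Rightarrow> ('i, 'm, 'e) psection \<Rightarrow> ('i, 'm, 'e) psection" where
  "cov M D X Y = fieldwise M (D Y) X"

definition connection_map :: "('i, 'm, 'e::euclidean_space) atlas \<Rightarrow> ('i, 'm, 'e) connection
    \<Rightarrow> ('i, 'm, 'e) tpoint \<Rightarrow> ('i \<Rightarrow> 'e \<times> 'e) \<Rightarrow> 'i \<Rightarrow> 'e" where
  "connection_map M D u \<xi> = D (fundamental_section M) u \<xi>"

definition vertical_space :: "('i, 'm, 'e::euclidean_space) atlas
    \<Rightarrow> ('i, 'm, 'e) tpoint \<Rightarrow> ('i \<Rightarrow> 'e \<times> 'e) set" where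
  "vertical_space M u = {\<xi> \<in> tangent_space (slit M) u. rho M u \<xi> = 0}"

definition horizontal_space :: "('i, 'm, 'e::euclidean_space) atlas \<Rightarrow> ('i, 'm, 'e) connection
    \<Rightarrow> ('i, 'm, 'e) tpoint \<Rightarrow> ('i \<Rightarrow> 'e \<times> 'e) set" where
  "horizontal_space M D u = {\<xi> \<in> tangent_space (slit M) u. connection_map M D u \<xi> = 0}"

definition regular_connection :: "('i, 'm, 'e::euclidean_space) atlas \<Rightarrow> ('i, 'm, 'e) connection \<Rightarrow> bool" where
  "regular_connection M D \<longleftrightarrow> linear_connection M D \<and>
     (\<forall>u\<in>mcarrier (slit M).
        vertical_space M u \<inter> horizontal_space M D u = {0} \<and>
        (\<forall>\<xi>\<in>tangent_space (slit M) u.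
           \<exists>v\<in>vertical_space M u. \<exists>h\<in>horizontal_space M D u. \<xi> = v + h))"

definition horizontal_map :: "('i, 'm, 'e::euclidean_space) atlas \<Rightarrow> ('i, 'm, 'e) connection
    \<Rightarrow> ('i, 'm, 'e) tpoint \<Rightarrow> ('i \<Rightarrow> 'e) \<Rightarrow> 'i \<Rightarrow> 'e \<times> 'e" where
  "horizontal_map M D u = inv_into (horizontal_space M D u) (rho M u)"

definition horizontal_projector :: "('i, 'm, 'e::euclidean_space) atlas \<Rightarrow> ('i, 'm, 'e) connection
    \<Rightarrow> ('i, 'm, 'e) tpoint \<Rightarrow> ('i \<Rightarrow> 'e \<times> 'e) \<Rightarrow> 'i \<Rightarrow> 'e \<times> 'e" where
  "horizontal_projector M D u \<xi> = horizontal_map M D u (rho M u \<xi>)"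

abbreviation rhoF where "rhoF M \<equiv> fieldwise M (rho M)"
abbreviation gamF where "gamF M \<equiv> fieldwise M (gam M)"
abbreviation betaF where "betaF M D \<equiv> fieldwise M (horizontal_map M D)"
abbreviation KF where "KF M D \<equiv> fieldwise M (connection_map M D)"


section \<open>Torsions and curvature\<close>

definition torsion :: "('i, 'm, 'e::euclidean_space) atlas \<Rightarrow> ('i, 'm, 'e) connection
    \<Rightarrow> ('i, 'm, 'e) tfield \<Rightarrow> ('i, 'm, 'e) tfield \<Rightarrow> ('i, 'm, 'e) psection" where
  "torsion M D X Y = cov M D X (rhoF M Y) - cov M D Y (rhoF M X) - rhoF M (bracket (slit M) X Y)"

text \<open>Every section of the pullback bundle is of the form $\rho Z$, so the last argument of the
  curvature is taken to be a section. The sign convention is the opposite of the usual one.\<close>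

definition curvature :: "('i, 'm, 'e::euclidean_space) atlas \<Rightarrow> ('i, 'm, 'e) connection
    \<Rightarrow> ('i, 'm, 'e) tfield \<Rightarrow> ('i, 'm, 'e) tfield \<Rightarrow> ('i, 'm, 'e) psection \<Rightarrow> ('i, 'm, 'e) psection" where
  "curvature M D X Y Z = - cov M D X (cov M D Y Z) + cov M D Y (cov M D X Z)
     + cov M D (bracket (slit M) X Y) Z"

definition h_torsion :: "('i, 'm, 'e::euclidean_space) atlas \<Rightarrow> ('i, 'm, 'e) connection
    \<Rightarrow> ('i, 'm, 'e) psection \<Rightarrow> ('i, 'm, 'e) psection \<Rightarrow> ('i, 'm, 'e) psection" where
  "h_torsion M D X Y = torsion M D (betaF M D X) (betaF M D Y)"

definition hv_torsion :: "('i, 'm, 'e::euclidean_space) atlas \<Rightarrow> ('i, 'm, 'e) connection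
    \<Rightarrow> ('i, 'm, 'e) psection \<Rightarrow> ('i, 'm, 'e) psection \<Rightarrow> ('i, 'm, 'e) psection" where
  "hv_torsion M D X Y = torsion M D (gamF M X) (betaF M D Y)"

definition vhv_torsion :: "('i, 'm, 'e::euclidean_space) atlas \<Rightarrow> ('i, 'm, 'e) connection
    \<Rightarrow> ('i, 'm, 'e) psection \<Rightarrow> ('i, 'm, 'e) psection \<Rightarrow> ('i, 'm, 'e) psection" where
  "vhv_torsion M D X Y = curvature M D (betaF M D X) (gamF M Y) (fundamental_section M)"


section \<open>Finsler manifolds and their Cartan and Berwald connections\<close>

definition energy :: "(('i, 'm, 'e) tpoint \<Rightarrow> real) \<Rightarrow> ('i, 'm, 'e) tpoint \<Rightarrow> real" where
  "energy L u = (L u)\<^sup>2 / 2"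

text \<open>The fibrewise Hessian of the energy.\<close>

definition finsler_metric :: "(('i, 'm, 'e::euclidean_space) tpoint \<Rightarrow> real)
    \<Rightarrow> ('i, 'm, 'e) tpoint \<Rightarrow> ('i \<Rightarrow> 'e) \<Rightarrow> ('i \<Rightarrow> 'e) \<Rightarrow> real" where
  "finsler_metric L u v w =
     deriv (\<lambda>s. deriv (\<lambda>t. energy L (fst u, snd u + scl s v + scl t w)) 0) 0"

definition finsler_manifold :: "('i, 'm, 'e::euclidean_space) atlas
    \<Rightarrow> (('i, 'm, 'e) tpoint \<Rightarrow> real) \<Rightarrow> bool" where
  "finsler_manifold M L \<longleftrightarrow> smooth_manifold M \<and>
     continuous_map (mtop (tangent_bundle M)) euclideanreal L \<and>
     smooth_fun (slit M) L \<and>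
     (\<forall>u\<in>mcarrier (slit M). L u > 0) \<and>
     (\<forall>(p, v)\<in>mcarrier (tangent_bundle M). \<forall>a>0. L (p, scl a v) = a * L (p, v)) \<and>
     (\<forall>u\<in>mcarrier (slit M). \<forall>v\<in>tangent_space M (fst u). v \<noteq> 0 \<longrightarrow> finsler_metric L u v v > 0)"

text \<open>The Cartan and the Berwald connection are the unique regular connections with the following
  properties.\<close>

definition cartan_connection :: "('i, 'm, 'e::euclidean_space) atlas
    \<Rightarrow> (('i, 'm, 'e) tpoint \<Rightarrow> real) \<Rightarrow> ('i, 'm, 'e) connection \<Rightarrow> bool" where
  "cartan_connection M L D \<longleftrightarrow> regular_connection M D \<and>
     (\<forall>X\<in>vector_fields (slit M). \<forall>Y\<in>psections M. \<forall>Z\<in>psections M. \<forall>u\<in>mcarrier (slit M).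
        fun_differential (slit M) (\<lambda>u. finsler_metric L u (Y u) (Z u)) u (X u)
        - finsler_metric L u (cov M D X Y u) (Z u)
        - finsler_metric L u (Y u) (cov M D X Z u) = 0) \<and>
     (\<forall>X\<in>psections M. \<forall>Y\<in>psections M. h_torsion M D X Y = 0) \<and>
     (\<forall>X\<in>psections M. \<forall>Y\<in>psections M. \<forall>Z\<in>psections M. \<forall>u\<in>mcarrier (slit M).
        finsler_metric L u (hv_torsion M D X Y u) (Z u) =
        finsler_metric L u (hv_torsion M D X Z u) (Y u))"

definition berwald_connection :: "('i, 'm, 'e::euclidean_space) atlas
    \<Rightarrow> (('i, 'm, 'e) tpoint \<Rightarrow> real) \<Rightarrow> ('i, 'm, 'e) connection \<Rightarrow> bool" where
  "berwald_connection M L D \<longleftrightarrow> regular_connection M D \<and>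
     (\<forall>X\<in>vector_fields (slit M). \<forall>u\<in>mcarrier (slit M).
        fun_differential (slit M) L u (horizontal_projector M D u (X u)) = 0) \<and>
     (\<forall>X\<in>vector_fields (slit M). \<forall>Y\<in>vector_fields (slit M). torsion M D X Y = 0) \<and>
     (\<forall>X\<in>psections M. \<forall>Y\<in>psections M. vhv_torsion M D X Y = 0)"

end

theory Submission
  imports Defs
begin

text \<open>
  Let \<open>D\<close> be a regular connection with \<open>K\<gamma>X = X\<close> for all sections \<open>X\<close>. Both connections of the theorem
  are of this kind: \<open>K\<gamma>X - X\<close> is the mixed torsion \<open>T(X, \<eta>)\<close>, which vanishes by definition for the
  Berwald connection, and for the Cartan connection because the metric is homogeneous of degree zero. Since also \<open>\<rho>\<gamma> = 0\<close>,
  \<open>\<rho>\<beta>X = X\<close> and \<open>K\<beta> = 0\<close>, the definitions of torsion and curvature collapse to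
  \<open>T(X, Y) = D\<^bsub>\<gamma>X\<^esub> Y - \<rho>[\<gamma>X, \<beta>Y]\<close> and \<open>P(X, Y) = K[\<beta>X, \<gamma>Y] - D\<^bsub>\<beta>X\<^esub> Y\<close>, where \<open>P\<close> is the (v)hv-torsion
  (\<open>hv_torsion_eq\<close>, \<open>vhv_torsion_eq\<close>). For the Cartan connection this shows that the two expressions
  for \<open>D\<degree>\<close> in (a), and the two in (b), agree. For the Berwald connection both torsions vanish, so
  that \<open>D\<degree>\<^bsub>\<gamma>X\<^esub> Y = \<rho>[\<gamma>X, \<beta>\<degree>Y]\<close> and \<open>D\<degree>\<^bsub>\<beta>\<degree>X\<^esub> Y = K\<degree>[\<beta>\<degree>X, \<gamma>Y]\<close>. Hence (a) and (b) hold as soon as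
  \<open>\<beta> = \<beta>\<degree>\<close> and \<open>K = K\<degree>\<close>. As \<open>K\<close> is the vertical component along the horizontal distribution
  (\<open>KF_component\<close>), the first of these implies the second. The formula for a general field follows
  from \<open>X = \<beta>\<rho>X + \<gamma>KX\<close> (\<open>vector_field_decomposition\<close>).

  It remains to show that both connections have the horizontal distribution of the Barthel
  connection. In a chart with coordinates \<open>(x, y)\<close>, let \<open>e\<close> be the energy, \<open>H\<close> its Hessian and
  \<open>\<beta>X = (X, b\<^sub>X)\<close>. Three conditions determine \<open>b\<close> (locale \<open>barthel\<close>): \<open>de(\<beta>X) = 0\<close>; the symmetry of
  \<open>H((0, Z), \<beta>Y)\<close> in \<open>Y\<close> and \<open>Z\<close>; and a formula for the derivative of the metric along the spray \<open>\<beta>\<eta>\<close>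
  as minus the sum of \<open>g(b\<^sub>Y, Z)\<close> and \<open>g(Y, b\<^sub>Z)\<close>. The first two fix \<open>b\<^sub>\<eta>\<close>. Then the difference of two
  solutions is self-adjoint by the second condition and anti-self-adjoint by the third, hence 0
  (\<open>barthel_unique\<close>). For the Cartan connection the conditions are instances of \<open>\<nabla>g = 0\<close>, combined with
  \<open>Q = 0\<close> and Euler's relations for \<open>e\<close>. For the Berwald connection the first is part of the definition,
  the second is its vertical derivative, and the third is the vertical derivative of the equation
  for \<open>b\<^sub>\<eta>\<close>.

  All identities are derived for global sections. Where nondegeneracy of the metric calls for a
  section with a particular value, that section is itself produced by the connections, as a torsion
  or as a difference of two horizontal lifts. This requires horizontal lifts, covariant derivatives
  and brackets of smooth fields to be smooth: horizontal lifts solve a linear system with smooth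
  coefficients (\<open>smooth_on_linear_solve\<close>), and brackets are independent of the chart because second
  derivatives are symmetric (\<open>second_derivative_symmetric\<close>).
\<close>

section \<open>Calculus of smooth functions\<close>

abbreviation dder :: "('a::real_normed_vector \<Rightarrow> 'b::real_normed_vector) \<Rightarrow> 'a \<Rightarrow> 'a \<Rightarrow> 'b"
  where "dder f z \<equiv> frechet_derivative f (at z)"

lemma dder_eqI: "(f has_derivative f') (at z) \<Longrightarrow> dder f z = f'"
  by (metis frechet_derivative_at)

lemma has_derivative_dder: "f differentiable (at z) \<Longrightarrow> (f has_derivative dder f z) (at z)"
  by (simp add: frechet_derivative_works)

lemma bounded_linear_dder: "f differentiable (at z) \<Longrightarrow> bounded_linear (dder f z)"
  using has_derivative_dder has_derivative_bounded_linear by blast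

lemma has_derivative_cong_open:
  assumes "open S" "z \<in> S" "\<And>x. x \<in> S \<Longrightarrow> f x = g x"
  shows "(f has_derivative f') (at z) \<longleftrightarrow> (g has_derivative f') (at z)"
proof
  show "(g has_derivative f') (at z)" if "(f has_derivative f') (at z)"
    by (rule has_derivative_transform_within_open[OF that assms(1,2)]) (simp add: assms(3))
  show "(f has_derivative f') (at z)" if "(g has_derivative f') (at z)"
    by (rule has_derivative_transform_within_open[OF that assms(1,2)]) (simp add: assms(3))
qed

lemma differentiable_cong_open:
  assumes "open S" "z \<in> S" "\<And>x. x \<in> S \<Longrightarrow> f x = g x"
  shows "f differentiable (at z) \<longleftrightarrow> g differentiable (at z)"
  using has_derivative_cong_open[OF assms] by (simp add: differentiable_def)

lemma dder_cong_open:
  assumes "open S" "z \<in> S" "\<And>x. x \<in> S \<Longrightarrow> f x = g x"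
  shows "dder f z = dder g z"
  using has_derivative_cong_open[OF assms] by (simp add: frechet_derivative_def)

lemma Ck_on_cong:
  assumes "open S" "\<And>x. x \<in> S \<Longrightarrow> f x = g x"
  shows "Ck_on k S f \<longleftrightarrow> Ck_on k S g"
  using assms(2)
proof (induction k arbitrary: f g)
  case 0
  then show ?case by (simp cong: continuous_on_cong)
next
  case (Suc k)
  have "Ck_on k S (\<lambda>x. dder f x v) \<longleftrightarrow> Ck_on k S (\<lambda>x. dder g x v)" for v
    by (rule Suc.IH) (use dder_cong_open[OF assms(1) _ Suc.prems] in auto)
  then show ?case
    using differentiable_cong_open[OF assms(1) _ Suc.prems] by auto
qed

lemma Ck_on_SucD: "Ck_on (Suc k) S f \<Longrightarrow> Ck_on k S f"
proof (induction k arbitrary: f)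
  case 0
  then show ?case
    by (auto intro!: continuous_at_imp_continuous_on differentiable_imp_continuous_within)
qed auto

lemma Ck_on_const: "Ck_on k S (\<lambda>_. c)"
  by (induction k arbitrary: c) auto

lemma Ck_on_bounded_linear: assumes "bounded_linear L" shows "Ck_on k S L"
proof (cases k)
  case 0
  then show ?thesis
    using assms by (simp add: linear_continuous_on)
next
  case (Suc n)
  have "dder L x = L" for x
    by (rule dder_eqI) (rule bounded_linear_imp_has_derivative[OF assms])
  then show ?thesis
    using Suc bounded_linear_imp_differentiable[OF assms] by (auto intro: Ck_on_const)
qed

lemma Ck_on_bounded_linear_comp:
  assumes "open S" "bounded_linear L" "Ck_on k S f"
  shows "Ck_on k S (\<lambda>x. L (f x))"
  using assms(3)
proof (induction k arbitrary: f)
  case 0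
  then show ?case by (simp add: bounded_linear.continuous_on[OF assms(2)])
next
  case (Suc k)
  have der: "((\<lambda>x. L (f x)) has_derivative (\<lambda>v. L (dder f x v))) (at x)" if "x \<in> S" for x
    using Suc.prems that
    by (auto intro!: bounded_linear.has_derivative[OF assms(2)] has_derivative_dder)
  have "Ck_on k S (\<lambda>x. dder (\<lambda>x. L (f x)) x v)" for v
    using Suc.IH[of "\<lambda>x. dder f x v"] Suc.prems
    by (subst Ck_on_cong[OF assms(1), of _ "\<lambda>x. L (dder f x v)"]) (auto simp: dder_eqI[OF der])
  then show ?case using der by (auto simp: differentiable_def)
qed

lemma Ck_on_add:
  assumes "open S" "Ck_on k S f" "Ck_on k S g"
  shows "Ck_on k S (\<lambda>x. f x + g x)"
  using assms(2,3)
proof (induction k arbitrary: f g)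
  case 0
  then show ?case by (simp add: continuous_on_add)
next
  case (Suc k)
  have der: "((\<lambda>x. f x + g x) has_derivative (\<lambda>v. dder f x v + dder g x v)) (at x)"
    if "x \<in> S" for x
    using Suc.prems that by (auto intro!: has_derivative_add has_derivative_dder)
  have "Ck_on k S (\<lambda>x. dder (\<lambda>x. f x + g x) x v)" for v
    using Suc.IH[of "\<lambda>x. dder f x v" "\<lambda>x. dder g x v"] Suc.prems
    by (subst Ck_on_cong[OF assms(1), of _ "\<lambda>x. dder f x v + dder g x v"])
      (auto simp: dder_eqI[OF der])
  then show ?case using der by (auto simp: differentiable_def)
qed

lemma Ck_on_bilinear:
  assumes "open S" "bounded_bilinear P" "Ck_on k S f" "Ck_on k S g"
  shows "Ck_on k S (\<lambda>x. P (f x) (g x))"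
  using assms(3,4)
proof (induction k arbitrary: f g)
  case 0
  then show ?case by (simp add: bounded_bilinear.continuous_on[OF assms(2)])
next
  case (Suc k)
  have der: "((\<lambda>x. P (f x) (g x)) has_derivative (\<lambda>v. P (f x) (dder g x v) + P (dder f x v) (g x))) (at x)"
    if "x \<in> S" for x
    using Suc.prems that
    by (auto intro!: bounded_bilinear.FDERIV[OF assms(2)] has_derivative_dder)
  have "Ck_on k S (\<lambda>x. dder (\<lambda>x. P (f x) (g x)) x v)" for v
  proof -
    have "Ck_on k S f" "Ck_on k S g"
      using Suc.prems by (blast intro: Ck_on_SucD)+
    then have "Ck_on k S (\<lambda>x. P (f x) (dder g x v) + P (dder f x v) (g x))"
      using Suc.IH[of f "\<lambda>x. dder g x v"] Suc.IH[of "\<lambda>x. dder f x v" g] Suc.prems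
      by (intro Ck_on_add[OF assms(1)]) auto
    then show ?thesis
      by (subst Ck_on_cong[OF assms(1)]) (auto simp: dder_eqI[OF der])
  qed
  then show ?case using der by (auto simp: differentiable_def)
qed

lemma Ck_on_sum:
  assumes "open S" "finite I" "\<And>i. i \<in> I \<Longrightarrow> Ck_on k S (f i)"
  shows "Ck_on k S (\<lambda>x. \<Sum>i\<in>I. f i x)"
  using assms(2,3)
proof (induction I rule: finite_induct)
  case empty
  show ?case by (simp add: Ck_on_const)
next
  case (insert i I)
  have "Ck_on k S (\<lambda>x. f i x + (\<Sum>i\<in>I. f i x))"
    using insert by (intro Ck_on_add[OF assms(1)]) auto
  then show ?case using insert(1,2) by simp
qed

lemma linear_euclidean_expansion:
  fixes A :: "'a::euclidean_space \<Rightarrow> 'b::real_vector"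
  assumes "linear A"
  shows "A v = (\<Sum>b\<in>Basis. (v \<bullet> b) *\<^sub>R A b)"
proof -
  have "A v = A (\<Sum>b\<in>Basis. (v \<bullet> b) *\<^sub>R b)"
    by (simp only: euclidean_representation)
  also have "\<dots> = (\<Sum>b\<in>Basis. A ((v \<bullet> b) *\<^sub>R b))"
    by (rule linear_sum[OF assms])
  also have "\<dots> = (\<Sum>b\<in>Basis. (v \<bullet> b) *\<^sub>R A b)"
    by (intro sum.cong refl linear_scale[OF assms])
  finally show ?thesis .
qed

text \<open>The derivative of \<open>f \<circ> g\<close> in a direction is a sum over a basis of products of directional
  derivatives of \<open>g\<close> with directional derivatives of \<open>f\<close> composed with \<open>g\<close>. The latter are again
  compositions, of class one lower, so the induction is over all \<open>f\<close> for a fixed \<open>g\<close>.\<close>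

lemma Ck_on_compose:
  assumes "open S" "open T" "g ` S \<subseteq> T" "Ck_on k T f" "Ck_on k S g"
  shows "Ck_on k S (\<lambda>x. f (g x))"
  using assms(4,5)
proof (induction k arbitrary: f)
  case 0
  then show ?case
    using assms(3) by (auto intro: continuous_on_compose2)
next
  case (Suc k)
  have der: "((\<lambda>x. f (g x)) has_derivative (\<lambda>v. dder f (g x) (dder g x v))) (at x)"
    if "x \<in> S" for x
  proof -
    have "g x \<in> T" using that assms(3) by blast
    then show ?thesis
      using Suc.prems that
      by (intro has_derivative_compose[where f=g and g=f, OF has_derivative_dder has_derivative_dder]) auto
  qed
  have "Ck_on k S (\<lambda>x. dder (\<lambda>x. f (g x)) x v)" for v
  proof -
    have *: "dder f (g x) w = (\<Sum>b\<in>Basis. (w \<bullet> b) *\<^sub>R dder f (g x) b)" if "x \<in> S" for x w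
      using that Suc.prems(1) assms(3)
      by (intro linear_euclidean_expansion bounded_linear.linear bounded_linear_dder) auto
    have "Ck_on k S (\<lambda>x. \<Sum>b\<in>Basis. (dder g x v \<bullet> b) *\<^sub>R dder f (g x) b)"
    proof (intro Ck_on_sum assms Ck_on_bilinear[OF assms(1) bounded_bilinear_scaleR])
      fix b :: 'b
      show "Ck_on k S (\<lambda>x. dder g x v \<bullet> b)"
        using Suc.prems
        by (intro Ck_on_bounded_linear_comp[OF assms(1) bounded_linear_inner_left]) auto
      show "Ck_on k S (\<lambda>x. dder f (g x) b)"
        using Suc.prems(1) by (intro Suc.IH[of "\<lambda>x. dder f x b"] Ck_on_SucD[OF Suc.prems(2)]) auto
    qed simp
    then show ?thesis
      using * by (subst Ck_on_cong[OF assms(1)]) (auto simp: dder_eqI[OF der])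
  qed
  then show ?case using der by (auto simp: differentiable_def)
qed

lemma smooth_on_cong: "open S \<Longrightarrow> (\<And>x. x \<in> S \<Longrightarrow> f x = g x) \<Longrightarrow> smooth_on S f \<longleftrightarrow> smooth_on S g"
  using Ck_on_cong unfolding smooth_on_def by blast

lemma smooth_on_differentiable: "smooth_on S f \<Longrightarrow> x \<in> S \<Longrightarrow> f differentiable (at x)"
  unfolding smooth_on_def by (metis Ck_on.simps(2))

lemma smooth_on_has_derivative: "smooth_on S f \<Longrightarrow> x \<in> S \<Longrightarrow> (f has_derivative dder f x) (at x)"
  by (simp add: has_derivative_dder smooth_on_differentiable)

lemma smooth_on_dder_const: "smooth_on S f \<Longrightarrow> smooth_on S (\<lambda>x. dder f x v)"
  unfolding smooth_on_def by (metis Ck_on.simps(2))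

lemma smooth_on_const: "smooth_on S (\<lambda>_. c)"
  by (simp add: smooth_on_def Ck_on_const)

lemma smooth_on_bounded_linear: "bounded_linear L \<Longrightarrow> smooth_on S L"
  by (simp add: smooth_on_def Ck_on_bounded_linear)

lemma smooth_on_bounded_linear_comp:
  "bounded_linear L \<Longrightarrow> open S \<Longrightarrow> smooth_on S f \<Longrightarrow> smooth_on S (\<lambda>x. L (f x))"
  by (simp add: smooth_on_def Ck_on_bounded_linear_comp)

lemma smooth_on_bilinear:
  "bounded_bilinear P \<Longrightarrow> open S \<Longrightarrow> smooth_on S f \<Longrightarrow> smooth_on S g
    \<Longrightarrow> smooth_on S (\<lambda>x. P (f x) (g x))"
  by (simp add: smooth_on_def Ck_on_bilinear)

lemma smooth_on_add: "open S \<Longrightarrow> smooth_on S f \<Longrightarrow> smooth_on S g \<Longrightarrow> smooth_on S (\<lambda>x. f x + g x)"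
  by (simp add: smooth_on_def Ck_on_add)

lemma smooth_on_sum:
  "open S \<Longrightarrow> finite I \<Longrightarrow> (\<And>i. i \<in> I \<Longrightarrow> smooth_on S (f i)) \<Longrightarrow> smooth_on S (\<lambda>x. \<Sum>i\<in>I. f i x)"
  by (simp add: smooth_on_def Ck_on_sum)

lemma smooth_on_compose:
  "open S \<Longrightarrow> open T \<Longrightarrow> g ` S \<subseteq> T \<Longrightarrow> smooth_on T f \<Longrightarrow> smooth_on S g
    \<Longrightarrow> smooth_on S (\<lambda>x. f (g x))"
  unfolding smooth_on_def using Ck_on_compose by blast

lemma smooth_on_minus: "open S \<Longrightarrow> smooth_on S f \<Longrightarrow> smooth_on S (\<lambda>x. - f x)"
  by (rule smooth_on_bounded_linear_comp[OF bounded_linear_minus[OF bounded_linear_ident]])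

lemma smooth_on_diff:
  "open S \<Longrightarrow> smooth_on S f \<Longrightarrow> smooth_on S g \<Longrightarrow> smooth_on S (\<lambda>x. f x - g x)"
  using smooth_on_add[OF _ _ smooth_on_minus, of S f g] by simp

lemma smooth_on_fst: "open S \<Longrightarrow> smooth_on S f \<Longrightarrow> smooth_on S (\<lambda>x. fst (f x))"
  by (rule smooth_on_bounded_linear_comp[OF bounded_linear_fst])

lemma smooth_on_snd: "open S \<Longrightarrow> smooth_on S f \<Longrightarrow> smooth_on S (\<lambda>x. snd (f x))"
  by (rule smooth_on_bounded_linear_comp[OF bounded_linear_snd])

lemma smooth_on_Pair:
  assumes "open S" "smooth_on S f" "smooth_on S g"
  shows "smooth_on S (\<lambda>x. (f x, g x))"
proof -
  have "smooth_on S (\<lambda>x. (f x, 0) + (0, g x))"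
    using assms
    by (intro smooth_on_add smooth_on_bounded_linear_comp[of "\<lambda>v. (v, 0)"]
        smooth_on_bounded_linear_comp[of "\<lambda>v. (0, v)"] bounded_linear_Pair bounded_linear_ident bounded_linear_zero)
  then show ?thesis by simp
qed

text \<open>Expanding the argument in a basis reduces the claim to finitely many constant arguments.\<close>

lemma smooth_on_linear_family:
  fixes A :: "'a::euclidean_space \<Rightarrow> 'b::euclidean_space \<Rightarrow> 'c::euclidean_space"
  assumes "open S" "\<And>x. x \<in> S \<Longrightarrow> linear (A x)" "\<And>b. smooth_on S (\<lambda>x. A x b)" "smooth_on S f"
  shows "smooth_on S (\<lambda>x. A x (f x))"
proof -
  have "smooth_on S (\<lambda>x. \<Sum>b\<in>Basis. (f x \<bullet> b) *\<^sub>R A x b)"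
    using assms
    by (intro smooth_on_sum smooth_on_bilinear[OF bounded_bilinear_scaleR]
        smooth_on_bounded_linear_comp[OF bounded_linear_inner_left]) auto
  then show ?thesis
    using linear_euclidean_expansion[OF assms(2)] by (subst smooth_on_cong[OF assms(1)]) auto
qed

lemma smooth_on_dder:
  assumes "open S" "smooth_on S f" "smooth_on S g"
  shows "smooth_on S (\<lambda>x. dder f x (g x))"
proof (rule smooth_on_linear_family[OF assms(1) _ _ assms(3)])
  show "linear (dder f x)" if "x \<in> S" for x
    by (intro bounded_linear.linear bounded_linear_dder smooth_on_differentiable[OF assms(2) that])
  show "smooth_on S (\<lambda>x. dder f x b)" for b
    by (rule smooth_on_dder_const[OF assms(2)])
qed

text \<open>The product rule for the application of a field of linear maps to a field of vectors.\<close>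

lemma has_derivative_linear_family:
  fixes A :: "'a::euclidean_space \<Rightarrow> 'b::euclidean_space \<Rightarrow> 'c::euclidean_space"
  assumes "open S" "z \<in> S" "\<And>x. x \<in> S \<Longrightarrow> linear (A x)"
    and A: "\<And>v. ((\<lambda>x. A x v) has_derivative A' v) (at z)"
    and f: "(f has_derivative f') (at z)"
  shows "((\<lambda>x. A x (f x)) has_derivative (\<lambda>c. A' (f z) c + A z (f' c))) (at z)"
proof -
  have expand: "A x v = (\<Sum>b\<in>Basis. (v \<bullet> b) *\<^sub>R A x b)" if "x \<in> S" for x v
    by (rule linear_euclidean_expansion[OF assms(3)[OF that]])
  have A'f: "A' v c = (\<Sum>b\<in>Basis. (v \<bullet> b) *\<^sub>R A' b c)" for v c
  proof -
    have "((\<lambda>x. \<Sum>b\<in>Basis. (v \<bullet> b) *\<^sub>R A x b) has_derivative (\<lambda>c. \<Sum>b\<in>Basis. (v \<bullet> b) *\<^sub>R A' b c)) (at z)"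
      by (intro has_derivative_sum has_derivative_scaleR_right A)
    then have "((\<lambda>x. A x v) has_derivative (\<lambda>c. \<Sum>b\<in>Basis. (v \<bullet> b) *\<^sub>R A' b c)) (at z)"
      by (rule has_derivative_cong_open[OF assms(1,2), THEN iffD2, rotated]) (rule expand)
    from has_derivative_unique[OF A this] show ?thesis by (rule fun_cong)
  qed
  have "((\<lambda>x. \<Sum>b\<in>Basis. (f x \<bullet> b) *\<^sub>R A x b) has_derivative
      (\<lambda>c. \<Sum>b\<in>Basis. (f z \<bullet> b) *\<^sub>R A' b c + (f' c \<bullet> b) *\<^sub>R A z b)) (at z)"
    by (intro has_derivative_sum has_derivative_scaleR A has_derivative_inner_left f)
  moreover have "(\<Sum>b\<in>Basis. (f z \<bullet> b) *\<^sub>R A' b c + (f' c \<bullet> b) *\<^sub>R A z b) = A' (f z) c + A z (f' c)" for c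
    using A'f[of "f z" c] expand[OF assms(2), of "f' c"] by (simp add: sum.distrib)
  ultimately have "((\<lambda>x. \<Sum>b\<in>Basis. (f x \<bullet> b) *\<^sub>R A x b) has_derivative
      (\<lambda>c. A' (f z) c + A z (f' c))) (at z)" by simp
  then show ?thesis
    by (rule has_derivative_cong_open[OF assms(1,2), THEN iffD2, rotated]) (rule expand)
qed

text \<open>The second difference of \<open>f\<close> along \<open>a\<close> and \<open>b\<close> is symmetric in \<open>a\<close> and \<open>b\<close>, and by the mean
  value theorem in the direction \<open>b\<close> it is asymptotic to the iterated derivative, first along \<open>b\<close>
  and then along \<open>a\<close>.\<close>

lemma second_difference_estimate:
  fixes f :: "'a::euclidean_space \<Rightarrow> real"
  assumes S: "open S" "z \<in> S" and f: "\<And>x. x \<in> S \<Longrightarrow> f differentiable (at x)"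
    and g: "((\<lambda>x. dder f x b) has_derivative g') (at z)" and "e > 0"
  shows "\<exists>d>0. \<forall>t. 0 < t \<and> t < d \<longrightarrow>
    \<bar>f (z + t *\<^sub>R a + t *\<^sub>R b) - f (z + t *\<^sub>R a) - f (z + t *\<^sub>R b) + f z - t\<^sup>2 * g' a\<bar> \<le> e * t\<^sup>2"
proof -
  define C where "C = norm a + norm b + 1"
  have C: "C > 0" unfolding C_def using norm_ge_zero[of a] norm_ge_zero[of b] by linarith
  have lin: "bounded_linear g'" using g has_derivative_bounded_linear by blast
  define e' where "e' = e / (2 * C)"
  have "e' > 0" using C \<open>e > 0\<close> by (simp add: e'_def)
  then obtain d1 where d1: "d1 > 0" "\<And>y. norm (y - z) < d1 \<Longrightarrow>
      \<bar>dder f y b - dder f z b - g' (y - z)\<bar> \<le> e' * norm (y - z)"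
    using g unfolding has_derivative_at_alt by (metis real_norm_def)
  obtain d2 where d2: "d2 > 0" "ball z d2 \<subseteq> S"
    using S open_contains_ball by blast
  define d where "d = min d1 d2 / C"
  have "d > 0" using d1 d2 C by (simp add: d_def)
  moreover have "\<bar>f (z + t *\<^sub>R a + t *\<^sub>R b) - f (z + t *\<^sub>R a) - f (z + t *\<^sub>R b) + f z - t\<^sup>2 * g' a\<bar> \<le> e * t\<^sup>2"
    if t: "0 < t" "t < d" for t
  proof -
    have tC: "t * C < d1" "t * C < d2"
      using t C by (auto simp: d_def field_simps min_def split: if_splits)
    have small: "norm (t *\<^sub>R (c *\<^sub>R a) + t *\<^sub>R (s *\<^sub>R b)) \<le> t * C" if "0 \<le> s" "s \<le> 1" "0 \<le> c" "c \<le> 1" for s c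
    proof -
      have "norm (t *\<^sub>R (c *\<^sub>R a) + t *\<^sub>R (s *\<^sub>R b)) \<le> t * (c * norm a) + t * (s * norm b)"
        using t that by (intro order_trans[OF norm_triangle_ineq]) auto
      also have "\<dots> \<le> t * norm a + t * norm b"
        using t that by (intro add_mono mult_left_mono mult_left_le_one_le) auto
      also have "\<dots> \<le> t * C" using t by (simp add: C_def algebra_simps)
      finally show ?thesis .
    qed
    have inS: "z + t *\<^sub>R (c *\<^sub>R a) + t *\<^sub>R (s *\<^sub>R b) \<in> S" if "0 \<le> s" "s \<le> 1" "0 \<le> c" "c \<le> 1" for s c
      using small[OF that] tC(2) d2(2) by (auto simp: dist_norm subset_iff algebra_simps norm_minus_commute)
    define h where "h s = f (z + t *\<^sub>R a + t *\<^sub>R (s *\<^sub>R b)) - f (z + t *\<^sub>R (s *\<^sub>R b))" for s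
    have der: "(h has_real_derivative
        t * (dder f (z + t *\<^sub>R a + t *\<^sub>R (s *\<^sub>R b)) b - dder f (z + t *\<^sub>R (s *\<^sub>R b)) b)) (at s)"
      if s: "0 \<le> s" "s \<le> 1" for s
    proof -
      have *: "((\<lambda>s. f (w + t *\<^sub>R (s *\<^sub>R b))) has_derivative
          (\<lambda>c. dder f (w + t *\<^sub>R (s *\<^sub>R b)) (t *\<^sub>R (c *\<^sub>R b)))) (at s)"
        if "w + t *\<^sub>R (s *\<^sub>R b) \<in> S" for w
      proof (rule has_derivative_compose[where f="\<lambda>s. w + t *\<^sub>R (s *\<^sub>R b)" and g=f, OF _ has_derivative_dder[OF f[OF that]]])
        have "bounded_linear (\<lambda>c. t *\<^sub>R (c *\<^sub>R b))"
          by (intro bounded_linear_const_scaleR bounded_linear_scaleR_left)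
        then have "((\<lambda>s. t *\<^sub>R (s *\<^sub>R b)) has_derivative (\<lambda>c. t *\<^sub>R (c *\<^sub>R b))) (at s)"
          by (rule bounded_linear_imp_has_derivative)
        from has_derivative_add[OF has_derivative_const[of w] this]
        show "((\<lambda>s. w + t *\<^sub>R (s *\<^sub>R b)) has_derivative (\<lambda>c. t *\<^sub>R (c *\<^sub>R b))) (at s)" by simp
      qed
      have lin': "dder f w (t *\<^sub>R (c *\<^sub>R b)) = t * c * dder f w b" if "w \<in> S" for w c
        using linear_scale[OF bounded_linear.linear[OF bounded_linear_dder[OF f[OF that]]]]
        by (simp del: scaleR_scaleR)
      have "(h has_derivative (\<lambda>c. t * c * dder f (z + t *\<^sub>R a + t *\<^sub>R (s *\<^sub>R b)) b
          - t * c * dder f (z + t *\<^sub>R (s *\<^sub>R b)) b)) (at s)"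
        unfolding h_def
        using has_derivative_diff[OF *[of "z + t *\<^sub>R a"] *[of z]] inS[OF s, of 1] inS[OF s, of 0]
        by (simp add: lin' del: scaleR_scaleR)
      then show ?thesis
        unfolding has_field_derivative_def
        by (rule has_derivative_eq_rhs) (simp add: fun_eq_iff algebra_simps)
    qed
    obtain s where s: "0 < s" "s < 1" and hs: "h 1 - h 0 =
        t * (dder f (z + t *\<^sub>R a + t *\<^sub>R (s *\<^sub>R b)) b - dder f (z + t *\<^sub>R (s *\<^sub>R b)) b)"
      using MVT2[of 0 1 h, OF _ der] by auto
    have est: "\<bar>dder f (z + w) b - dder f z b - g' w\<bar> \<le> e' * (t * C)" if "norm w \<le> t * C" for w
      using d1(2)[of "z + w"] that tC(1) \<open>e' > 0\<close>
      by (auto intro: order_trans[OF _ mult_left_mono])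
    have "\<bar>dder f (z + (t *\<^sub>R a + t *\<^sub>R (s *\<^sub>R b))) b - dder f z b - g' (t *\<^sub>R a + t *\<^sub>R (s *\<^sub>R b))\<bar> \<le> e' * (t * C)"
      "\<bar>dder f (z + t *\<^sub>R (s *\<^sub>R b)) b - dder f z b - g' (t *\<^sub>R (s *\<^sub>R b))\<bar> \<le> e' * (t * C)"
      using small[of s 1] small[of s 0] s by (auto intro!: est simp del: scaleR_scaleR)
    moreover have "g' (t *\<^sub>R a + t *\<^sub>R (s *\<^sub>R b)) - g' (t *\<^sub>R (s *\<^sub>R b)) = t * g' a"
      using linear_add[OF bounded_linear.linear[OF lin]] linear_scale[OF bounded_linear.linear[OF lin], of t a]
      by (simp del: scaleR_scaleR)
    ultimately have "\<bar>dder f (z + t *\<^sub>R a + t *\<^sub>R (s *\<^sub>R b)) b - dder f (z + t *\<^sub>R (s *\<^sub>R b)) b - t * g' a\<bar>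
        \<le> 2 * (e' * (t * C))"
      by (simp add: add.assoc del: scaleR_scaleR)
    also have "\<dots> = e * t" using C by (simp add: e'_def)
    finally have "t * \<bar>dder f (z + t *\<^sub>R a + t *\<^sub>R (s *\<^sub>R b)) b - dder f (z + t *\<^sub>R (s *\<^sub>R b)) b - t * g' a\<bar>
        \<le> t * (e * t)" using t by (intro mult_left_mono) auto
    moreover have "h 1 - h 0 - t\<^sup>2 * g' a =
        t * (dder f (z + t *\<^sub>R a + t *\<^sub>R (s *\<^sub>R b)) b - dder f (z + t *\<^sub>R (s *\<^sub>R b)) b - t * g' a)"
      unfolding hs by (simp add: power2_eq_square algebra_simps del: scaleR_scaleR)
    ultimately have "\<bar>h 1 - h 0 - t\<^sup>2 * g' a\<bar> \<le> e * t\<^sup>2"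
      using t by (simp add: abs_mult power2_eq_square mult_ac del: scaleR_scaleR)
    then show ?thesis by (simp add: h_def algebra_simps)
  qed
  ultimately show ?thesis by blast
qed

text \<open>Both iterated derivatives are limits of the same second difference, divided by \<open>t\<^sup>2\<close>.\<close>

lemma second_derivative_symmetric_real:
  fixes f :: "'a::euclidean_space \<Rightarrow> real"
  assumes S: "open S" "z \<in> S" and f: "smooth_on S f"
  shows "dder (\<lambda>x. dder f x b) z a = dder (\<lambda>x. dder f x a) z b" (is "?p = ?q")
proof (rule ccontr)
  assume "?p \<noteq> ?q"
  define e where "e = \<bar>?p - ?q\<bar> / 3"
  have e: "e > 0" using \<open>?p \<noteq> ?q\<close> by (simp add: e_def)
  have diff: "\<And>x. x \<in> S \<Longrightarrow> f differentiable (at x)"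
    using f smooth_on_differentiable by blast
  have der: "((\<lambda>x. dder f x c) has_derivative dder (\<lambda>x. dder f x c) z) (at z)" for c
    using smooth_on_dder_const[OF f] S smooth_on_has_derivative by blast
  obtain d1 where d1: "d1 > 0" "\<And>t. 0 < t \<Longrightarrow> t < d1 \<Longrightarrow>
      \<bar>f (z + t *\<^sub>R a + t *\<^sub>R b) - f (z + t *\<^sub>R a) - f (z + t *\<^sub>R b) + f z - t\<^sup>2 * ?p\<bar> \<le> e * t\<^sup>2"
    using second_difference_estimate[OF S diff der[of b] e, of a] by blast
  obtain d2 where d2: "d2 > 0" "\<And>t. 0 < t \<Longrightarrow> t < d2 \<Longrightarrow>
      \<bar>f (z + t *\<^sub>R b + t *\<^sub>R a) - f (z + t *\<^sub>R b) - f (z + t *\<^sub>R a) + f z - t\<^sup>2 * ?q\<bar> \<le> e * t\<^sup>2"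
    using second_difference_estimate[OF S diff der[of a] e, of b] by blast
  obtain t where t: "0 < t" "t < d1" "t < d2"
    using d1(1) d2(1) by (metis field_lbound_gt_zero)
  have *: "f (z + t *\<^sub>R b + t *\<^sub>R a) = f (z + t *\<^sub>R a + t *\<^sub>R b)" by (simp add: algebra_simps)
  have "\<bar>t\<^sup>2 * ?p - t\<^sup>2 * ?q\<bar> \<le> 2 * (e * t\<^sup>2)"
    using d1(2)[OF t(1,2)] d2(2)[OF t(1,3)] unfolding * by linarith
  also have "\<bar>t\<^sup>2 * ?p - t\<^sup>2 * ?q\<bar> = t\<^sup>2 * \<bar>?p - ?q\<bar>"
    by (simp add: abs_mult flip: right_diff_distrib)
  finally have "t\<^sup>2 * (3 * e) \<le> t\<^sup>2 * (2 * e)" by (simp add: e_def algebra_simps)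
  then show False using e t by simp
qed

lemma second_derivative_symmetric:
  fixes f :: "'a::euclidean_space \<Rightarrow> 'b::euclidean_space"
  assumes S: "open S" "z \<in> S" and f: "smooth_on S f"
  shows "dder (\<lambda>x. dder f x b) z a = dder (\<lambda>x. dder f x a) z b"
proof (rule euclidean_eqI)
  fix c :: 'b assume "c \<in> Basis"
  have comp: "dder (\<lambda>x. g x \<bullet> c) x v = dder g x v \<bullet> c" if "smooth_on S g" "x \<in> S" for g x v
  proof -
    have "((\<lambda>x. g x \<bullet> c) has_derivative (\<lambda>v. dder g x v \<bullet> c)) (at x)"
      by (rule has_derivative_inner_left[OF smooth_on_has_derivative[OF that]])
    then show ?thesis by (metis dder_eqI)
  qed
  have sym: "dder (\<lambda>x. dder (\<lambda>x. f x \<bullet> c) x b) z a = dder (\<lambda>x. dder (\<lambda>x. f x \<bullet> c) x a) z b"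
    by (intro second_derivative_symmetric_real[OF S]
        smooth_on_bounded_linear_comp[OF bounded_linear_inner_left] S f)
  have "dder (\<lambda>x. dder (\<lambda>x. f x \<bullet> c) x v) z w = dder (\<lambda>x. dder f x v) z w \<bullet> c" for v w
  proof -
    have "dder (\<lambda>x. dder (\<lambda>x. f x \<bullet> c) x v) z = dder (\<lambda>x. dder f x v \<bullet> c) z"
      by (rule dder_cong_open[OF S]) (simp add: comp f)
    then show ?thesis using comp[OF smooth_on_dder_const[OF f] S(2)] by simp
  qed
  then show "dder (\<lambda>x. dder f x b) z a \<bullet> c = dder (\<lambda>x. dder f x a) z b \<bullet> c"
    using sym by simp
qed

text \<open>Solutions of a linear system with smooth coefficients. If \<open>B x (w x) = r x\<close>, then \<open>w x - w z\<close>
  equals \<open>I (r x - B x (w z))\<close>, where \<open>I\<close> inverts \<open>B z\<close>, up to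
  \<open>I ((B x - B z) (w x - w z))\<close>. The latter is small against \<open>w x - w z\<close>, which first bounds
  \<open>w x - w z\<close> by a multiple of \<open>x - z\<close> and then shows that the error has vanishing derivative.\<close>

lemma linear_solve_has_derivative:
  fixes B :: "'a::euclidean_space \<Rightarrow> 'b::euclidean_space \<Rightarrow> 'b"
  assumes S: "open S" "z \<in> S" and lin: "\<And>x. x \<in> S \<Longrightarrow> linear (B x)"
    and diff: "\<And>b. (\<lambda>x. B x b) differentiable (at z)" and r: "r differentiable (at z)"
    and sol: "\<And>x. x \<in> S \<Longrightarrow> B x (w x) = r x"
    and I: "linear I" "\<And>v. I (B z v) = v"
  shows "(w has_derivative (\<lambda>c. I (dder r z c - dder (\<lambda>x. B x (w z)) z c))) (at z)"
proof -
  define h where "h x = r x - B x (w z)" for x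
  define h' where "h' c = dder r z c - dder (\<lambda>x. B x (w z)) z c" for c
  define E where "E x = (\<Sum>b\<in>Basis. norm (B x b - B z b))" for x
  define R where "R x = I ((B x - B z) (w x - w z))" for x
  have h: "(h has_derivative h') (at z)"
    unfolding h_def h'_def by (intro has_derivative_diff has_derivative_dder diff r)
  have hz: "h z = 0" using sol[OF S(2)] by (simp add: h_def)
  obtain M where M: "M > 0" "\<And>v. norm (I v) \<le> M * norm v"
    using linear_bounded_pos[OF I(1)] by blast
  have E_ge: "E x \<ge> 0" for x by (simp add: E_def sum_nonneg)
  have E: "norm ((B x - B z) v) \<le> E x * norm v" if x: "x \<in> S" for x v
  proof -
    have "(B x - B z) v = (\<Sum>b\<in>Basis. (v \<bullet> b) *\<^sub>R (B x b - B z b))"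
      using linear_euclidean_expansion[OF lin[OF x], of v]
        linear_euclidean_expansion[OF lin[OF S(2)], of v]
      by (simp add: scaleR_diff_right sum_subtractf)
    also have "norm \<dots> \<le> (\<Sum>b\<in>Basis. norm v * norm (B x b - B z b))"
      by (intro sum_norm_le) (simp add: Basis_le_norm mult_right_mono)
    finally show ?thesis by (simp add: E_def sum_distrib_left mult.commute)
  qed
  have "((\<lambda>x. B x b) \<longlongrightarrow> B z b) (at z)" for b
    using differentiable_imp_continuous_within[OF diff] by (simp add: continuous_within)
  then have "(E \<longlongrightarrow> (\<Sum>b\<in>Basis. norm (B z b - B z b))) (at z)"
    unfolding E_def by (intro tendsto_intros)
  then have E_lim: "(E \<longlongrightarrow> 0) (at z)" by simp
  have E_z: "E z = 0" by (simp add: E_def)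
  have split: "w x - w z = I (h x) - R x" if x: "x \<in> S" for x
  proof -
    have "h x = B z (w x - w z) + (B x - B z) (w x - w z)"
      using sol[OF x] by (simp add: h_def linear_diff[OF lin[OF x]])
    then show ?thesis by (simp add: R_def linear_diff[OF I(1)] I(2))
  qed
  have R: "(R has_derivative (\<lambda>_. 0)) (at z)"
    unfolding has_derivative_at_alt
  proof (intro conjI allI impI)
    show "bounded_linear (\<lambda>_. 0)" by (rule bounded_linear_zero)
    fix e :: real assume e: "e > 0"
    obtain K where K: "K > 0" "\<And>c. norm (h' c) \<le> K * norm c"
      using has_derivative_bounded_linear[OF h] bounded_linear.pos_bounded
      by (metis mult.commute)
    obtain d1 where d1: "d1 > 0" "\<And>y. norm (y - z) < d1 \<Longrightarrow> norm (h y - h' (y - z)) \<le> 1 * norm (y - z)"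
      using h hz unfolding has_derivative_at_alt by (metis diff_zero zero_less_one)
    obtain d2 where d2: "d2 > 0" "ball z d2 \<subseteq> S"
      using S open_contains_ball by blast
    define e' where "e' = min (1 / (2 * M)) (e / (2 * M\<^sup>2 * (K + 1)))"
    have e': "e' > 0" "M * e' \<le> 1 / 2" "2 * M\<^sup>2 * (K + 1) * e' \<le> e"
    proof -
      define P where "P = 2 * M\<^sup>2 * (K + 1)"
      have P: "P > 0" using M(1) K(1) by (simp add: P_def)
      show "e' > 0" using M(1) P e by (simp add: e'_def flip: P_def)
      have "M * e' \<le> M * (1 / (2 * M))" using M(1) by (intro mult_left_mono) (auto simp: e'_def)
      then show "M * e' \<le> 1 / 2" using M(1) by simp
      have "P * e' \<le> P * (e / P)" using P by (intro mult_left_mono) (auto simp: e'_def P_def)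
      then show "2 * M\<^sup>2 * (K + 1) * e' \<le> e" using P by (simp flip: P_def)
    qed
    have "eventually (\<lambda>x. E x < e') (at z)"
      using order_tendstoD(2)[OF E_lim e'(1)] .
    then obtain d3 where d3: "d3 > 0" "\<And>y. norm (y - z) < d3 \<Longrightarrow> E y < e'"
      unfolding eventually_at using E_z e'(1) by (metis UNIV_I dist_norm)
    show "\<exists>d>0. \<forall>y. norm (y - z) < d \<longrightarrow> norm (R y - R z - 0) \<le> e * norm (y - z)"
    proof (intro exI[of _ "min d1 (min d2 d3)"] conjI allI impI)
      show "min d1 (min d2 d3) > 0" using d1 d2 d3 by simp
      fix y assume y: "norm (y - z) < min d1 (min d2 d3)"
      then have yS: "y \<in> S" using d2 by (auto simp: dist_norm norm_minus_commute subset_iff)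
      have hy: "norm (h y) \<le> (K + 1) * norm (y - z)"
        using norm_triangle_ineq2[of "h y" "h' (y - z)"] d1(2)[of y] y K(2)[of "y - z"]
        by (simp add: algebra_simps)
      have nw: "norm (w y - w z) \<le> norm (I (h y)) + norm (R y)"
        using norm_triangle_ineq4[of "I (h y)" "R y"] by (simp add: split[OF yS])
      have "M * E y \<le> M * e'" using d3(2)[of y] y M(1) by (intro mult_left_mono) auto
      then have ME: "M * E y \<le> 1 / 2" using e'(2) by linarith
      have Ry: "norm (R y) \<le> M * (E y * norm (w y - w z))"
        unfolding R_def using M E[OF yS]
        by (intro order_trans[OF M(2)]) simp
      also have "\<dots> = (M * E y) * norm (w y - w z)" by simp
      also have "\<dots> \<le> (1 / 2) * norm (w y - w z)"
        by (rule mult_right_mono[OF ME norm_ge_zero])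
      finally have "norm (w y - w z) \<le> norm (I (h y)) + (1 / 2) * norm (w y - w z)"
        using nw by linarith
      then have "norm (w y - w z) \<le> 2 * (M * norm (h y))"
        using M(2)[of "h y"] by linarith
      also have "\<dots> \<le> 2 * (M * ((K + 1) * norm (y - z)))"
        using hy M(1) by simp
      finally have "M * (E y * norm (w y - w z)) \<le> M * (e' * (2 * (M * ((K + 1) * norm (y - z)))))"
        using M(1) E_ge[of y] d3(2)[of y] y e'(1) by (intro mult_left_mono mult_mono) auto
      also have "\<dots> = (2 * M\<^sup>2 * (K + 1) * e') * norm (y - z)" by (simp add: power2_eq_square)
      also have "\<dots> \<le> e * norm (y - z)"
        using e'(3) by (intro mult_right_mono) auto
      finally show "norm (R y - R z - 0) \<le> e * norm (y - z)"
        using Ry by (simp add: R_def linear_0[OF I(1)])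
    qed
  qed
  have "((\<lambda>x. w z + I (h x) - R x) has_derivative (\<lambda>c. 0 + I (h' c) - 0)) (at z)"
    by (intro has_derivative_diff has_derivative_add has_derivative_const R
        bounded_linear.has_derivative[OF _ h] linear_conv_bounded_linear[THEN iffD1] I(1))
  then have "((\<lambda>x. w z + I (h x) - R x) has_derivative (\<lambda>c. I (h' c))) (at z)" by simp
  moreover have "w z + I (h x) - R x = w x" if "x \<in> S" for x
    using split[OF that] by (simp add: algebra_simps)
  ultimately show ?thesis
    unfolding h'_def using has_derivative_cong_open[OF S] by (metis (no_types, lifting))
qed

text \<open>The inverse \<open>I\<close> of a smooth field \<open>B\<close> of invertible linear maps satisfies \<open>dI = - I dB I\<close>,
  which expresses its derivative by \<open>I\<close> itself and \<open>B\<close>. Smoothness of \<open>I\<close> follows by bootstrapping,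
  and then that of \<open>w = I r\<close>.\<close>

lemma smooth_on_linear_solve:
  fixes B :: "'a::euclidean_space \<Rightarrow> 'b::euclidean_space \<Rightarrow> 'b"
  assumes S: "open S" and lin: "\<And>x. x \<in> S \<Longrightarrow> linear (B x)" and inj: "\<And>x. x \<in> S \<Longrightarrow> inj (B x)"
    and B: "\<And>b. smooth_on S (\<lambda>x. B x b)" and r: "smooth_on S r"
    and sol: "\<And>x. x \<in> S \<Longrightarrow> B x (w x) = r x"
  shows "smooth_on S w"
proof -
  have "\<exists>I. linear I \<and> (\<forall>v. I (B x v) = v) \<and> (\<forall>v. B x (I v) = v)" if "x \<in> S" for x
    using linear_injective_isomorphism[OF lin[OF that] inj[OF that]] by blast
  then obtain I where I: "\<And>x. x \<in> S \<Longrightarrow> linear (I x)" "\<And>x v. x \<in> S \<Longrightarrow> I x (B x v) = v"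
      "\<And>x v. x \<in> S \<Longrightarrow> B x (I x v) = v"
    by metis
  have der: "((\<lambda>x. I x b) has_derivative (\<lambda>c. I z (- dder (\<lambda>x. B x (I z b)) z c))) (at z)"
    if z: "z \<in> S" for b z
    using linear_solve_has_derivative[OF S z lin smooth_on_differentiable[OF B z] differentiable_const
        I(3) I(1)[OF z] I(2)[OF z]]
    by simp
  \<comment> \<open>By this formula, one more derivative of the inverse is available at each step.\<close>
  have "Ck_on k S (\<lambda>x. I x b)" for k b
  proof (induction k arbitrary: b)
    case 0
    show ?case
      using der by (auto intro!: continuous_at_imp_continuous_on has_derivative_continuous)
  next
    case (Suc k)
    have lin': "linear (\<lambda>v. - dder (\<lambda>x. B x v) z c)" if z: "z \<in> S" for z c
    proof -
      have d: "((\<lambda>x. B x v) has_derivative dder (\<lambda>x. B x v) z) (at z)" for v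
        using smooth_on_has_derivative[OF B z] .
      have "dder (\<lambda>x. B x (v + w)) z = (\<lambda>c. dder (\<lambda>x. B x v) z c + dder (\<lambda>x. B x w) z c)" for v w
        by (rule dder_eqI, rule has_derivative_cong_open[OF S z, THEN iffD2, rotated])
          (rule has_derivative_add[OF d d], simp add: linear_add[OF lin])
      moreover have "dder (\<lambda>x. B x (a *\<^sub>R v)) z = (\<lambda>c. a *\<^sub>R dder (\<lambda>x. B x v) z c)" for a v
        by (rule dder_eqI, rule has_derivative_cong_open[OF S z, THEN iffD2, rotated])
          (rule has_derivative_scaleR_right[OF d], simp add: linear_scale[OF lin])
      ultimately show ?thesis by (intro linearI) simp_all
    qed
    have family: "Ck_on k S (\<lambda>x. A x (g x))"
      if "\<And>x. x \<in> S \<Longrightarrow> linear (A x)" "\<And>b. Ck_on k S (\<lambda>x. A x b)" "Ck_on k S g"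
      for A :: "'a \<Rightarrow> 'b \<Rightarrow> 'b" and g
    proof -
      have "Ck_on k S (\<lambda>x. \<Sum>b\<in>Basis. (g x \<bullet> b) *\<^sub>R A x b)"
        by (intro Ck_on_sum Ck_on_bilinear[OF S bounded_bilinear_scaleR]
            Ck_on_bounded_linear_comp[OF S bounded_linear_inner_left] S that) auto
      then show ?thesis
        by (rule Ck_on_cong[OF S, THEN iffD2, rotated]) (rule linear_euclidean_expansion[OF that(1)])
    qed
    have Bk: "Ck_on k S (\<lambda>z. - dder (\<lambda>x. B x v) z c)" for v c
      using smooth_on_minus[OF S smooth_on_dder_const[OF B]] by (simp add: smooth_on_def)
    have Bk': "Ck_on k S (\<lambda>z. - dder (\<lambda>x. B x (I z b)) z c)" for c
      by (rule family[where A="\<lambda>z v. - dder (\<lambda>x. B x v) z c" and g="\<lambda>z. I z b", OF lin' Bk Suc.IH])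
    have "Ck_on k S (\<lambda>z. I z (- dder (\<lambda>x. B x (I z b)) z c))" for c
      by (rule family[where A=I, OF I(1) Suc.IH Bk'])
    then have "Ck_on k S (\<lambda>z. dder (\<lambda>x. I x b) z c)" for c
      by (rule Ck_on_cong[OF S, THEN iffD1, rotated]) (simp add: dder_eqI[OF der])
    then show ?case
      using der by (auto simp: differentiable_def)
  qed
  then have "smooth_on S (\<lambda>x. I x (r x))"
    using I(1) by (intro smooth_on_linear_family[where A=I and f=r, OF S _ _ r]) (auto simp: smooth_on_def)
  then show ?thesis
    by (rule smooth_on_cong[OF S, THEN iffD1, rotated]) (simp add: I(2) flip: sol)
qed

section \<open>Atlases, tangent vectors and fields in charts\<close>

text \<open>The part of the definition of a manifold that concerns the charts alone. In this form it passes
  from \<open>M\<close> to the slit tangent bundle, so that everything proved here applies to both.\<close>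

locale smooth_atlas =
  fixes M :: "('i, 'm, 'e::euclidean_space) atlas"
  assumes inj_chart: "\<And>i. inj_on (cmap M i) (cdom M i)"
    and open_overlap: "\<And>i j. open (cmap M i ` (cdom M i \<inter> cdom M j))"
    and smooth_transition:
      "\<And>i j. smooth_on (cmap M i ` (cdom M i \<inter> cdom M j)) (transition M i j)"

lemma smooth_manifold_atlas: "smooth_manifold M \<Longrightarrow> smooth_atlas M"
  by unfold_locales (simp_all add: smooth_manifold_def)

abbreviation chart_image :: "('i, 'm, 'e) atlas \<Rightarrow> 'i \<Rightarrow> 'e set"
  where "chart_image M i \<equiv> cmap M i ` cdom M i"

abbreviation local_rep :: "('i, 'm, 'e) atlas \<Rightarrow> 'i \<Rightarrow> ('m \<Rightarrow> 'i \<Rightarrow> 'b) \<Rightarrow> 'e \<Rightarrow> 'b"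
  where "local_rep M i X \<equiv> (\<lambda>z. X (cinv M i z) i)"

definition tangent_lift :: "('i, 'm, 'e::euclidean_space) atlas \<Rightarrow> 'i \<Rightarrow> 'm \<Rightarrow> 'e \<Rightarrow> 'i \<Rightarrow> 'e"
  where "tangent_lift M i p w =
    (\<lambda>j. if p \<in> cdom M j then dder (transition M i j) (cmap M i p) w else 0)"

lemma tangent_space_outside: "v \<in> tangent_space M p \<Longrightarrow> p \<notin> cdom M i \<Longrightarrow> v i = 0"
  by (simp add: tangent_space_def)

lemma tangent_space_transition:
  "v \<in> tangent_space M p \<Longrightarrow> p \<in> cdom M i \<Longrightarrow> p \<in> cdom M j
    \<Longrightarrow> v j = dder (transition M i j) (cmap M i p) (v i)"
  unfolding tangent_space_def by blast

lemma tangent_space_eqI: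
  assumes "v \<in> tangent_space M p" "w \<in> tangent_space M p" "p \<in> cdom M i" "v i = w i"
  shows "v = w"
proof
  fix j show "v j = w j"
  proof (cases "p \<in> cdom M j")
    case True
    from tangent_space_transition[OF assms(1,3) this] tangent_space_transition[OF assms(2,3) this]
    show ?thesis by (simp only: assms(4))
  next
    case False
    from tangent_space_outside[OF assms(1) this] tangent_space_outside[OF assms(2) this]
    show ?thesis by simp
  qed
qed

context smooth_atlas
begin

lemma open_chart_image: "open (chart_image M i)"
  using open_overlap[of i i] by simp

lemma cinv_cmap [simp]: "p \<in> cdom M i \<Longrightarrow> cinv M i (cmap M i p) = p"
  by (simp add: cinv_def inj_chart)

lemma cinv_in_cdom: "z \<in> chart_image M i \<Longrightarrow> cinv M i z \<in> cdom M i"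
  unfolding cinv_def by (rule inv_into_into)

lemma cmap_cinv [simp]: "z \<in> chart_image M i \<Longrightarrow> cmap M i (cinv M i z) = z"
  unfolding cinv_def by (rule f_inv_into_f)

lemma cinv_in_carrier: "z \<in> chart_image M i \<Longrightarrow> cinv M i z \<in> mcarrier M"
  using cinv_in_cdom by (fastforce simp: mcarrier_def)

lemma transition_cmap: "p \<in> cdom M i \<Longrightarrow> transition M i j (cmap M i p) = cmap M j p"
  by (simp add: transition_def)

lemma transition_differentiable:
  "p \<in> cdom M i \<Longrightarrow> p \<in> cdom M j \<Longrightarrow> transition M i j differentiable (at (cmap M i p))"
  by (rule smooth_on_differentiable[OF smooth_transition]) blast

lemma linear_dtransition:
  "p \<in> cdom M i \<Longrightarrow> p \<in> cdom M j \<Longrightarrow> linear (dder (transition M i j) (cmap M i p))"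
  by (intro bounded_linear.linear bounded_linear_dder transition_differentiable)

lemma dtransition_self: "p \<in> cdom M i \<Longrightarrow> dder (transition M i i) (cmap M i p) v = v"
  using dder_cong_open[OF open_chart_image, of "cmap M i p" i "transition M i i" "\<lambda>x. x"]
  by (auto simp: transition_def)

lemma dtransition_compose:
  assumes p: "p \<in> cdom M i" "p \<in> cdom M j" "p \<in> cdom M k"
  shows "dder (transition M j k) (cmap M j p) (dder (transition M i j) (cmap M i p) v)
    = dder (transition M i k) (cmap M i p) v"
proof -
  let ?S = "cmap M i ` (cdom M i \<inter> cdom M j) \<inter> cmap M i ` (cdom M i \<inter> cdom M k)"
  have S: "open ?S" "cmap M i p \<in> ?S"
    using open_overlap p by auto
  have agree: "transition M i k x = transition M j k (transition M i j x)" if "x \<in> ?S" for x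
  proof -
    from that obtain q where q: "q \<in> cdom M i" "q \<in> cdom M j" "x = cmap M i q" by blast
    then show ?thesis by (simp add: transition_cmap)
  qed
  have "((\<lambda>x. transition M j k (transition M i j x)) has_derivative
      (\<lambda>v. dder (transition M j k) (transition M i j (cmap M i p))
        (dder (transition M i j) (cmap M i p) v))) (at (cmap M i p))"
  proof (rule has_derivative_compose[where f="transition M i j" and g="transition M j k"
        and f'="dder (transition M i j) (cmap M i p)"
        and g'="dder (transition M j k) (transition M i j (cmap M i p))"])
    show "(transition M i j has_derivative dder (transition M i j) (cmap M i p)) (at (cmap M i p))"
      by (intro has_derivative_dder transition_differentiable p)
    show "(transition M j k has_derivative dder (transition M j k) (transition M i j (cmap M i p)))
        (at (transition M i j (cmap M i p)))"
      unfolding transition_cmap[OF p(1)] by (intro has_derivative_dder transition_differentiable p)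
  qed
  from dder_eqI[OF this] dder_cong_open[OF S agree] show ?thesis
    using transition_cmap[OF p(1)] by simp
qed

lemma tangent_lift_in_tangent_space: "p \<in> cdom M i \<Longrightarrow> tangent_lift M i p w \<in> tangent_space M p"
  by (auto simp: tangent_space_def tangent_lift_def dtransition_compose)

lemma tangent_lift_component [simp]: "p \<in> cdom M i \<Longrightarrow> tangent_lift M i p w i = w"
  by (simp add: tangent_lift_def dtransition_self)

lemma tangent_lift_eq [simp]:
  "p \<in> cdom M i \<Longrightarrow> v \<in> tangent_space M p \<Longrightarrow> tangent_lift M i p (v i) = v"
  using tangent_lift_in_tangent_space by (intro tangent_space_eqI) auto

lemma tangent_spaceI:
  assumes "\<And>i. p \<notin> cdom M i \<Longrightarrow> v i = 0"
    and "\<And>i j. p \<in> cdom M i \<Longrightarrow> p \<in> cdom M j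
      \<Longrightarrow> v j = dder (transition M i j) (cmap M i p) (v i)"
  shows "v \<in> tangent_space M p"
  unfolding tangent_space_def using assms by blast

lemma tangent_space_zero: "0 \<in> tangent_space M p"
  by (rule tangent_spaceI) (simp_all add: linear_0[OF linear_dtransition])

lemma tangent_space_add:
  assumes "v \<in> tangent_space M p" "w \<in> tangent_space M p"
  shows "v + w \<in> tangent_space M p"
proof (rule tangent_spaceI)
  fix i j assume i: "p \<in> cdom M i" and j: "p \<in> cdom M j"
  from tangent_space_transition[OF assms(1) i j] tangent_space_transition[OF assms(2) i j]
  show "(v + w) j = dder (transition M i j) (cmap M i p) ((v + w) i)"
    by (simp only: plus_fun_apply linear_add[OF linear_dtransition[OF i j]])
qed (simp add: tangent_space_outside[OF assms(1)] tangent_space_outside[OF assms(2)])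

lemma tangent_space_scl:
  assumes "v \<in> tangent_space M p"
  shows "scl a v \<in> tangent_space M p"
proof (rule tangent_spaceI)
  fix i j assume i: "p \<in> cdom M i" and j: "p \<in> cdom M j"
  from tangent_space_transition[OF assms i j]
  show "scl a v j = dder (transition M i j) (cmap M i p) (scl a v i)"
    by (simp only: scl_def linear_scale[OF linear_dtransition[OF i j]])
qed (simp add: scl_def tangent_space_outside[OF assms])

lemma tangent_space_diff:
  assumes "v \<in> tangent_space M p" "w \<in> tangent_space M p"
  shows "v - w \<in> tangent_space M p"
proof -
  have "v - w = v + scl (- 1) w" by (rule ext) (simp add: scl_def)
  then show ?thesis using assms by (simp only: tangent_space_add tangent_space_scl)
qed

lemma tangent_lift_add:
  "p \<in> cdom M i \<Longrightarrow> tangent_lift M i p (v + w) = tangent_lift M i p v + tangent_lift M i p w"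
  by (rule tangent_space_eqI[of _ M p _ i])
    (simp_all add: tangent_lift_in_tangent_space tangent_space_add)

lemma tangent_lift_scale:
  "p \<in> cdom M i \<Longrightarrow> tangent_lift M i p (a *\<^sub>R v) = scl a (tangent_lift M i p v)"
  by (rule tangent_space_eqI[of _ M p _ i])
    (simp_all add: tangent_lift_in_tangent_space tangent_space_scl, simp add: scl_def)

text \<open>A section of a bundle with charts \<open>(p, v) \<mapsto> (cmap M i p, v i)\<close> is smooth as soon as its
  components in each chart are smooth in the same chart: the representation with respect to a pair of
  charts differs from these by a transition map.\<close>

lemma smooth_section_iff:
  assumes N: "cdom N = (\<lambda>i. {(p, v). p \<in> cdom M i \<and> v \<in> F p})"
    "cmap N = (\<lambda>i (p, v). (cmap M i p, v i))"
  shows "smooth_map M N (\<lambda>p. (p, X p)) \<longleftrightarrow>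
    (\<forall>p\<in>mcarrier M. X p \<in> F p) \<and> (\<forall>i. smooth_on (chart_image M i) (local_rep M i X))"
    (is "?l \<longleftrightarrow> ?r")
proof
  assume l: ?l
  then have F: "X p \<in> F p" if "p \<in> mcarrier M" for p
    using that by (auto simp: smooth_map_def mcarrier_def N)
  have dom: "cdom M i \<inter> (\<lambda>p. (p, X p)) -` cdom N i = cdom M i" for i
    using F by (auto simp: N mcarrier_def)
  have "smooth_on (chart_image M i) (\<lambda>z. snd ((cmap N i \<circ> (\<lambda>p. (p, X p)) \<circ> cinv M i) z))" for i
  proof (rule smooth_on_snd[OF open_chart_image])
    have "smooth_on (cmap M i ` (cdom M i \<inter> (\<lambda>p. (p, X p)) -` cdom N i))
        (cmap N i \<circ> (\<lambda>p. (p, X p)) \<circ> cinv M i)"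
      using l unfolding smooth_map_def by blast
    then show "smooth_on (chart_image M i) (cmap N i \<circ> (\<lambda>p. (p, X p)) \<circ> cinv M i)"
      unfolding dom .
  qed
  then show ?r using F by (simp add: N)
next
  assume r: ?r
  have dom: "cdom M i \<inter> (\<lambda>p. (p, X p)) -` cdom N j = cdom M i \<inter> cdom M j" for i j
    using r by (auto simp: N mcarrier_def)
  have "smooth_on (cmap M i ` (cdom M i \<inter> cdom M j)) (cmap N j \<circ> (\<lambda>p. (p, X p)) \<circ> cinv M i)" for i j
  proof -
    have "smooth_on (cmap M i ` (cdom M i \<inter> cdom M j)) (\<lambda>z. local_rep M j X (transition M i j z))"
    proof (rule smooth_on_compose[where T="chart_image M j" and g="transition M i j" and f="local_rep M j X",
            OF open_overlap open_chart_image _ _ smooth_transition])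
      show "transition M i j ` cmap M i ` (cdom M i \<inter> cdom M j) \<subseteq> chart_image M j"
        by (auto simp: transition_cmap)
      show "smooth_on (chart_image M j) (local_rep M j X)" using r by blast
    qed
    then have "smooth_on (cmap M i ` (cdom M i \<inter> cdom M j))
        (\<lambda>z. (transition M i j z, local_rep M j X (transition M i j z)))"
      by (intro smooth_on_Pair open_overlap smooth_transition)
    then show ?thesis
      by (rule smooth_on_cong[OF open_overlap, THEN iffD1, rotated]) (auto simp: N transition_def)
  qed
  then show ?l
    using r dom open_overlap by (auto simp: smooth_map_def N mcarrier_def)
qed

lemma vector_fields_iff:
  "X \<in> vector_fields M \<longleftrightarrow> (\<forall>p\<in>mcarrier M. X p \<in> tangent_space M p) \<and>
    (\<forall>p. p \<notin> mcarrier M \<longrightarrow> X p = 0) \<and> (\<forall>i. smooth_on (chart_image M i) (local_rep M i X))"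
  using smooth_section_iff[of "tangent_bundle M" "tangent_space M" X]
  by (auto simp: vector_fields_def tangent_bundle_def)

lemma vector_fieldsD:
  assumes "X \<in> vector_fields M"
  shows "p \<in> mcarrier M \<Longrightarrow> X p \<in> tangent_space M p"
    and "p \<notin> mcarrier M \<Longrightarrow> X p = 0"
    and "smooth_on (chart_image M i) (local_rep M i X)"
  using assms by (auto simp: vector_fields_iff)

lemma bracket_component:
  "p \<in> cdom M i \<Longrightarrow> bracket M X Y p i =
    dder (local_rep M i Y) (cmap M i p) (X p i) - dder (local_rep M i X) (cmap M i p) (Y p i)"
  by (simp add: bracket_def)

lemma bracket_antisym: "bracket M X Y p = - bracket M Y X p"
  by (simp add: bracket_def fun_eq_iff)

text \<open>The second derivatives of the transition maps, which enter the derivatives of both fields,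
  cancel by symmetry.\<close>

lemma bracket_in_vector_fields:
  assumes X: "X \<in> vector_fields M" and Y: "Y \<in> vector_fields M"
  shows "bracket M X Y \<in> vector_fields M"
  unfolding vector_fields_iff
proof (intro conjI ballI allI impI)
  show "bracket M X Y p = 0" if "p \<notin> mcarrier M" for p
    using that by (auto simp: bracket_def mcarrier_def)
next
  fix i
  have "smooth_on (chart_image M i) (\<lambda>z. dder (local_rep M i Y) z (local_rep M i X z)
      - dder (local_rep M i X) z (local_rep M i Y z))"
    by (intro smooth_on_diff smooth_on_dder open_chart_image vector_fieldsD(3) X Y)
  then show "smooth_on (chart_image M i) (local_rep M i (bracket M X Y))"
    by (rule smooth_on_cong[OF open_chart_image, THEN iffD1, rotated])
      (simp add: bracket_component cinv_in_cdom)
next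
  fix p assume p: "p \<in> mcarrier M"
  have "bracket M X Y p j = dder (transition M i j) (cmap M i p) (bracket M X Y p i)"
    if ij: "p \<in> cdom M i" "p \<in> cdom M j" for i j
  proof -
    let ?S = "cmap M i ` (cdom M i \<inter> cdom M j)" and ?t = "transition M i j" and ?z = "cmap M i p"
    have S: "open ?S" "?z \<in> ?S" using open_overlap ij by auto
    have rule: "dder (local_rep M j X) (cmap M j p) (Y p j) =
        dder (\<lambda>x. dder ?t x (X p i)) ?z (Y p i) + dder ?t ?z (dder (local_rep M i X) ?z (Y p i))"
      if X: "X \<in> vector_fields M" and Y: "Y \<in> vector_fields M" for X Y
    proof -
      have eq: "local_rep M j X (?t x) = dder ?t x (local_rep M i X x)" if x: "x \<in> ?S" for x
      proof -
        from x obtain q where q: "q \<in> cdom M i" "q \<in> cdom M j" "x = cmap M i q" by auto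
        have "X q \<in> tangent_space M q" using vector_fieldsD(1)[OF X] q by (auto simp: mcarrier_def)
        from tangent_space_transition[OF this q(1,2)] show ?thesis
          using q by (simp add: transition_cmap)
      qed
      have "((\<lambda>x. dder ?t x (local_rep M i X x)) has_derivative
          (\<lambda>c. dder (\<lambda>x. dder ?t x (local_rep M i X ?z)) ?z c
            + dder ?t ?z (dder (local_rep M i X) ?z c))) (at ?z)"
        using ij
        by (intro has_derivative_linear_family[where A="\<lambda>x. dder ?t x", OF S]
            smooth_on_has_derivative[OF smooth_on_dder_const[OF smooth_transition] S(2)]
            smooth_on_has_derivative[OF vector_fieldsD(3)[OF X]]) (auto intro: linear_dtransition)
      then have "((\<lambda>x. local_rep M j X (?t x)) has_derivative
          (\<lambda>c. dder (\<lambda>x. dder ?t x (local_rep M i X ?z)) ?z c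
            + dder ?t ?z (dder (local_rep M i X) ?z c))) (at ?z)"
        by (rule has_derivative_cong_open[OF S, THEN iffD2, rotated]) (rule eq)
      moreover have "((\<lambda>x. local_rep M j X (?t x)) has_derivative
          (\<lambda>c. dder (local_rep M j X) (?t ?z) (dder ?t ?z c))) (at ?z)"
        using ij
        by (intro has_derivative_compose[where f="?t" and g="local_rep M j X",
              OF has_derivative_dder smooth_on_has_derivative[OF vector_fieldsD(3)[OF X]]])
          (simp_all add: transition_differentiable transition_cmap)
      ultimately have "dder (local_rep M j X) (?t ?z) (dder ?t ?z (Y p i)) =
          dder (\<lambda>x. dder ?t x (local_rep M i X ?z)) ?z (Y p i)
            + dder ?t ?z (dder (local_rep M i X) ?z (Y p i))"
        by (rule fun_cong[OF has_derivative_unique, rotated])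
      moreover have "Y p \<in> tangent_space M p" using p vector_fieldsD(1)[OF Y] by blast
      ultimately show ?thesis
        using tangent_space_transition[of "Y p" M p i j] ij by (simp add: transition_cmap)
    qed
    have "dder (\<lambda>x. dder ?t x (X p i)) ?z (Y p i) = dder (\<lambda>x. dder ?t x (Y p i)) ?z (X p i)"
      by (rule second_derivative_symmetric[OF S smooth_transition])
    then show ?thesis
      using ij by (simp add: bracket_component rule[OF X Y] rule[OF Y X] linear_diff[OF linear_dtransition[OF ij]])
  qed
  then show "bracket M X Y p \<in> tangent_space M p"
    by (auto simp: tangent_space_def) (simp add: bracket_def)
qed

end

section \<open>The slit tangent bundle and the pullback bundle in charts\<close>

lemma slit_dom_iff: "u \<in> cdom (slit M) i \<longleftrightarrow>
    fst u \<in> cdom M i \<and> snd u \<in> tangent_space M (fst u) \<and> snd u \<noteq> 0"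
  by (cases u) (simp add: slit_def open_submanifold_def tangent_bundle_def)

lemma cmap_slit: "cmap (slit M) i u = (cmap M i (fst u), snd u i)"
  by (cases u) (simp add: slit_def open_submanifold_def tangent_bundle_def)

lemma slit_carrier_iff: "u \<in> mcarrier (slit M) \<longleftrightarrow>
    fst u \<in> mcarrier M \<and> snd u \<in> tangent_space M (fst u) \<and> snd u \<noteq> 0"
  by (auto simp: mcarrier_def slit_dom_iff)

lemma slit_domD: "u \<in> cdom (slit M) i \<Longrightarrow> u \<in> mcarrier (slit M)"
  by (auto simp: mcarrier_def)

lemma slit_dom_base: "u \<in> mcarrier (slit M) \<Longrightarrow> u \<in> cdom (slit M) i \<longleftrightarrow> fst u \<in> cdom M i"
  by (auto simp: slit_carrier_iff slit_dom_iff)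

lemma chart_at_slit: "u \<in> mcarrier (slit M) \<Longrightarrow> u \<in> cdom (slit M) (chart_at (slit M) u)"
  unfolding chart_at_def mcarrier_def by (rule someI_ex) auto

lemma fieldwise_in: "u \<in> mcarrier (slit M) \<Longrightarrow> fieldwise M A X u = A u (X u)"
  by (simp add: fieldwise_def)

lemma fieldwise_out: "u \<notin> mcarrier (slit M) \<Longrightarrow> fieldwise M A X u = 0"
  by (simp add: fieldwise_def)

context smooth_atlas
begin

text \<open>A tangent vector vanishes iff one of its components does, so removing the zero section removes
  exactly the points with second coordinate 0 from each chart.\<close>

lemma slit_overlap: "cmap (slit M) i ` (cdom (slit M) i \<inter> cdom (slit M) j)
    = cmap M i ` (cdom M i \<inter> cdom M j) \<times> (- {0})" (is "?l = ?r")
proof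
  have "snd u i \<noteq> 0" if "u \<in> cdom (slit M) i" for u
    using that tangent_space_eqI[of "snd u" M "fst u" 0 i] tangent_space_zero
    by (auto simp: slit_dom_iff)
  then show "?l \<subseteq> ?r" by (auto simp: cmap_slit slit_dom_iff)
  show "?r \<subseteq> ?l"
  proof
    fix z assume "z \<in> ?r"
    then obtain p where p: "p \<in> cdom M i" "p \<in> cdom M j" "fst z = cmap M i p" "snd z \<noteq> 0"
      by (cases z) auto
    let ?u = "(p, tangent_lift M i p (snd z))"
    have "tangent_lift M i p (snd z) \<noteq> 0"
      using tangent_lift_component[OF p(1), of "snd z"] p(4) by (metis zero_fun_apply)
    then have "?u \<in> cdom (slit M) i \<inter> cdom (slit M) j"
      using p by (simp add: slit_dom_iff tangent_lift_in_tangent_space)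
    moreover have "z = cmap (slit M) i ?u"
      using p by (cases z) (simp add: cmap_slit)
    ultimately show "z \<in> ?l" by (rule rev_image_eqI)
  qed
qed

lemma inj_slit: "inj_on (cmap (slit M) i) (cdom (slit M) i)"
proof (rule inj_onI)
  fix u v assume u: "u \<in> cdom (slit M) i" and v: "v \<in> cdom (slit M) i"
    and eq: "cmap (slit M) i u = cmap (slit M) i v"
  then have base: "fst u = fst v"
    using inj_chart[of i] by (auto simp: slit_dom_iff cmap_slit inj_on_def)
  moreover have "snd u = snd v"
    using u v eq base by (intro tangent_space_eqI[of _ M "fst u" _ i]) (auto simp: slit_dom_iff cmap_slit)
  ultimately show "u = v" by (simp add: prod_eq_iff)
qed

lemma open_slit_overlap: "open (cmap (slit M) i ` (cdom (slit M) i \<inter> cdom (slit M) j))"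
  unfolding slit_overlap by (intro open_Times open_overlap) auto

text \<open>The transition maps of the tangent bundle are the tangent maps of those of \<open>M\<close>; they are
  smooth because the derivative of a transition map is a smooth field of linear maps.\<close>

lemma transition_slit:
  assumes "z \<in> cmap (slit M) i ` (cdom (slit M) i \<inter> cdom (slit M) j)"
  shows "transition (slit M) i j z = (transition M i j (fst z), dder (transition M i j) (fst z) (snd z))"
proof -
  from assms obtain u where u: "u \<in> cdom (slit M) i" "u \<in> cdom (slit M) j" "z = cmap (slit M) i u"
    by auto
  then have "cinv (slit M) i z = u"
    by (simp add: cinv_def inj_slit)
  then show ?thesis
    using u tangent_space_transition[of "snd u" M "fst u" i j]
    by (simp add: transition_def[of "slit M"] slit_dom_iff cmap_slit transition_cmap)
qed

lemma linear_dtransition_overlap: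
  assumes "x \<in> cmap M i ` (cdom M i \<inter> cdom M j)"
  shows "linear (dder (transition M i j) x)"
  using assms linear_dtransition by auto

lemma smooth_atlas_slit: "smooth_atlas (slit M)"
proof
  show "inj_on (cmap (slit M) i) (cdom (slit M) i)" for i by (rule inj_slit)
  show "open (cmap (slit M) i ` (cdom (slit M) i \<inter> cdom (slit M) j))" for i j
    by (rule open_slit_overlap)
  show "smooth_on (cmap (slit M) i ` (cdom (slit M) i \<inter> cdom (slit M) j)) (transition (slit M) i j)"
    for i j
  proof -
    let ?W = "cmap (slit M) i ` (cdom (slit M) i \<inter> cdom (slit M) j)"
    let ?V = "cmap M i ` (cdom M i \<inter> cdom M j)"
    have base: "fst ` ?W \<subseteq> ?V" by (auto simp: slit_overlap)
    have fst: "smooth_on ?W fst" and snd: "smooth_on ?W snd"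
      by (intro smooth_on_bounded_linear bounded_linear_fst bounded_linear_snd)+
    have t: "smooth_on ?W (\<lambda>z. transition M i j (fst z))"
      by (rule smooth_on_compose[where T="?V" and g=fst, OF open_slit_overlap open_overlap base
            smooth_transition fst])
    have tb: "smooth_on ?W (\<lambda>z. dder (transition M i j) (fst z) b)" for b
      by (rule smooth_on_compose[where T="?V" and g=fst and f="\<lambda>x. dder (transition M i j) x b",
            OF open_slit_overlap open_overlap base smooth_on_dder_const[OF smooth_transition] fst])
    have "smooth_on ?W (\<lambda>z. dder (transition M i j) (fst z) (snd z))"
    proof (rule smooth_on_linear_family[where A="\<lambda>z. dder (transition M i j) (fst z)" and f=snd,
            OF open_slit_overlap _ tb snd])
      show "linear (dder (transition M i j) (fst z))" if "z \<in> ?W" for z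
        using base that by (intro linear_dtransition_overlap) blast
    qed
    from smooth_on_Pair[OF open_slit_overlap t this] show ?thesis
      by (rule smooth_on_cong[OF open_slit_overlap, THEN iffD1, rotated])
        (simp add: transition_slit del: image_Int)
  qed
qed

end

text \<open>Facts about the charts of \<open>M\<close> keep their names; those about the charts of the slit tangent
  bundle get the prefix \<open>slit\<close>.\<close>

locale slit_atlas = smooth_atlas M for M :: "('i, 'm, 'e::euclidean_space) atlas"

sublocale slit_atlas \<subseteq> slit: smooth_atlas "slit M"
  by (rule smooth_atlas_slit)

context slit_atlas
begin

text \<open>The tangent map of \<open>(x, y) \<mapsto> (t x, dt\<^sub>x y)\<close> is block triangular. Its first block
  makes the projection of a tangent vector, and its last block makes the vertical lift, independent of
  the chart.\<close>

lemma dtransition_slit: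
  assumes u: "u \<in> cdom (slit M) i" "u \<in> cdom (slit M) j"
  shows "fst (dder (transition (slit M) i j) (cmap (slit M) i u) \<xi>)
      = dder (transition M i j) (cmap M i (fst u)) (fst \<xi>)"
    and "dder (transition (slit M) i j) (cmap (slit M) i u) (0, w)
      = (0, dder (transition M i j) (cmap M i (fst u)) w)"
proof -
  let ?W = "cmap (slit M) i ` (cdom (slit M) i \<inter> cdom (slit M) j)" and ?z = "cmap (slit M) i u"
  let ?t = "transition M i j" and ?p = "fst u"
  have W: "open ?W" "?z \<in> ?W" using open_slit_overlap u by auto
  have p: "?p \<in> cdom M i" "?p \<in> cdom M j" using u by (auto simp: slit_dom_iff)
  have z: "fst ?z = cmap M i ?p" by (simp add: cmap_slit)
  have tp: "(?t has_derivative dder ?t (fst ?z)) (at (fst ?z))"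
    unfolding z by (intro has_derivative_dder transition_differentiable p)
  have t: "((\<lambda>z. ?t (fst z)) has_derivative (\<lambda>\<xi>. dder ?t (fst ?z) (fst \<xi>))) (at ?z)"
    by (rule has_derivative_compose[where f=fst and f'=fst and g="?t" and g'="dder ?t (fst ?z)",
          OF has_derivative_fst[OF has_derivative_ident] tp])
  have dt: "((\<lambda>z. dder ?t (fst z) b) has_derivative
      (\<lambda>\<xi>. dder (\<lambda>x. dder ?t x b) (fst ?z) (fst \<xi>))) (at ?z)" for b
  proof (rule has_derivative_compose[where f=fst and f'=fst and g="\<lambda>x. dder ?t x b"
        and g'="dder (\<lambda>x. dder ?t x b) (fst ?z)", OF has_derivative_fst[OF has_derivative_ident]])
    show "((\<lambda>x. dder ?t x b) has_derivative dder (\<lambda>x. dder ?t x b) (fst ?z)) (at (fst ?z))"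
      unfolding z
      by (rule smooth_on_has_derivative[OF smooth_on_dder_const[OF smooth_transition]]) (use p in blast)
  qed
  have lin: "linear (dder ?t (fst x))" if "x \<in> ?W" for x
    using that linear_dtransition_overlap[of "fst x" i j] unfolding slit_overlap by auto
  have "((\<lambda>z. dder ?t (fst z) (snd z)) has_derivative
      (\<lambda>\<xi>. dder (\<lambda>x. dder ?t x (snd ?z)) (fst ?z) (fst \<xi>) + dder ?t (fst ?z) (snd \<xi>))) (at ?z)"
    by (rule has_derivative_linear_family[where A="\<lambda>z. dder ?t (fst z)" and f=snd and f'=snd,
          OF W lin dt has_derivative_snd[OF has_derivative_ident]])
  from has_derivative_Pair[OF t this]
  have "(transition (slit M) i j has_derivative
      (\<lambda>\<xi>. (dder ?t (fst ?z) (fst \<xi>),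
        dder (\<lambda>x. dder ?t x (snd ?z)) (fst ?z) (fst \<xi>) + dder ?t (fst ?z) (snd \<xi>)))) (at ?z)"
    by (rule has_derivative_cong_open[OF W, THEN iffD2, rotated]) (rule transition_slit)
  note d = dder_eqI[OF this]
  show "fst (dder (transition (slit M) i j) ?z \<xi>) = dder ?t (cmap M i ?p) (fst \<xi>)"
    unfolding d by (simp add: z)
  have "dder (\<lambda>x. dder ?t x (snd ?z)) (fst ?z) 0 = 0"
    unfolding z
    by (intro linear_0 bounded_linear.linear bounded_linear_dder
        smooth_on_differentiable[OF smooth_on_dder_const[OF smooth_transition]]) (use p in blast)
  then show "dder (transition (slit M) i j) ?z (0, w) = (0, dder ?t (cmap M i ?p) w)"
    unfolding d by (simp add: z linear_0[OF linear_dtransition[OF p]])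
qed

lemma rho_component:
  assumes u: "u \<in> cdom (slit M) j" and \<xi>: "\<xi> \<in> tangent_space (slit M) u"
  shows "rho M u \<xi> j = fst (\<xi> j)"
proof -
  define i where "i = chart_at (slit M) u"
  have i: "u \<in> cdom (slit M) i" unfolding i_def by (rule chart_at_slit[OF slit_domD[OF u]])
  let ?W = "cmap (slit M) i ` (cdom (slit M) i \<inter> cdom (slit M) j)" and ?z = "cmap (slit M) i u"
  have W: "open ?W" "?z \<in> ?W" using open_slit_overlap u i by auto
  have eq: "(cmap M j \<circ> fst \<circ> cinv (slit M) i) x = fst (transition (slit M) i j x)" if "x \<in> ?W" for x
    by (simp add: transition_def cmap_slit)
  have "((\<lambda>x. fst (transition (slit M) i j x)) has_derivative
      (\<lambda>v. fst (dder (transition (slit M) i j) ?z v))) (at ?z)"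
    by (intro has_derivative_fst has_derivative_dder slit.transition_differentiable i u)
  then have "((cmap M j \<circ> fst \<circ> cinv (slit M) i) has_derivative
      (\<lambda>v. fst (dder (transition (slit M) i j) ?z v))) (at ?z)"
    by (rule has_derivative_cong_open[OF W, THEN iffD2, rotated]) (rule eq)
  from dder_eqI[OF this] have "rho M u \<xi> j = fst (dder (transition (slit M) i j) ?z (\<xi> i))"
    using u by (simp add: rho_def differential_def Let_def slit_dom_iff flip: i_def)
  also have "\<dots> = fst (\<xi> j)"
    using tangent_space_transition[OF \<xi> i u] by simp
  finally show ?thesis .
qed

lemma rho_outside: "fst u \<notin> cdom M j \<Longrightarrow> rho M u \<xi> j = 0"
  by (simp add: rho_def differential_def)

lemma rho_in_tangent_space:
  assumes u: "u \<in> mcarrier (slit M)" and \<xi>: "\<xi> \<in> tangent_space (slit M) u"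
  shows "rho M u \<xi> \<in> tangent_space M (fst u)"
proof (rule tangent_spaceI)
  fix i j assume "fst u \<in> cdom M i" "fst u \<in> cdom M j"
  then have ij: "u \<in> cdom (slit M) i" "u \<in> cdom (slit M) j" using slit_dom_base[OF u] by auto
  have "rho M u \<xi> j = fst (dder (transition (slit M) i j) (cmap (slit M) i u) (\<xi> i))"
    using rho_component[OF ij(2) \<xi>] tangent_space_transition[OF \<xi> ij] by simp
  also have "\<dots> = dder (transition M i j) (cmap M i (fst u)) (rho M u \<xi> i)"
    unfolding dtransition_slit(1)[OF ij] rho_component[OF ij(1) \<xi>] ..
  finally show "rho M u \<xi> j = dder (transition M i j) (cmap M i (fst u)) (rho M u \<xi> i)" .
qed (rule rho_outside)

lemma gam_eq: "gam M u v = (\<lambda>j. if u \<in> cdom (slit M) j then (0, v j) else 0)"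
proof
  fix j
  have c0: "(fst u, snd u + scl 0 v) = u" by (simp add: prod_eq_iff fun_eq_iff scl_def)
  have "((\<lambda>s. cmap (slit M) j (fst u, snd u + scl s v)) has_vector_derivative (0, v j)) (at 0)"
    unfolding cmap_slit by (auto simp: scl_def intro!: derivative_eq_intros)
  from vector_derivative_at[OF this]
  show "gam M u v j = (if u \<in> cdom (slit M) j then (0, v j) else 0)"
    by (simp add: gam_def velocity_def c0)
qed

lemma gam_component: "u \<in> cdom (slit M) j \<Longrightarrow> gam M u v j = (0, v j)"
  by (simp add: gam_eq)

lemma gam_in_tangent_space:
  assumes u: "u \<in> mcarrier (slit M)" and v: "v \<in> tangent_space M (fst u)"
  shows "gam M u v \<in> tangent_space (slit M) u"
proof (rule slit.tangent_spaceI)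
  fix i j assume ij: "u \<in> cdom (slit M) i" "u \<in> cdom (slit M) j"
  then have "v j = dder (transition M i j) (cmap M i (fst u)) (v i)"
    by (intro tangent_space_transition[OF v]) (auto simp: slit_dom_iff)
  then show "gam M u v j = dder (transition (slit M) i j) (cmap (slit M) i u) (gam M u v i)"
    using ij by (simp add: gam_component dtransition_slit(2))
qed (simp add: gam_eq)

text \<open>In a chart, a vertical vector has the form \<open>(0, w)\<close>, and by block triangularity the \<open>w\<close>
  are the components of a tangent vector of \<open>M\<close>.\<close>

lemma vertical_eq_gam:
  assumes u: "u \<in> mcarrier (slit M)" and \<xi>: "\<xi> \<in> tangent_space (slit M) u" "rho M u \<xi> = 0"
  shows "(\<lambda>j. snd (\<xi> j)) \<in> tangent_space M (fst u)" "\<xi> = gam M u (\<lambda>j. snd (\<xi> j))"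
proof -
  have comp: "\<xi> j = (0, snd (\<xi> j))" if "u \<in> cdom (slit M) j" for j
    using rho_component[OF that \<xi>(1)] \<xi>(2) by (simp add: prod_eq_iff)
  show "(\<lambda>j. snd (\<xi> j)) \<in> tangent_space M (fst u)"
  proof (rule tangent_spaceI)
    show "snd (\<xi> i) = 0" if "fst u \<notin> cdom M i" for i
      using tangent_space_outside[OF \<xi>(1), of i] that by (auto simp: slit_dom_iff)
    fix i j assume "fst u \<in> cdom M i" "fst u \<in> cdom M j"
    then have ij: "u \<in> cdom (slit M) i" "u \<in> cdom (slit M) j" using slit_dom_base[OF u] by auto
    have "\<xi> j = dder (transition (slit M) i j) (cmap (slit M) i u) (0, snd (\<xi> i))"
      using tangent_space_transition[OF \<xi>(1) ij] comp[OF ij(1)] by simp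
    then show "snd (\<xi> j) = dder (transition M i j) (cmap M i (fst u)) (snd (\<xi> i))"
      unfolding dtransition_slit(2)[OF ij] by simp
  qed
  show "\<xi> = gam M u (\<lambda>j. snd (\<xi> j))"
    using comp tangent_space_outside[OF \<xi>(1)] by (auto simp: gam_eq fun_eq_iff)
qed

lemma psections_iff:
  "Y \<in> psections M \<longleftrightarrow> (\<forall>u\<in>mcarrier (slit M). Y u \<in> tangent_space M (fst u)) \<and>
    (\<forall>u. u \<notin> mcarrier (slit M) \<longrightarrow> Y u = 0) \<and>
    (\<forall>i. smooth_on (chart_image (slit M) i) (local_rep (slit M) i Y))"
  using slit.smooth_section_iff[of "pullback_bundle M" "\<lambda>u. tangent_space M (fst u)" Y]
  by (auto simp: psections_def pullback_bundle_def)

lemma psectionsD: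
  assumes "Y \<in> psections M"
  shows "u \<in> mcarrier (slit M) \<Longrightarrow> Y u \<in> tangent_space M (fst u)"
    and "u \<notin> mcarrier (slit M) \<Longrightarrow> Y u = 0"
    and "smooth_on (chart_image (slit M) i) (local_rep (slit M) i Y)"
  using assms unfolding psections_iff by blast+

lemma psection_eqI:
  assumes "X \<in> psections M" "Y \<in> psections M"
    and "\<And>i u. u \<in> cdom (slit M) i \<Longrightarrow> X u i = Y u i"
  shows "X = Y"
proof
  fix u show "X u = Y u"
  proof (cases "u \<in> mcarrier (slit M)")
    case True
    then obtain i where i: "u \<in> cdom (slit M) i" by (auto simp: mcarrier_def)
    then show ?thesis
      using assms(3)[OF i] psectionsD(1)[OF assms(1) True] psectionsD(1)[OF assms(2) True]
      by (intro tangent_space_eqI[of _ M "fst u" _ i]) (auto simp: slit_dom_iff)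
  qed (simp add: psectionsD(2)[OF assms(1)] psectionsD(2)[OF assms(2)])
qed

lemma psections_zero: "0 \<in> psections M"
  by (simp add: psections_iff tangent_space_zero smooth_on_const)

lemma psections_diff:
  assumes "X \<in> psections M" "Y \<in> psections M"
  shows "X - Y \<in> psections M"
  unfolding psections_iff
proof (intro conjI ballI allI impI)
  fix i show "smooth_on (chart_image (slit M) i) (local_rep (slit M) i (X - Y))"
    using smooth_on_diff[OF slit.open_chart_image psectionsD(3)[OF assms(1)] psectionsD(3)[OF assms(2)]]
    by simp
qed (simp_all add: psectionsD[OF assms(1)] psectionsD[OF assms(2)] tangent_space_diff)

lemma fundamental_section_component:
  "u \<in> cdom (slit M) i \<Longrightarrow> fundamental_section M u i = snd (cmap (slit M) i u)"
  by (simp add: fundamental_section_def cmap_slit slit_domD[of u M i])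

lemma fundamental_section_in_psections: "fundamental_section M \<in> psections M"
  unfolding psections_iff
proof (intro conjI ballI allI impI)
  fix i
  have "smooth_on (chart_image (slit M) i) snd"
    by (rule smooth_on_bounded_linear[OF bounded_linear_snd])
  then show "smooth_on (chart_image (slit M) i) (local_rep (slit M) i (fundamental_section M))"
    by (rule smooth_on_cong[OF slit.open_chart_image, THEN iffD1, rotated])
      (simp add: fundamental_section_component slit.cinv_in_cdom)
qed (simp_all add: fundamental_section_def slit_carrier_iff)

lemma gamF_in_vector_fields:
  assumes X: "X \<in> psections M"
  shows "gamF M X \<in> vector_fields (slit M)"
  unfolding slit.vector_fields_iff
proof (intro conjI ballI allI impI)
  fix i
  have "smooth_on (chart_image (slit M) i) (\<lambda>z. (0::'e, local_rep (slit M) i X z))"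
    by (intro smooth_on_Pair slit.open_chart_image smooth_on_const psectionsD(3)[OF X])
  then show "smooth_on (chart_image (slit M) i) (local_rep (slit M) i (gamF M X))"
    by (rule smooth_on_cong[OF slit.open_chart_image, THEN iffD1, rotated])
      (simp add: slit.cinv_in_carrier fieldwise_in gam_component slit.cinv_in_cdom)
qed (simp_all add: fieldwise_def gam_in_tangent_space psectionsD(1)[OF X])

lemma rhoF_in_psections:
  assumes X: "X \<in> vector_fields (slit M)"
  shows "rhoF M X \<in> psections M"
  unfolding psections_iff
proof (intro conjI ballI allI impI)
  fix i
  have "smooth_on (chart_image (slit M) i) (\<lambda>z. fst (local_rep (slit M) i X z))"
    by (intro smooth_on_fst slit.open_chart_image slit.vector_fieldsD(3)[OF X])
  then show "smooth_on (chart_image (slit M) i) (local_rep (slit M) i (rhoF M X))"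
    by (rule smooth_on_cong[OF slit.open_chart_image, THEN iffD1, rotated])
      (simp add: slit.cinv_in_carrier fieldwise_in rho_component slit.cinv_in_cdom
        slit.vector_fieldsD(1)[OF X])
qed (simp_all add: fieldwise_def rho_in_tangent_space slit.vector_fieldsD(1)[OF X])

lemma rhoF_gamF: "X \<in> psections M \<Longrightarrow> rhoF M (gamF M X) = 0"
  by (rule psection_eqI)
    (simp_all add: rhoF_in_psections gamF_in_vector_fields psections_zero fieldwise_in slit_domD
      rho_component gam_component gam_in_tangent_space psectionsD(1))

end

section \<open>Regular connections\<close>

locale regular_conn = slit_atlas M for M :: "('i, 'm, 'e::euclidean_space) atlas" +
  fixes D :: "('i, 'm, 'e) connection"
  assumes regular: "regular_connection M D"
begin

lemma linear_conn: "linear_connection M D"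
  using regular by (simp add: regular_connection_def)

lemma conn_smooth_map: "Y \<in> psections M \<Longrightarrow>
    smooth_map (tangent_bundle (slit M)) (pullback_bundle M) (\<lambda>(u, \<xi>). (u, D Y u \<xi>))"
  using linear_conn unfolding linear_connection_def by blast

lemma conn_add: "Y \<in> psections M \<Longrightarrow> u \<in> mcarrier (slit M) \<Longrightarrow> \<xi> \<in> tangent_space (slit M) u
    \<Longrightarrow> \<zeta> \<in> tangent_space (slit M) u \<Longrightarrow> D Y u (\<xi> + \<zeta>) = D Y u \<xi> + D Y u \<zeta>"
  using linear_conn unfolding linear_connection_def by blast

lemma conn_scl: "Y \<in> psections M \<Longrightarrow> u \<in> mcarrier (slit M) \<Longrightarrow> \<xi> \<in> tangent_space (slit M) u
    \<Longrightarrow> D Y u (scl a \<xi>) = scl a (D Y u \<xi>)"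
  using linear_conn unfolding linear_connection_def by blast

lemma conn_add_section: "Y \<in> psections M \<Longrightarrow> Z \<in> psections M \<Longrightarrow> u \<in> mcarrier (slit M)
    \<Longrightarrow> \<xi> \<in> tangent_space (slit M) u \<Longrightarrow> D (Y + Z) u \<xi> = D Y u \<xi> + D Z u \<xi>"
  using linear_conn unfolding linear_connection_def by blast

lemma conn_diff:
  assumes "Y \<in> psections M" "u \<in> mcarrier (slit M)"
    "\<xi> \<in> tangent_space (slit M) u" "\<zeta> \<in> tangent_space (slit M) u"
  shows "D Y u (\<xi> - \<zeta>) = D Y u \<xi> - D Y u \<zeta>"
  using conn_add[OF assms(1,2) slit.tangent_space_diff[OF assms(3,4)] assms(4)] by simp

lemma conn_minus:
  assumes "Y \<in> psections M" "u \<in> mcarrier (slit M)" "\<xi> \<in> tangent_space (slit M) u"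
  shows "D Y u (- \<xi>) = - D Y u \<xi>"
  using conn_diff[OF assms assms(3)] conn_diff[OF assms(1,2) slit.tangent_space_zero assms(3)] by simp

lemma conn_zero_section: "u \<in> mcarrier (slit M) \<Longrightarrow> \<xi> \<in> tangent_space (slit M) u \<Longrightarrow> D 0 u \<xi> = 0"
  using conn_add_section[OF psections_zero psections_zero, of u \<xi>] by simp

lemma conn_in_tangent_space:
  assumes "Y \<in> psections M" "u \<in> mcarrier (slit M)" "\<xi> \<in> tangent_space (slit M) u"
  shows "D Y u \<xi> \<in> tangent_space M (fst u)"
proof -
  have "(u, \<xi>) \<in> mcarrier (tangent_bundle (slit M))"
    using assms(2,3) by (auto simp: mcarrier_def tangent_bundle_def)
  then have "(u, D Y u \<xi>) \<in> mcarrier (pullback_bundle M)"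
    using conn_smooth_map[OF assms(1)] unfolding smooth_map_def by blast
  then show ?thesis by (auto simp: mcarrier_def pullback_bundle_def)
qed

text \<open>A connection is required to be smooth as a map on the tangent bundle of the slit tangent bundle.
  Composing with a smooth choice of tangent vectors gives smoothness in the base point, without
  reference to the charts of that iterated bundle.\<close>

lemma conn_smooth_on:
  assumes Y: "Y \<in> psections M" and w: "smooth_on (chart_image (slit M) i) w"
  shows "smooth_on (chart_image (slit M) i)
    (\<lambda>z. D Y (cinv (slit M) i z) (tangent_lift (slit M) i (cinv (slit M) i z) (w z)) i)"
proof -
  let ?U = "chart_image (slit M) i" and ?T = "tangent_bundle (slit M)" and ?N = "pullback_bundle M"
  let ?F = "\<lambda>(u, \<xi>). (u, D Y u \<xi>)"
  let ?P = "cmap ?T i ` (cdom ?T i \<inter> ?F -` cdom ?N i)"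
  let ?v = "\<lambda>z. tangent_lift (slit M) i (cinv (slit M) i z) (w z)"
  have P: "open ?P" and smooth: "smooth_on ?P (cmap ?N i \<circ> ?F \<circ> cinv ?T i)"
    using conn_smooth_map[OF Y] unfolding smooth_map_def by blast+
  have inj: "inj_on (cmap ?T i) (cdom ?T i)"
  proof (rule inj_onI)
    fix a b assume a: "a \<in> cdom ?T i" and b: "b \<in> cdom ?T i" and eq: "cmap ?T i a = cmap ?T i b"
    obtain u \<xi> v \<zeta> where ab: "a = (u, \<xi>)" "b = (v, \<zeta>)" by (cases a, cases b) auto
    then have uv: "u \<in> cdom (slit M) i" "v \<in> cdom (slit M) i" "\<xi> \<in> tangent_space (slit M) u"
        "\<zeta> \<in> tangent_space (slit M) v" "cmap (slit M) i u = cmap (slit M) i v" "\<xi> i = \<zeta> i"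
      using a b eq by (auto simp: tangent_bundle_def)
    then have "u = v" using inj_slit[of i] by (simp add: inj_on_def)
    then show "a = b" using uv ab tangent_space_eqI[of \<xi> "slit M" u \<zeta> i] by simp
  qed
  have dom: "(cinv (slit M) i z, ?v z) \<in> cdom ?T i" if "z \<in> ?U" for z
    using slit.cinv_in_cdom[OF that]
    by (simp add: tangent_bundle_def slit.tangent_lift_in_tangent_space)
  have cmapT: "cmap ?T i (cinv (slit M) i z, ?v z) = (z, w z)" if "z \<in> ?U" for z
    using that by (simp add: tangent_bundle_def slit.cinv_in_cdom)
  have cinvT: "cinv ?T i (z, w z) = (cinv (slit M) i z, ?v z)" if "z \<in> ?U" for z
    using inv_into_f_f[OF inj dom[OF that]] cmapT[OF that] by (simp add: cinv_def)
  have "smooth_on ?U (\<lambda>z. (cmap ?N i \<circ> ?F \<circ> cinv ?T i) (z, w z))"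
  proof (rule smooth_on_compose[where T="?P" and g="\<lambda>z. (z, w z)", OF slit.open_chart_image P _ smooth])
    show "(\<lambda>z. (z, w z)) ` ?U \<subseteq> ?P"
    proof (rule image_subsetI)
      fix z assume z: "z \<in> ?U"
      have "?F (cinv (slit M) i z, ?v z) \<in> cdom ?N i"
        using dom[OF z] slit.cinv_in_cdom[OF z] slit.cinv_in_carrier[OF z]
        by (auto simp: pullback_bundle_def tangent_bundle_def intro!: conn_in_tangent_space[OF Y])
      then show "(z, w z) \<in> ?P"
        using dom[OF z] cmapT[OF z] by (intro rev_image_eqI[of "(cinv (slit M) i z, ?v z)"]) auto
    qed
    show "smooth_on ?U (\<lambda>z. (z, w z))"
      by (intro smooth_on_Pair slit.open_chart_image smooth_on_bounded_linear bounded_linear_ident w)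
  qed
  from smooth_on_snd[OF slit.open_chart_image this] show ?thesis
    by (rule smooth_on_cong[OF slit.open_chart_image, THEN iffD1, rotated])
      (simp add: cinvT pullback_bundle_def)
qed

lemma cov_in: "u \<in> mcarrier (slit M) \<Longrightarrow> cov M D X Y u = D Y u (X u)"
  by (simp add: cov_def fieldwise_in)

lemma cov_in_psections:
  assumes X: "X \<in> vector_fields (slit M)" and Y: "Y \<in> psections M"
  shows "cov M D X Y \<in> psections M"
  unfolding psections_iff
proof (intro conjI ballI allI impI)
  fix i
  from conn_smooth_on[OF Y slit.vector_fieldsD(3)[OF X]]
  show "smooth_on (chart_image (slit M) i) (local_rep (slit M) i (cov M D X Y))"
    by (rule smooth_on_cong[OF slit.open_chart_image, THEN iffD1, rotated])
      (simp add: cov_in slit.cinv_in_carrier slit.cinv_in_cdom slit.vector_fieldsD(1)[OF X])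
qed (simp_all add: cov_def fieldwise_def conn_in_tangent_space[OF Y] slit.vector_fieldsD(1)[OF X])

lemma cov_zero_section: "X \<in> vector_fields (slit M) \<Longrightarrow> cov M D X 0 = 0"
  by (rule ext) (simp add: cov_def fieldwise_def conn_zero_section slit.vector_fieldsD(1))

lemma cov_add:
  assumes Y: "Y \<in> psections M" and "X \<in> vector_fields (slit M)" "Z \<in> vector_fields (slit M)"
    and W: "\<And>u. u \<in> mcarrier (slit M) \<Longrightarrow> W u = X u + Z u"
  shows "cov M D W Y = cov M D X Y + cov M D Z Y"
proof
  fix u show "cov M D W Y u = (cov M D X Y + cov M D Z Y) u"
  proof (cases "u \<in> mcarrier (slit M)")
    case True
    then show ?thesis
      using assms(2,3) by (simp add: cov_in W conn_add[OF Y] slit.vector_fieldsD(1))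
  qed (simp add: cov_def fieldwise_out)
qed

lemma KF_eq_cov: "KF M D X = cov M D X (fundamental_section M)"
  by (rule ext) (simp add: cov_def fieldwise_def connection_map_def)

lemma KF_in_psections: "X \<in> vector_fields (slit M) \<Longrightarrow> KF M D X \<in> psections M"
  by (simp add: KF_eq_cov cov_in_psections fundamental_section_in_psections)

lemma vertical_horizontal_trivial:
  assumes u: "u \<in> mcarrier (slit M)" and \<xi>: "\<xi> \<in> tangent_space (slit M) u"
    "rho M u \<xi> = 0" "connection_map M D u \<xi> = 0"
  shows "\<xi> = 0"
proof -
  have "\<xi> \<in> vertical_space M u \<inter> horizontal_space M D u"
    using \<xi> by (simp add: vertical_space_def horizontal_space_def)
  then show ?thesis using regular u unfolding regular_connection_def by blast
qed

lemma rho_add: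
  assumes u: "u \<in> mcarrier (slit M)"
    and "\<xi> \<in> tangent_space (slit M) u" "\<zeta> \<in> tangent_space (slit M) u"
  shows "rho M u (\<xi> + \<zeta>) = rho M u \<xi> + rho M u \<zeta>"
proof -
  obtain i where i: "u \<in> cdom (slit M) i" using u by (auto simp: mcarrier_def)
  then show ?thesis using assms
    by (intro tangent_space_eqI[of _ M "fst u" _ i])
      (simp_all add: rho_in_tangent_space tangent_space_add slit.tangent_space_add rho_component
        slit_dom_iff[of u M i])
qed

lemma rho_diff:
  assumes u: "u \<in> mcarrier (slit M)"
    and "\<xi> \<in> tangent_space (slit M) u" "\<zeta> \<in> tangent_space (slit M) u"
  shows "rho M u (\<xi> - \<zeta>) = rho M u \<xi> - rho M u \<zeta>"
  using rho_add[OF u slit.tangent_space_diff[OF assms(2,3)] assms(3)] by simp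

text \<open>The horizontal space is a complement of the kernel of \<open>\<rho>\<close>, and \<open>\<rho>\<close> is onto.\<close>

lemma rho_bij_horizontal:
  assumes u: "u \<in> mcarrier (slit M)"
  shows "inj_on (rho M u) (horizontal_space M D u)"
    and "tangent_space M (fst u) \<subseteq> rho M u ` horizontal_space M D u"
proof -
  have \<eta>: "fundamental_section M \<in> psections M" by (rule fundamental_section_in_psections)
  show "inj_on (rho M u) (horizontal_space M D u)"
  proof (rule inj_onI)
    fix \<xi> \<zeta> assume *: "\<xi> \<in> horizontal_space M D u" "\<zeta> \<in> horizontal_space M D u"
      and eq: "rho M u \<xi> = rho M u \<zeta>"
    then have t: "\<xi> \<in> tangent_space (slit M) u" "\<zeta> \<in> tangent_space (slit M) u"
      by (auto simp: horizontal_space_def)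
    have "\<xi> - \<zeta> = 0"
      using * eq
      by (intro vertical_horizontal_trivial[OF u slit.tangent_space_diff[OF t]])
        (simp_all add: rho_diff[OF u t] horizontal_space_def connection_map_def conn_diff[OF \<eta> u t] fun_eq_iff)
    then show "\<xi> = \<zeta>" by simp
  qed
  show "tangent_space M (fst u) \<subseteq> rho M u ` horizontal_space M D u"
  proof
    fix v assume v: "v \<in> tangent_space M (fst u)"
    obtain i where i: "u \<in> cdom (slit M) i" using u by (auto simp: mcarrier_def)
    let ?\<xi> = "tangent_lift (slit M) i u (v i, 0)"
    have \<xi>: "?\<xi> \<in> tangent_space (slit M) u" by (rule slit.tangent_lift_in_tangent_space[OF i])
    have "rho M u ?\<xi> = v"
      using i rho_in_tangent_space[OF u \<xi>] v
      by (intro tangent_space_eqI[of _ M "fst u" _ i]) (simp_all add: rho_component[OF i \<xi>] slit_dom_iff[of u M i])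
    moreover obtain a b where ab: "a \<in> vertical_space M u" "b \<in> horizontal_space M D u" "?\<xi> = a + b"
      using regular u \<xi> unfolding regular_connection_def by blast
    ultimately have "rho M u b = v"
      using rho_add[OF u, of a b] by (simp add: vertical_space_def horizontal_space_def)
    then show "v \<in> rho M u ` horizontal_space M D u" using ab(2) by blast
  qed
qed

lemma horizontal_map:
  assumes u: "u \<in> mcarrier (slit M)" and v: "v \<in> tangent_space M (fst u)"
  shows "horizontal_map M D u v \<in> tangent_space (slit M) u"
    and "rho M u (horizontal_map M D u v) = v"
    and "connection_map M D u (horizontal_map M D u v) = 0"
proof -
  have v': "v \<in> rho M u ` horizontal_space M D u" using rho_bij_horizontal(2)[OF u] v by blast
  show "rho M u (horizontal_map M D u v) = v"
    unfolding horizontal_map_def by (rule f_inv_into_f[OF v'])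
  have "horizontal_map M D u v \<in> horizontal_space M D u"
    unfolding horizontal_map_def by (rule inv_into_into[OF v'])
  then show "horizontal_map M D u v \<in> tangent_space (slit M) u"
      "connection_map M D u (horizontal_map M D u v) = 0"
    by (simp_all add: horizontal_space_def)
qed

text \<open>In a chart, the vertical component of \<open>\<beta>X\<close> solves the linear system \<open>K (X, w) = 0\<close> in \<open>w\<close>, whose
  coefficients are smooth, and regularity makes the system uniquely solvable.\<close>

lemma betaF_in_vector_fields:
  assumes X: "X \<in> psections M"
  shows "betaF M D X \<in> vector_fields (slit M)"
  unfolding slit.vector_fields_iff
proof (intro conjI ballI allI impI)
  have tangent: "betaF M D X u \<in> tangent_space (slit M) u" if "u \<in> mcarrier (slit M)" for u
    using that by (simp add: fieldwise_in horizontal_map(1) psectionsD(1)[OF X])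
  then show "betaF M D X u \<in> tangent_space (slit M) u" if "u \<in> mcarrier (slit M)" for u
    using that .
  show "betaF M D X u = 0" if "u \<notin> mcarrier (slit M)" for u using that by (simp add: fieldwise_out)
  fix i
  let ?U = "chart_image (slit M) i" and ?c = "cinv (slit M) i" and ?\<eta> = "fundamental_section M"
  have \<eta>: "?\<eta> \<in> psections M" by (rule fundamental_section_in_psections)
  define Kl where "Kl z \<xi> = D ?\<eta> (?c z) (tangent_lift (slit M) i (?c z) \<xi>) i" for z and \<xi> :: "'e \<times> 'e"
  have z: "?c z \<in> cdom (slit M) i" "?c z \<in> mcarrier (slit M)" if "z \<in> ?U" for z
    using slit.cinv_in_cdom[OF that] slit.cinv_in_carrier[OF that] .
  have lift: "tangent_lift (slit M) i (?c z) \<xi> \<in> tangent_space (slit M) (?c z)" if "z \<in> ?U" for z \<xi>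
    by (rule slit.tangent_lift_in_tangent_space[OF z(1)[OF that]])
  have Kl_linear: "linear (Kl z)" if "z \<in> ?U" for z
    by (rule linearI)
      (simp_all add: Kl_def slit.tangent_lift_add[OF z(1)[OF that]] slit.tangent_lift_scale[OF z(1)[OF that]]
        conn_add[OF \<eta> z(2)[OF that] lift[OF that] lift[OF that]] conn_scl[OF \<eta> z(2)[OF that] lift[OF that]],
        simp add: scl_def)
  have Kl_smooth: "smooth_on ?U (\<lambda>z. Kl z (w z))" if "smooth_on ?U w" for w
    unfolding Kl_def by (rule conn_smooth_on[OF \<eta> that])
  define w where "w z = snd (local_rep (slit M) i (betaF M D X) z)" for z
  have \<beta>: "local_rep (slit M) i (betaF M D X) z = (local_rep (slit M) i X z, w z)" if "z \<in> ?U" for z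
    using rho_component[OF z(1)[OF that] tangent[OF z(2)[OF that]]]
      horizontal_map(2)[OF z(2)[OF that] psectionsD(1)[OF X z(2)[OF that]]]
    by (simp add: w_def fieldwise_in[OF z(2)[OF that]] prod_eq_iff)
  have sol: "Kl z (0, w z) = - Kl z (local_rep (slit M) i X z, 0)" if U: "z \<in> ?U" for z
  proof -
    have "Kl z (local_rep (slit M) i X z, w z) = 0"
      using horizontal_map(3)[OF z(2)[OF U] psectionsD(1)[OF X z(2)[OF U]]]
        slit.tangent_lift_eq[OF z(1)[OF U] tangent[OF z(2)[OF U]]]
      unfolding \<beta>[OF U] by (simp add: Kl_def connection_map_def fieldwise_in[OF z(2)[OF U]])
    moreover have "Kl z (local_rep (slit M) i X z, w z) = Kl z (local_rep (slit M) i X z, 0) + Kl z (0, w z)"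
      using linear_add[OF Kl_linear[OF U], of "(local_rep (slit M) i X z, 0)" "(0, w z)"] by simp
    ultimately show ?thesis by (simp add: add_eq_0_iff)
  qed
  have "smooth_on ?U w"
  proof (rule smooth_on_linear_solve[where B="\<lambda>z b. Kl z (0, b)" and w=w, OF slit.open_chart_image])
    show lin: "linear (\<lambda>b. Kl z (0, b))" if "z \<in> ?U" for z
      using linear_compose[OF _ Kl_linear[OF that], of "\<lambda>b. (0, b)"]
      by (simp add: o_def linear_iff)
    show "inj (\<lambda>b. Kl z (0, b))" if U: "z \<in> ?U" for z
      unfolding linear_injective_0[OF lin[OF U]]
    proof (intro allI impI)
      fix b assume b: "Kl z (0, b) = 0"
      let ?\<xi> = "tangent_lift (slit M) i (?c z) (0, b)"
      have "rho M (?c z) ?\<xi> = 0"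
        using rho_component[OF z(1)[OF U] lift[OF U]] z(1)[OF U]
        by (intro tangent_space_eqI[of _ M "fst (?c z)" _ i] rho_in_tangent_space z(2)[OF U] lift[OF U]
            tangent_space_zero) (simp_all add: slit_dom_iff)
      moreover have "connection_map M D (?c z) ?\<xi> = 0"
        using b conn_in_tangent_space[OF \<eta> z(2)[OF U] lift[OF U]] z(1)[OF U]
        by (intro tangent_space_eqI[of _ M "fst (?c z)" _ i] tangent_space_zero)
          (simp_all add: slit_dom_iff connection_map_def Kl_def)
      ultimately have "?\<xi> = 0" by (rule vertical_horizontal_trivial[OF z(2)[OF U] lift[OF U]])
      then show "b = 0"
        using slit.tangent_lift_component[OF z(1)[OF U], of "(0, b)"] by (simp add: zero_prod_def)
    qed
    show "smooth_on ?U (\<lambda>z. Kl z (0, b))" for b by (rule Kl_smooth[OF smooth_on_const])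
    show "smooth_on ?U (\<lambda>z. - Kl z (local_rep (slit M) i X z, 0))"
      by (intro smooth_on_minus Kl_smooth smooth_on_Pair smooth_on_const slit.open_chart_image psectionsD(3)[OF X])
    show "Kl z (0, w z) = - Kl z (local_rep (slit M) i X z, 0)" if "z \<in> ?U" for z by (rule sol[OF that])
  qed
  then have "smooth_on ?U (\<lambda>z. (local_rep (slit M) i X z, w z))"
    by (intro smooth_on_Pair slit.open_chart_image psectionsD(3)[OF X])
  then show "smooth_on ?U (local_rep (slit M) i (betaF M D X))"
    by (rule smooth_on_cong[OF slit.open_chart_image, THEN iffD1, rotated]) (simp add: \<beta>)
qed

lemma rhoF_betaF:
  assumes X: "X \<in> psections M"
  shows "rhoF M (betaF M D X) = X"
proof
  fix u show "rhoF M (betaF M D X) u = X u"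
  proof (cases "u \<in> mcarrier (slit M)")
    case True
    then show ?thesis by (simp only: fieldwise_in horizontal_map(2) psectionsD(1)[OF X])
  qed (simp only: fieldwise_out psectionsD(2)[OF X] not_False_eq_True)
qed

lemma KF_betaF:
  assumes X: "X \<in> psections M"
  shows "KF M D (betaF M D X) = 0"
proof
  fix u show "KF M D (betaF M D X) u = 0 u"
  proof (cases "u \<in> mcarrier (slit M)")
    case True
    then show ?thesis
      by (simp only: fieldwise_in horizontal_map(3) psectionsD(1)[OF X] zero_fun_apply)
  qed (simp only: fieldwise_out zero_fun_apply not_False_eq_True)
qed

end

section \<open>Hessians\<close>

abbreviation hess :: "('a::euclidean_space \<Rightarrow> real) \<Rightarrow> 'a \<Rightarrow> 'a \<Rightarrow> 'a \<Rightarrow> real"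
  where "hess f z a b \<equiv> dder (\<lambda>x. dder f x b) z a"

abbreviation third :: "('a::euclidean_space \<Rightarrow> real) \<Rightarrow> 'a \<Rightarrow> 'a \<Rightarrow> 'a \<Rightarrow> 'a \<Rightarrow> real"
  where "third f z c a b \<equiv> dder (\<lambda>x. hess f x a b) z c"

locale smooth_real_function =
  fixes S :: "'a::euclidean_space set" and f :: "'a \<Rightarrow> real"
  assumes open_dom: "open S" and smooth: "smooth_on S f"
begin

lemma dder_linear: "x \<in> S \<Longrightarrow> linear (dder f x)"
  by (intro bounded_linear.linear bounded_linear_dder smooth_on_differentiable[OF smooth])

lemma hess_sym: "z \<in> S \<Longrightarrow> hess f z a b = hess f z b a"
  by (rule second_derivative_symmetric[OF open_dom _ smooth])

lemma hess_linear_left: "z \<in> S \<Longrightarrow> linear (\<lambda>a. hess f z a b)"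
  by (intro bounded_linear.linear bounded_linear_dder
      smooth_on_differentiable[OF smooth_on_dder_const[OF smooth]])

lemma hess_linear_right: "z \<in> S \<Longrightarrow> linear (\<lambda>b. hess f z a b)"
  using hess_linear_left[of z a] by (subst hess_sym) auto

lemma third_sym_left: "z \<in> S \<Longrightarrow> third f z c a b = third f z a c b"
  by (rule second_derivative_symmetric[OF open_dom _ smooth_on_dder_const[OF smooth]])

lemma third_sym_right:
  assumes "z \<in> S"
  shows "third f z c a b = third f z c b a"
proof -
  have "dder (\<lambda>x. hess f x a b) z = dder (\<lambda>x. hess f x b a) z"
    by (rule dder_cong_open[OF open_dom assms]) (rule hess_sym)
  then show ?thesis by (rule fun_cong)
qed

lemma has_derivative_dder_apply:
  assumes z: "z \<in> S" and \<alpha>: "(\<alpha> has_derivative \<alpha>') (at z)"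
  shows "((\<lambda>x. dder f x (\<alpha> x)) has_derivative (\<lambda>c. hess f z c (\<alpha> z) + dder f z (\<alpha>' c))) (at z)"
  by (rule has_derivative_linear_family[where A="\<lambda>x. dder f x" and f=\<alpha> and f'=\<alpha>', OF open_dom z
        dder_linear smooth_on_has_derivative[OF smooth_on_dder_const[OF smooth] z] \<alpha>])

text \<open>The Hessian is a field of bilinear maps, so its value on two moving vectors obeys the product
  rule with three terms.\<close>

lemma has_derivative_hess_apply:
  assumes z: "z \<in> S" and \<alpha>: "(\<alpha> has_derivative \<alpha>') (at z)" and \<beta>: "(\<beta> has_derivative \<beta>') (at z)"
  shows "((\<lambda>x. hess f x (\<alpha> x) (\<beta> x)) has_derivative
    (\<lambda>c. third f z c (\<alpha> z) (\<beta> z) + hess f z (\<alpha> z) (\<beta>' c) + hess f z (\<alpha>' c) (\<beta> z))) (at z)"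
proof -
  have A: "((\<lambda>x. hess f x v (\<beta> x)) has_derivative (\<lambda>c. third f z c v (\<beta> z) + hess f z v (\<beta>' c))) (at z)"
    for v
    by (rule has_derivative_linear_family[where A="\<lambda>x b. hess f x v b" and f=\<beta> and f'=\<beta>', OF open_dom z
        hess_linear_right smooth_on_has_derivative[OF smooth_on_dder_const[OF smooth_on_dder_const[OF smooth]] z] \<beta>])
  show ?thesis
    by (rule has_derivative_linear_family[where A="\<lambda>x a. hess f x a (\<beta> x)" and f=\<alpha> and f'=\<alpha>', OF open_dom z
        hess_linear_left A \<alpha>])
qed

lemma line_derivative:
  assumes "z \<in> S"
  shows "((\<lambda>t. f (z + t *\<^sub>R a)) has_real_derivative dder f z a) (at 0)"
proof -
  have line: "((\<lambda>t. z + t *\<^sub>R a) has_derivative (\<lambda>t. t *\<^sub>R a)) (at 0)"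
    using has_derivative_add[OF has_derivative_const[of z]
        bounded_linear_imp_has_derivative[OF bounded_linear_scaleR_left[of a]]] by simp
  have f: "(f has_derivative dder f z) (at (z + 0 *\<^sub>R a))"
    using smooth_on_has_derivative[OF smooth assms] by simp
  have "((\<lambda>t. f (z + t *\<^sub>R a)) has_derivative (\<lambda>t. dder f z (t *\<^sub>R a))) (at 0)"
    by (rule has_derivative_compose[where f="\<lambda>t. z + t *\<^sub>R a" and f'="\<lambda>t. t *\<^sub>R a" and g=f
          and g'="dder f z", OF line f])
  then show ?thesis
    unfolding has_field_derivative_def
    by (rule has_derivative_eq_rhs) (simp add: fun_eq_iff linear_scale[OF dder_linear[OF assms]])
qed

lemma eventually_on_line:
  assumes "z \<in> S"
  shows "\<forall>\<^sub>F t in nhds 0. z + t *\<^sub>R a \<in> S"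
proof -
  have "((\<lambda>t. z + t *\<^sub>R a) \<longlongrightarrow> z + 0 *\<^sub>R a) (nhds 0)"
    by (intro tendsto_intros filterlim_ident)
  then show ?thesis using assms open_dom by (intro topological_tendstoD[of _ z]) simp_all
qed

end

section \<open>The energy in a chart\<close>

lemma (in smooth_atlas) fun_differential_chart:
  assumes p: "p \<in> cdom M i" and v: "v \<in> tangent_space M p"
    and f: "(f \<circ> cinv M i) differentiable (at (cmap M i p))"
  shows "fun_differential M f p v = dder (f \<circ> cinv M i) (cmap M i p) (v i)"
proof -
  define j where "j = chart_at M p"
  have j: "p \<in> cdom M j" unfolding j_def chart_at_def using p by (rule someI)
  let ?W = "cmap M j ` (cdom M j \<inter> cdom M i)"
  have W: "open ?W" "cmap M j p \<in> ?W" using open_overlap p j by auto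
  have eq: "(f \<circ> cinv M j) x = (f \<circ> cinv M i) (transition M j i x)" if "x \<in> ?W" for x
    using that by (auto simp: transition_cmap)
  have t: "(transition M j i has_derivative dder (transition M j i) (cmap M j p)) (at (cmap M j p))"
    by (intro has_derivative_dder transition_differentiable p j)
  have f': "((f \<circ> cinv M i) has_derivative dder (f \<circ> cinv M i) (cmap M i p))
      (at (transition M j i (cmap M j p)))"
    using has_derivative_dder[OF f] by (simp add: transition_cmap j)
  have "((\<lambda>x. (f \<circ> cinv M i) (transition M j i x)) has_derivative
      (\<lambda>v. dder (f \<circ> cinv M i) (cmap M i p) (dder (transition M j i) (cmap M j p) v))) (at (cmap M j p))"
    by (rule has_derivative_compose[where f="transition M j i" and g="f \<circ> cinv M i"
          and f'="dder (transition M j i) (cmap M j p)" and g'="dder (f \<circ> cinv M i) (cmap M i p)", OF t f'])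
  then have "((f \<circ> cinv M j) has_derivative
      (\<lambda>v. dder (f \<circ> cinv M i) (cmap M i p) (dder (transition M j i) (cmap M j p) v))) (at (cmap M j p))"
    by (rule has_derivative_cong_open[OF W, THEN iffD2, rotated]) (rule eq)
  from dder_eqI[OF this] show ?thesis
    using tangent_space_transition[OF v j p] by (simp add: fun_differential_def Let_def flip: j_def)
qed

locale finsler = slit_atlas M for M :: "('i, 'm, 'e::euclidean_space) atlas" +
  fixes L :: "('i, 'm, 'e) tpoint \<Rightarrow> real"
  assumes finsler: "finsler_manifold M L"
begin

definition energy_rep :: "'i \<Rightarrow> 'e \<times> 'e \<Rightarrow> real"
  where "energy_rep i z = energy L (cinv (slit M) i z)"

lemma L_smooth: "smooth_on (chart_image (slit M) i) (L \<circ> cinv (slit M) i)"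
  using finsler by (simp add: finsler_manifold_def smooth_fun_def)

lemma e_smooth: "smooth_on (chart_image (slit M) i) (energy_rep i)"
proof -
  have "smooth_on (chart_image (slit M) i)
      (\<lambda>z. ((L \<circ> cinv (slit M) i) z * (L \<circ> cinv (slit M) i) z) *\<^sub>R (1 / 2 :: real))"
    by (intro smooth_on_bounded_linear_comp[OF bounded_linear_scaleR_left]
        smooth_on_bilinear[OF bounded_bilinear_mult] slit.open_chart_image L_smooth)
  then show ?thesis by (simp add: energy_rep_def[abs_def] energy_def power2_eq_square)
qed

sublocale e: smooth_real_function "chart_image (slit M) i" "energy_rep i" for i
  by unfold_locales (rule slit.open_chart_image e_smooth)+

lemma slit_image: "chart_image (slit M) i = chart_image M i \<times> (- {0})"
  using slit_overlap[of i i] by simp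

lemma dder_e_eq_L:
  assumes z: "z \<in> chart_image (slit M) i"
  shows "dder (energy_rep i) z a = L (cinv (slit M) i z) * dder (L \<circ> cinv (slit M) i) z a"
proof -
  note d = smooth_on_has_derivative[OF L_smooth z]
  have "(energy_rep i has_derivative (\<lambda>a. ((L \<circ> cinv (slit M) i) z * dder (L \<circ> cinv (slit M) i) z a
        + dder (L \<circ> cinv (slit M) i) z a * (L \<circ> cinv (slit M) i) z) * (1 / 2))) (at z)"
    using bounded_linear.has_derivative[OF bounded_linear_mult_left[of "1 / 2"] has_derivative_mult[OF d d]]
    by (simp add: energy_rep_def[abs_def] energy_def power2_eq_square)
  from dder_eqI[OF this] show ?thesis by simp
qed

lemma e_at_vector:
  assumes p: "p \<in> cdom M i" and v: "v \<in> tangent_space M p" and "v i \<noteq> 0"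
  shows "energy L (p, v) = energy_rep i (cmap M i p, v i)"
proof -
  have "(p, v) \<in> cdom (slit M) i" using assms by (auto simp: slit_dom_iff)
  from slit.cinv_cmap[OF this] show ?thesis by (simp add: energy_rep_def cmap_slit)
qed

lemma e_homogeneous:
  assumes z: "z \<in> chart_image (slit M) i" and a: "a > 0"
  shows "energy_rep i (fst z, a *\<^sub>R snd z) = a\<^sup>2 * energy_rep i z"
proof -
  let ?u = "cinv (slit M) i z"
  have u: "?u \<in> cdom (slit M) i" by (rule slit.cinv_in_cdom[OF z])
  then have u': "fst ?u \<in> cdom M i" "snd ?u \<in> tangent_space M (fst ?u)" by (auto simp: slit_dom_iff)
  have z0: "snd z \<noteq> 0" using z by (auto simp: slit_image)
  have "(fst ?u, snd ?u) \<in> mcarrier (tangent_bundle M)"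
    using u' by (auto simp: mcarrier_def tangent_bundle_def)
  then have "L (fst ?u, scl a (snd ?u)) = a * L ?u"
    using finsler a unfolding finsler_manifold_def by fastforce
  then have "energy L (fst ?u, scl a (snd ?u)) = a\<^sup>2 * energy L ?u"
    by (simp add: energy_def power_mult_distrib)
  moreover have "energy L (fst ?u, scl a (snd ?u)) = energy_rep i (fst z, a *\<^sub>R snd z)"
  proof -
    have comp: "cmap M i (fst ?u) = fst z" "scl a (snd ?u) i = a *\<^sub>R snd z"
      using slit.cmap_cinv[OF z] unfolding cmap_slit scl_def by (metis fst_conv, metis snd_conv)
    then have "scl a (snd ?u) i \<noteq> 0" using z0 a by simp
    from e_at_vector[OF u'(1) tangent_space_scl[OF u'(2)] this] show ?thesis
      unfolding comp .
  qed
  ultimately show ?thesis by (simp add: energy_rep_def)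
qed

text \<open>Euler's relation for the energy, which is homogeneous of degree two. The relations for its first
  and second derivatives, below, arise from it by repeated differentiation.\<close>

lemma e_euler:
  assumes z: "z \<in> chart_image (slit M) i"
  shows "dder (energy_rep i) z (0, snd z) = 2 * energy_rep i z"
proof -
  have "((\<lambda>t. energy_rep i (z + t *\<^sub>R (0, snd z))) has_real_derivative dder (energy_rep i) z (0, snd z)) (at 0)"
    by (rule e.line_derivative[OF z])
  moreover have "((\<lambda>t. energy_rep i (z + t *\<^sub>R (0, snd z))) has_real_derivative 2 * energy_rep i z) (at 0)"
  proof (rule DERIV_cong_ev[THEN iffD2])
    show "\<forall>\<^sub>F t in nhds 0. energy_rep i (z + t *\<^sub>R (0, snd z)) = (1 + t)\<^sup>2 * energy_rep i z"
    proof -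
      have "\<forall>\<^sub>F t in nhds (0::real). t \<in> {-1<..}"
        by (rule eventually_nhds_in_open) auto
      then show ?thesis
      proof eventually_elim
        case (elim t)
        have "z + t *\<^sub>R (0, snd z) = (fst z, (1 + t) *\<^sub>R snd z)"
          by (simp add: prod_eq_iff algebra_simps)
        then show ?case using e_homogeneous[OF z, of "1 + t"] elim by simp
      qed
    qed
    show "((\<lambda>t. (1 + t)\<^sup>2 * energy_rep i z) has_real_derivative 2 * energy_rep i z) (at 0)"
      by (auto intro!: derivative_eq_intros)
  qed simp_all
  ultimately show ?thesis by (rule DERIV_unique)
qed

lemma e_euler_hess:
  assumes z: "z \<in> chart_image (slit M) i"
  shows "hess (energy_rep i) z a (0, snd z) + dder (energy_rep i) z (0, snd a) = 2 * dder (energy_rep i) z a"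
proof -
  have snd: "((\<lambda>x. (0::'e, snd x)) has_derivative (\<lambda>a. (0, snd a))) (at z)" for z :: "'e \<times> 'e"
    by (intro bounded_linear_imp_has_derivative bounded_linear_Pair bounded_linear_zero bounded_linear_snd)
  have "((\<lambda>x. dder (energy_rep i) x (0, snd x)) has_derivative
      (\<lambda>a. hess (energy_rep i) z a (0, snd z) + dder (energy_rep i) z (0, snd a))) (at z)"
    by (rule e.has_derivative_dder_apply[OF z snd])
  moreover have "((\<lambda>x. 2 * energy_rep i x) has_derivative (\<lambda>a. 2 * dder (energy_rep i) z a)) (at z)"
    by (intro has_derivative_mult_right smooth_on_has_derivative[OF e_smooth z])
  then have "((\<lambda>x. dder (energy_rep i) x (0, snd x)) has_derivative (\<lambda>a. 2 * dder (energy_rep i) z a)) (at z)"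
    by (rule has_derivative_cong_open[OF slit.open_chart_image z, THEN iffD2, rotated]) (rule e_euler)
  ultimately show ?thesis by (rule fun_cong[OF has_derivative_unique])
qed

lemma e_euler_hess_vertical:
  assumes z: "z \<in> chart_image (slit M) i"
  shows "hess (energy_rep i) z (0, w) (0, snd z) = dder (energy_rep i) z (0, w)"
  using e_euler_hess[OF z, of "(0, w)"] by simp

lemma e_euler_third:
  assumes z: "z \<in> chart_image (slit M) i"
  shows "third (energy_rep i) z c (0, w) (0, snd z) + hess (energy_rep i) z (0, w) (0, snd c) = hess (energy_rep i) z c (0, w)"
proof -
  have snd: "((\<lambda>x. (0::'e, snd x)) has_derivative (\<lambda>a. (0, snd a))) (at z)" for z :: "'e \<times> 'e"
    by (intro bounded_linear_imp_has_derivative bounded_linear_Pair bounded_linear_zero bounded_linear_snd)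
  have "((\<lambda>x. hess (energy_rep i) x (0, w) (0, snd x)) has_derivative
      (\<lambda>c. third (energy_rep i) z c (0, w) (0, snd z) + hess (energy_rep i) z (0, w) (0, snd c) + hess (energy_rep i) z 0 (0, snd z)))
      (at z)"
    by (rule e.has_derivative_hess_apply[OF z has_derivative_const snd])
  moreover have "((\<lambda>x. hess (energy_rep i) x (0, w) (0, snd x)) has_derivative
      (\<lambda>c. hess (energy_rep i) z c (0, w))) (at z)"
    by (rule has_derivative_cong_open[OF slit.open_chart_image z, THEN iffD2, rotated,
          OF smooth_on_has_derivative[OF smooth_on_dder_const[OF e_smooth] z]])
      (rule e_euler_hess_vertical)
  ultimately have "third (energy_rep i) z c (0, w) (0, snd z) + hess (energy_rep i) z (0, w) (0, snd c)
      + hess (energy_rep i) z 0 (0, snd z) = hess (energy_rep i) z c (0, w)"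
    by (rule fun_cong[OF has_derivative_unique])
  then show ?thesis using linear_0[OF e.hess_linear_left[OF z]] by simp
qed

text \<open>The metric is defined by differentiating along straight lines in the fibre. Such a line stays in
  the chart for small times, where it is a straight line of the second coordinate.\<close>

lemma finsler_metric_chart:
  assumes u: "u \<in> cdom (slit M) i" and v: "v \<in> tangent_space M (fst u)" "w \<in> tangent_space M (fst u)"
  shows "finsler_metric L u v w = hess (energy_rep i) (cmap (slit M) i u) (0, v i) (0, w i)"
proof -
  let ?z = "cmap (slit M) i u" and ?U = "chart_image (slit M) i"
  have z: "?z \<in> ?U" using u by blast
  have u': "fst u \<in> cdom M i" "snd u \<in> tangent_space M (fst u)" using u by (auto simp: slit_dom_iff)
  let ?G = "\<lambda>s t. ?z + s *\<^sub>R (0, v i) + t *\<^sub>R (0, w i)"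
  have en: "energy L (fst u, snd u + scl s v + scl t w) = energy_rep i (?G s t)" if "?G s t \<in> ?U" for s t
  proof -
    have "snd (?G s t) \<in> - {0}" using that unfolding slit_image mem_Times_iff by blast
    then have "(snd u + scl s v + scl t w) i \<noteq> 0" by (simp add: cmap_slit scl_def)
    moreover have "snd u + scl s v + scl t w \<in> tangent_space M (fst u)"
      by (intro tangent_space_add tangent_space_scl u' v)
    moreover have "?G s t = (cmap M i (fst u), (snd u + scl s v + scl t w) i)"
      by (simp add: cmap_slit scl_def)
    ultimately show ?thesis using e_at_vector[OF u'(1)] by metis
  qed
  \<comment> \<open>The formula is required for all small \<open>s\<close>, since it is next differentiated in \<open>s\<close>.\<close>
  have inner: "deriv (\<lambda>t. energy L (fst u, snd u + scl s v + scl t w)) 0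
      = dder (energy_rep i) (?z + s *\<^sub>R (0, v i)) (0, w i)" if s: "?z + s *\<^sub>R (0, v i) \<in> ?U" for s
  proof -
    have "\<forall>\<^sub>F t in nhds 0. energy L (fst u, snd u + scl s v + scl t w) = energy_rep i (?G s t)"
      using e.eventually_on_line[OF s, of "(0, w i)"] by eventually_elim (rule en)
    then have "deriv (\<lambda>t. energy L (fst u, snd u + scl s v + scl t w)) 0 = deriv (\<lambda>t. energy_rep i (?G s t)) 0"
      by (rule deriv_cong_ev) simp
    also have "\<dots> = dder (energy_rep i) (?z + s *\<^sub>R (0, v i)) (0, w i)"
      by (rule DERIV_imp_deriv[OF e.line_derivative[OF s]])
    finally show ?thesis .
  qed
  interpret de: smooth_real_function ?U "\<lambda>x. dder (energy_rep i) x (0, w i)"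
    by unfold_locales (rule slit.open_chart_image smooth_on_dder_const[OF e_smooth])+
  have "\<forall>\<^sub>F s in nhds 0. deriv (\<lambda>t. energy L (fst u, snd u + scl s v + scl t w)) 0
      = dder (energy_rep i) (?z + s *\<^sub>R (0, v i)) (0, w i)"
    using e.eventually_on_line[OF z, of "(0, v i)"] by eventually_elim (rule inner)
  then have "finsler_metric L u v w = deriv (\<lambda>s. dder (energy_rep i) (?z + s *\<^sub>R (0, v i)) (0, w i)) 0"
    unfolding finsler_metric_def by (rule deriv_cong_ev) simp
  also have "\<dots> = hess (energy_rep i) ?z (0, v i) (0, w i)"
    by (rule DERIV_imp_deriv[OF de.line_derivative[OF z]])
  finally show ?thesis .
qed

text \<open>Positive definiteness, in the form in which it is applied: the sections \<open>V\<close> will be differences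
  of sections produced by connections.\<close>

lemma section_eq_zeroI:
  assumes V: "V \<in> psections M"
    and null: "\<And>i u. u \<in> cdom (slit M) i \<Longrightarrow> hess (energy_rep i) (cmap (slit M) i u) (0, V u i) (0, V u i) = 0"
  shows "V = 0"
proof
  fix u show "V u = 0 u"
  proof (cases "u \<in> mcarrier (slit M)")
    case True
    then obtain i where i: "u \<in> cdom (slit M) i" by (auto simp: mcarrier_def)
    have "finsler_metric L u (V u) (V u) = 0"
      using null[OF i] psectionsD(1)[OF V True] by (simp add: finsler_metric_chart[OF i])
    moreover have "V u \<noteq> 0 \<Longrightarrow> finsler_metric L u (V u) (V u) > 0"
      using finsler True psectionsD(1)[OF V True] by (simp add: finsler_manifold_def)
    ultimately show ?thesis by auto
  qed (simp add: psectionsD(2)[OF V])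
qed

end

section \<open>Horizontal lifts, brackets and torsions in a chart\<close>

text \<open>The coefficients of the horizontal distribution: in a chart, \<open>\<beta>X = (X, b)\<close> where the vertical
  part \<open>b\<close> is classically written \<open>- N(X)\<close>. The part \<open>b\<close> depends on the chart, so it is a function of
  coordinates and not a section.\<close>

definition hcoef :: "('i, 'm, 'e::euclidean_space) atlas \<Rightarrow> ('i, 'm, 'e) connection \<Rightarrow> 'i
    \<Rightarrow> ('i, 'm, 'e) psection \<Rightarrow> 'e \<times> 'e \<Rightarrow> 'e"
  where "hcoef M D i X z = snd (betaF M D X (cinv (slit M) i z) i)"

context slit_atlas
begin

lemma rhoF_component:
  "W \<in> vector_fields (slit M) \<Longrightarrow> u \<in> cdom (slit M) i \<Longrightarrow> rhoF M W u i = fst (W u i)"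
  by (simp add: fieldwise_in slit_domD rho_component slit.vector_fieldsD(1))

lemma gamF_component: "u \<in> cdom (slit M) i \<Longrightarrow> gamF M X u i = (0, X u i)"
  by (simp add: fieldwise_in slit_domD gam_component)

lemma dder_gamF:
  assumes X: "X \<in> psections M" and z: "z \<in> chart_image (slit M) i"
  shows "dder (local_rep (slit M) i (gamF M X)) z a = (0, dder (local_rep (slit M) i X) z a)"
proof -
  have "((\<lambda>x. (0::'e, local_rep (slit M) i X x)) has_derivative
      (\<lambda>a. (0, dder (local_rep (slit M) i X) z a))) (at z)"
    by (intro has_derivative_Pair has_derivative_const smooth_on_has_derivative[OF psectionsD(3)[OF X] z])
  then have "(local_rep (slit M) i (gamF M X) has_derivative
      (\<lambda>a. (0, dder (local_rep (slit M) i X) z a))) (at z)"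
    by (rule has_derivative_cong_open[OF slit.open_chart_image z, THEN iffD2, rotated])
      (simp add: gamF_component slit.cinv_in_cdom)
  from dder_eqI[OF this] show ?thesis by simp
qed

lemma dder_rhoF:
  assumes W: "W \<in> vector_fields (slit M)" and z: "z \<in> chart_image (slit M) i"
  shows "dder (local_rep (slit M) i (rhoF M W)) z a = fst (dder (local_rep (slit M) i W) z a)"
proof -
  have "((\<lambda>x. fst (local_rep (slit M) i W x)) has_derivative
      (\<lambda>a. fst (dder (local_rep (slit M) i W) z a))) (at z)"
    by (intro has_derivative_fst smooth_on_has_derivative[OF slit.vector_fieldsD(3)[OF W] z])
  then have "(local_rep (slit M) i (rhoF M W) has_derivative
      (\<lambda>a. fst (dder (local_rep (slit M) i W) z a))) (at z)"
    by (rule has_derivative_cong_open[OF slit.open_chart_image z, THEN iffD2, rotated])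
      (simp add: rhoF_component[OF W] slit.cinv_in_cdom)
  from dder_eqI[OF this] show ?thesis by simp
qed

lemma rhoF_bracket_component:
  assumes X: "X \<in> vector_fields (slit M)" and Y: "Y \<in> vector_fields (slit M)"
    and u: "u \<in> cdom (slit M) i"
  shows "rhoF M (bracket (slit M) X Y) u i =
    dder (local_rep (slit M) i (rhoF M Y)) (cmap (slit M) i u) (X u i)
    - dder (local_rep (slit M) i (rhoF M X)) (cmap (slit M) i u) (Y u i)"
proof -
  have "cmap (slit M) i u \<in> chart_image (slit M) i" using u by blast
  then show ?thesis
    using u by (simp add: rhoF_component[OF slit.bracket_in_vector_fields[OF X Y]]
        slit.bracket_component dder_rhoF X Y)
qed

lemma dder_fundamental_section:
  assumes z: "z \<in> chart_image (slit M) i"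
  shows "dder (local_rep (slit M) i (fundamental_section M)) z a = snd a"
proof -
  have "(local_rep (slit M) i (fundamental_section M) has_derivative snd) (at z)"
    by (rule has_derivative_cong_open[OF slit.open_chart_image z, THEN iffD2, rotated,
          OF has_derivative_snd[OF has_derivative_ident]])
      (simp add: fundamental_section_component slit.cinv_in_cdom)
  from dder_eqI[OF this] show ?thesis by simp
qed

end

context regular_conn
begin

lemma betaF_component:
  assumes X: "X \<in> psections M" and u: "u \<in> cdom (slit M) i"
  shows "betaF M D X u i = (X u i, hcoef M D i X (cmap (slit M) i u))"
  using rhoF_component[OF betaF_in_vector_fields[OF X] u] u
  by (simp add: rhoF_betaF[OF X] hcoef_def prod_eq_iff)

lemma dder_betaF:
  assumes X: "X \<in> psections M" and z: "z \<in> chart_image (slit M) i"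
  shows "dder (local_rep (slit M) i (betaF M D X)) z a
    = (dder (local_rep (slit M) i X) z a, dder (hcoef M D i X) z a)"
proof -
  note d = smooth_on_has_derivative[OF slit.vector_fieldsD(3)[OF betaF_in_vector_fields[OF X]] z]
  have "dder (hcoef M D i X) z a = snd (dder (local_rep (slit M) i (betaF M D X)) z a)"
    unfolding hcoef_def[abs_def] using dder_eqI[OF has_derivative_snd[OF d]] by simp
  then show ?thesis
    using dder_rhoF[OF betaF_in_vector_fields[OF X] z, of a] by (simp add: rhoF_betaF[OF X] prod_eq_iff)
qed

text \<open>The term \<open>D\<^bsub>\<beta>Y\<^esub> \<rho>\<gamma>X\<close> of the torsion vanishes since \<open>\<gamma>X\<close> is vertical.\<close>

lemma hv_torsion_eq:
  assumes X: "X \<in> psections M" and Y: "Y \<in> psections M"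
  shows "hv_torsion M D X Y = cov M D (gamF M X) Y - rhoF M (bracket (slit M) (gamF M X) (betaF M D Y))"
  by (simp add: hv_torsion_def torsion_def rhoF_betaF[OF Y] rhoF_gamF[OF X]
      cov_zero_section betaF_in_vector_fields[OF Y])

text \<open>A vertical derivative of the components of a section is independent of the chart, being the
  projection of a bracket. This turns chart derivatives of sections into sections.\<close>

lemma rhoF_bracket_gamF_betaF:
  assumes X: "X \<in> psections M" and Y: "Y \<in> psections M" and u: "u \<in> cdom (slit M) i"
  shows "rhoF M (bracket (slit M) (gamF M X) (betaF M D Y)) u i
    = dder (local_rep (slit M) i Y) (cmap (slit M) i u) (0, X u i)"
  using u by (simp add: rhoF_bracket_component gamF_in_vector_fields[OF X] betaF_in_vector_fields[OF Y]
      rhoF_betaF[OF Y] rhoF_gamF[OF X] gamF_component)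

end

text \<open>The Christoffel symbols of the connection, contracted with \<open>X\<close> and \<open>Y\<close>.\<close>

definition chart_deviation :: "('i, 'm, 'e::euclidean_space) atlas \<Rightarrow> ('i, 'm, 'e) connection \<Rightarrow> 'i
    \<Rightarrow> ('i, 'm, 'e) tfield \<Rightarrow> ('i, 'm, 'e) psection \<Rightarrow> ('i, 'm, 'e) tpoint \<Rightarrow> 'e"
  where "chart_deviation M D i X Y u
    = cov M D X Y u i - dder (local_rep (slit M) i Y) (cmap (slit M) i u) (X u i)"

context regular_conn
begin

lemma chart_deviation_fundamental:
  assumes "u \<in> cdom (slit M) i"
  shows "chart_deviation M D i X (fundamental_section M) u = KF M D X u i - snd (X u i)"
proof -
  have "cmap (slit M) i u \<in> chart_image (slit M) i" using assms by blast
  then show ?thesis by (simp add: chart_deviation_def dder_fundamental_section KF_eq_cov)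
qed

lemma chart_deviation_betaF_fundamental:
  assumes "X \<in> psections M" "u \<in> cdom (slit M) i"
  shows "chart_deviation M D i (betaF M D X) (fundamental_section M) u
    = - hcoef M D i X (cmap (slit M) i u)"
  by (simp add: chart_deviation_fundamental[OF assms(2)] KF_betaF[OF assms(1)] betaF_component[OF assms])

text \<open>The bracket of two horizontal lifts projects to the difference of the derivatives of the
  components, so vanishing horizontal torsion makes the deviation symmetric, like the Christoffel
  symbols of a torsion-free connection.\<close>

lemma chart_deviation_symmetric:
  assumes X: "X \<in> psections M" and Y: "Y \<in> psections M" and u: "u \<in> cdom (slit M) i"
    and Q: "h_torsion M D X Y = 0"
  shows "chart_deviation M D i (betaF M D X) Y u = chart_deviation M D i (betaF M D Y) X u"
proof -
  have "torsion M D (betaF M D X) (betaF M D Y) u i = 0"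
    using Q by (simp add: h_torsion_def)
  then show ?thesis
    by (simp add: chart_deviation_def torsion_def rhoF_betaF X Y betaF_in_vector_fields
        rhoF_bracket_component[OF _ _ u] algebra_simps)
qed

lemma hv_torsion_component:
  assumes X: "X \<in> psections M" and Y: "Y \<in> psections M" and u: "u \<in> cdom (slit M) i"
  shows "hv_torsion M D X Y u i = chart_deviation M D i (gamF M X) Y u"
  by (simp add: hv_torsion_eq[OF X Y] chart_deviation_def rhoF_bracket_gamF_betaF[OF X Y u] gamF_component[OF u])

lemma hv_torsion_in_psections:
  assumes X: "X \<in> psections M" and Y: "Y \<in> psections M"
  shows "hv_torsion M D X Y \<in> psections M"
  unfolding hv_torsion_eq[OF X Y]
  by (intro psections_diff cov_in_psections rhoF_in_psections slit.bracket_in_vector_fields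
      gamF_in_vector_fields betaF_in_vector_fields X Y)

end

section \<open>Connections whose connection map inverts the vertical lift\<close>

text \<open>For these connections \<open>K\<close> is the projection to the vertical component along the horizontal
  distribution, so that the distribution determines \<open>K\<close>. The condition is imposed on fields: it says
  that the vertical covariant derivative of \<open>\<eta>\<close> is the expected one, \<open>D\<^bsub>\<gamma>X\<^esub> \<eta> = X\<close>.\<close>

locale normal_conn = regular_conn +
  assumes KF_gamF: "X \<in> psections M \<Longrightarrow> KF M D (gamF M X) = X"
begin

text \<open>The difference of \<open>W\<close> and \<open>\<beta>\<rho>W\<close> is vertical, hence the vertical lift of a smooth section, which
  must be \<open>KW\<close>.\<close>

lemma
  assumes W: "W \<in> vector_fields (slit M)"
  shows KF_component: "u \<in> cdom (slit M) i \<Longrightarrow>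
      KF M D W u i = snd (W u i) - hcoef M D i (rhoF M W) (cmap (slit M) i u)"
    and vector_field_decomposition: "u \<in> mcarrier (slit M) \<Longrightarrow>
      W u = betaF M D (rhoF M W) u + gamF M (KF M D W) u"
proof -
  define V where "V u = (\<lambda>j. snd (W u j - betaF M D (rhoF M W) u j))" for u
  have \<rho>W: "rhoF M W \<in> psections M" by (rule rhoF_in_psections[OF W])
  have \<beta>: "betaF M D (rhoF M W) \<in> vector_fields (slit M)" by (rule betaF_in_vector_fields[OF \<rho>W])
  have tangent: "W u - betaF M D (rhoF M W) u \<in> tangent_space (slit M) u"
    and vertical: "rho M u (W u - betaF M D (rhoF M W) u) = 0" if u: "u \<in> mcarrier (slit M)" for u
  proof -
    note t = slit.vector_fieldsD(1)[OF W u] slit.vector_fieldsD(1)[OF \<beta> u]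
    show "W u - betaF M D (rhoF M W) u \<in> tangent_space (slit M) u"
      by (rule slit.tangent_space_diff[OF t])
    have "rho M u (betaF M D (rhoF M W) u) = rho M u (W u)"
      using fun_cong[OF rhoF_betaF[OF \<rho>W], of u] u by (simp add: fieldwise_in)
    then show "rho M u (W u - betaF M D (rhoF M W) u) = 0"
      by (simp add: rho_diff[OF u t])
  qed
  have V: "V \<in> psections M"
    unfolding psections_iff
  proof (intro conjI ballI allI impI)
    show "V u \<in> tangent_space M (fst u)" if "u \<in> mcarrier (slit M)" for u
      using vertical_eq_gam(1)[OF that tangent[OF that] vertical[OF that]] by (simp add: V_def)
    show "V u = 0" if "u \<notin> mcarrier (slit M)" for u
      using slit.vector_fieldsD(2)[OF W that] slit.vector_fieldsD(2)[OF \<beta> that]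
      by (simp add: V_def fun_eq_iff)
    fix i
    have "smooth_on (chart_image (slit M) i)
        (\<lambda>z. snd (local_rep (slit M) i W z - local_rep (slit M) i (betaF M D (rhoF M W)) z))"
      by (intro smooth_on_snd smooth_on_diff slit.open_chart_image slit.vector_fieldsD(3) W \<beta>)
    then show "smooth_on (chart_image (slit M) i) (local_rep (slit M) i V)"
      by (simp add: V_def)
  qed
  have dec: "W u - betaF M D (rhoF M W) u = gamF M V u" if u: "u \<in> mcarrier (slit M)" for u
    using vertical_eq_gam(2)[OF u tangent[OF u] vertical[OF u]] u by (simp add: V_def fieldwise_in)
  have KV: "KF M D W u = V u" if u: "u \<in> mcarrier (slit M)" for u
  proof -
    have "KF M D W u - KF M D (betaF M D (rhoF M W)) u = KF M D (gamF M V) u"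
      unfolding KF_eq_cov cov_in[OF u] dec[OF u, symmetric]
      by (rule conn_diff[symmetric, OF fundamental_section_in_psections u
            slit.vector_fieldsD(1)[OF W u] slit.vector_fieldsD(1)[OF \<beta> u]])
    then show ?thesis by (simp add: KF_betaF[OF \<rho>W] KF_gamF[OF V])
  qed
  show "KF M D W u i = snd (W u i) - hcoef M D i (rhoF M W) (cmap (slit M) i u)"
    if u: "u \<in> cdom (slit M) i"
    unfolding KV[OF slit_domD[OF u]] using u by (simp add: V_def betaF_component[OF \<rho>W])
  show "W u = betaF M D (rhoF M W) u + gamF M (KF M D W) u" if u: "u \<in> mcarrier (slit M)"
    using dec[OF u] KV[OF u] u by (simp add: fieldwise_in algebra_simps)
qed

text \<open>In the curvature, evaluated on \<open>\<beta>X\<close>, \<open>\<gamma>Y\<close> and \<open>\<eta>\<close>, all covariant derivatives of \<open>\<eta>\<close> are values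
  of \<open>K\<close>: they are \<open>K\<gamma>Y = Y\<close>, \<open>K\<beta>X = 0\<close> and the value on the bracket.\<close>

lemma vhv_torsion_eq:
  assumes X: "X \<in> psections M" and Y: "Y \<in> psections M"
  shows "vhv_torsion M D X Y
    = KF M D (bracket (slit M) (betaF M D X) (gamF M Y)) - cov M D (betaF M D X) Y"
  using KF_gamF[OF Y] KF_betaF[OF X]
  by (simp add: vhv_torsion_def curvature_def cov_zero_section gamF_in_vector_fields[OF Y] flip: KF_eq_cov)

end

section \<open>The horizontal structure determined by the energy\<close>

context finsler
begin

lemma dder_e_split:
  "z \<in> chart_image (slit M) i \<Longrightarrow> dder (energy_rep i) z (v, w) = dder (energy_rep i) z (v, 0) + dder (energy_rep i) z (0, w)"
  using linear_add[OF e.dder_linear, of z i "(v, 0)" "(0, w)"] by simp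

lemma hess_e_split:
  "z \<in> chart_image (slit M) i \<Longrightarrow> hess (energy_rep i) z a (v, w) = hess (energy_rep i) z a (v, 0) + hess (energy_rep i) z a (0, w)"
  using linear_add[OF e.hess_linear_right, of z i "(v, 0)" "(0, w)" a] by simp

lemma hess_e_vertical_diff:
  "z \<in> chart_image (slit M) i \<Longrightarrow> hess (energy_rep i) z a (0, v - w) = hess (energy_rep i) z a (0, v) - hess (energy_rep i) z a (0, w)"
  using linear_diff[OF e.hess_linear_right, of z i "(0, v)" "(0, w)" a] by simp

lemma hess_e_vertical_minus:
  "z \<in> chart_image (slit M) i \<Longrightarrow> hess (energy_rep i) z a (0, - w) = - hess (energy_rep i) z a (0, w)"
  using linear_neg[OF e.hess_linear_right, of z i "(0, w)" a] by simp

lemma dder_e_vertical_minus: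
  "z \<in> chart_image (slit M) i \<Longrightarrow> dder (energy_rep i) z (0, - w) = - dder (energy_rep i) z (0, w)"
  using linear_neg[OF e.dder_linear, of z i "(0, w)"] by simp

end

text \<open>Three conditions on a horizontal distribution, stated in charts, with \<open>e\<close> the energy, \<open>H\<close> its
  Hessian and \<open>\<beta>X = (X, b\<^sub>X)\<close>. The first says that the energy is constant along horizontal curves. The
  second, \<open>H((0, Z), \<beta>Y) = H((0, Y), \<beta>Z)\<close>, says that the horizontal spaces are Lagrangian for
  \<open>\<Omega> = dd\<^sub>JE\<close>. The third says that the metric \<open>g\<close> is parallel along the spray \<open>\<beta>\<eta>\<close>, if a section
  is differentiated along it by adding \<open>- b\<close> to the derivative of its components. The nonlinear
  connection that they characterise is the one of Barthel.\<close>

locale barthel = finsler M L + normal_conn M D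
  for M :: "('i, 'm, 'e::euclidean_space) atlas" and L and D +
  assumes conservative: "\<And>i u Y. u \<in> cdom (slit M) i \<Longrightarrow> Y \<in> psections M \<Longrightarrow>
      dder (energy_rep i) (cmap (slit M) i u) (betaF M D Y u i) = 0"
    and lagrangian: "\<And>i u Y Z. u \<in> cdom (slit M) i \<Longrightarrow> Y \<in> psections M \<Longrightarrow> Z \<in> psections M \<Longrightarrow>
      hess (energy_rep i) (cmap (slit M) i u) (0, Z u i) (betaF M D Y u i)
      = hess (energy_rep i) (cmap (slit M) i u) (0, Y u i) (betaF M D Z u i)"
    and parallel: "\<And>i u Y Z. u \<in> cdom (slit M) i \<Longrightarrow> Y \<in> psections M \<Longrightarrow> Z \<in> psections M \<Longrightarrow>
      third (energy_rep i) (cmap (slit M) i u) (betaF M D (fundamental_section M) u i) (0, Y u i) (0, Z u i)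
      = - hess (energy_rep i) (cmap (slit M) i u) (0, hcoef M D i Y (cmap (slit M) i u)) (0, Z u i)
        - hess (energy_rep i) (cmap (slit M) i u) (0, Y u i) (0, hcoef M D i Z (cmap (slit M) i u))"

text \<open>This is the Lagrangian condition for the pair \<open>\<eta>\<close>, \<open>Z\<close>: on its other side, Euler's relation and
  the conservation of energy along \<open>\<beta>Z\<close> leave a single first derivative of the energy. For all \<open>Z\<close>
  together these are the Euler-Lagrange equations, which determine the vertical component of \<open>\<beta>\<eta>\<close> as
  the vertical Hessian is nondegenerate.\<close>

lemma (in finsler) spray_equation:
  assumes D: "regular_conn M D"
    and conservative: "dder (energy_rep i) (cmap (slit M) i u) (betaF M D Z u i) = 0"
    and lagrangian: "hess (energy_rep i) (cmap (slit M) i u) (0, Z u i) (betaF M D (fundamental_section M) u i)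
      = hess (energy_rep i) (cmap (slit M) i u) (0, fundamental_section M u i) (betaF M D Z u i)"
    and u: "u \<in> cdom (slit M) i" and Z: "Z \<in> psections M"
  shows "hess (energy_rep i) (cmap (slit M) i u) (0, Z u i) (betaF M D (fundamental_section M) u i)
    = dder (energy_rep i) (cmap (slit M) i u) (Z u i, 0)"
proof -
  interpret regular_conn M D by (rule D)
  let ?z = "cmap (slit M) i u" and ?b = "hcoef M D i Z (cmap (slit M) i u)"
  have z: "?z \<in> chart_image (slit M) i" using u by blast
  have \<beta>: "betaF M D Z u i = (Z u i, ?b)" by (rule betaF_component[OF Z u])
  have "hess (energy_rep i) ?z (0, fundamental_section M u i) (betaF M D Z u i)
      = 2 * dder (energy_rep i) ?z (betaF M D Z u i) - dder (energy_rep i) ?z (0, ?b)"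
    using e_euler_hess[OF z, of "betaF M D Z u i"] e.hess_sym[OF z, where a="(0, snd ?z)"]
    by (simp add: fundamental_section_component[OF u] \<beta>)
  then show ?thesis
    using lagrangian conservative dder_e_split[OF z, of "Z u i" ?b] by (simp add: \<beta>)
qed

text \<open>The vertical part of \<open>\<beta>X - \<beta>'X\<close> is a section \<open>V X\<close>. For \<open>X = \<eta>\<close> the spray equations give
  \<open>g(V \<eta>, Z) = 0\<close> for all \<open>Z\<close>. Once the sprays agree, the remaining two conditions say that \<open>V\<close> is
  self-adjoint and anti-self-adjoint with respect to \<open>g\<close>, so \<open>g(V X, Z) = 0\<close>. In both cases \<open>Z\<close> is
  taken to be the section \<open>V \<eta>\<close> or \<open>V X\<close> itself.\<close>

lemma barthel_unique:
  assumes "barthel M L C" "barthel M L D" and X: "X \<in> psections M"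
  shows "betaF M C X = betaF M D X"
proof -
  interpret C: barthel M L C by fact
  interpret D: barthel M L D by fact
  let ?\<eta> = "fundamental_section M"
  have \<eta>: "?\<eta> \<in> psections M" by (rule C.fundamental_section_in_psections)
  \<comment> \<open>Applying \<open>K\<close> to the other lift exhibits the difference as a smooth section.\<close>
  define V where "V X = KF M D (betaF M C X)" for X
  have V: "V X \<in> psections M" if "X \<in> psections M" for X
    unfolding V_def by (intro D.KF_in_psections C.betaF_in_vector_fields that)
  have V_comp: "V X u i = hcoef M C i X (cmap (slit M) i u) - hcoef M D i X (cmap (slit M) i u)"
    if "X \<in> psections M" "u \<in> cdom (slit M) i" for X u i
    using that by (simp add: V_def D.KF_component C.betaF_in_vector_fields C.rhoF_betaF C.betaF_component)
  have beta_eq: "betaF M C X = betaF M D X" if X: "X \<in> psections M" and V0: "V X = 0" for X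
  proof
    fix u show "betaF M C X u = betaF M D X u"
    proof (cases "u \<in> mcarrier (slit M)")
      case True
      then obtain i where i: "u \<in> cdom (slit M) i" by (auto simp: mcarrier_def)
      have "betaF M C X u i = betaF M D X u i"
        using V_comp[OF X i] V0 by (simp add: C.betaF_component[OF X i] D.betaF_component[OF X i])
      then show ?thesis
        using C.slit.vector_fieldsD(1)[OF C.betaF_in_vector_fields[OF X] True]
          C.slit.vector_fieldsD(1)[OF D.betaF_in_vector_fields[OF X] True]
        by (intro tangent_space_eqI[OF _ _ i]) auto
    qed (simp add: fieldwise_out)
  qed
  have "V ?\<eta> = 0"
  proof (rule C.section_eq_zeroI[OF V[OF \<eta>]])
    fix i u assume u: "u \<in> cdom (slit M) i"
    let ?z = "cmap (slit M) i u"
    have z: "?z \<in> chart_image (slit M) i" using u by blast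
    note Z = V[OF \<eta>]
    have "hess (C.energy_rep i) ?z (0, V ?\<eta> u i) (betaF M C ?\<eta> u i) = hess (C.energy_rep i) ?z (0, V ?\<eta> u i) (betaF M D ?\<eta> u i)"
      using C.spray_equation[OF C.regular_conn_axioms C.conservative[OF u Z] C.lagrangian[OF u \<eta> Z] u Z]
        C.spray_equation[OF D.regular_conn_axioms D.conservative[OF u Z] D.lagrangian[OF u \<eta> Z] u Z]
      by simp
    then show "hess (C.energy_rep i) ?z (0, V ?\<eta> u i) (0, V ?\<eta> u i) = 0"
      using V_comp[OF \<eta> u] C.hess_e_vertical_diff[OF z, where a="(0, V ?\<eta> u i)"]
        C.hess_e_split[OF z, where a="(0, V ?\<eta> u i)" and v="?\<eta> u i" and w="hcoef M C i ?\<eta> ?z"]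
        C.hess_e_split[OF z, where a="(0, V ?\<eta> u i)" and v="?\<eta> u i" and w="hcoef M D i ?\<eta> ?z"]
      by (simp add: C.betaF_component[OF \<eta> u] D.betaF_component[OF \<eta> u])
  qed
  then have \<eta>_eq: "betaF M C ?\<eta> = betaF M D ?\<eta>" by (rule beta_eq[OF \<eta>])
  have "V X = 0"
  proof (rule C.section_eq_zeroI[OF V[OF X]])
    fix i u assume u: "u \<in> cdom (slit M) i"
    let ?z = "cmap (slit M) i u"
    have z: "?z \<in> chart_image (slit M) i" using u by blast
    have g: "hess (C.energy_rep i) ?z (0, Z u i) (0, V Y u i)
        = hess (C.energy_rep i) ?z (0, Z u i) (betaF M C Y u i) - hess (C.energy_rep i) ?z (0, Z u i) (betaF M D Y u i)"
      if "Y \<in> psections M" for Y Z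
      using V_comp[OF that u] C.hess_e_vertical_diff[OF z, where a="(0, Z u i)"]
        C.hess_e_split[OF z, where a="(0, Z u i)" and v="Y u i" and w="hcoef M C i Y ?z"]
        C.hess_e_split[OF z, where a="(0, Z u i)" and v="Y u i" and w="hcoef M D i Y ?z"]
      by (simp add: C.betaF_component[OF that u] D.betaF_component[OF that u])
    let ?Z = "V X"
    note Z = V[OF X]
    have "hess (C.energy_rep i) ?z (0, ?Z u i) (0, V X u i) = hess (C.energy_rep i) ?z (0, X u i) (0, V ?Z u i)"
      using C.lagrangian[OF u X Z] D.lagrangian[OF u X Z] by (simp add: g[OF X] g[OF Z])
    moreover have "hess (C.energy_rep i) ?z (0, ?Z u i) (0, V X u i) + hess (C.energy_rep i) ?z (0, X u i) (0, V ?Z u i) = 0"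
      using C.parallel[OF u X Z] D.parallel[OF u X Z] V_comp[OF X u] V_comp[OF Z u]
        C.hess_e_vertical_diff[OF z, where a="(0, ?Z u i)"] C.hess_e_vertical_diff[OF z, where a="(0, X u i)"]
        C.e.hess_sym[OF z, where a="(0, hcoef M C i X ?z)"] C.e.hess_sym[OF z, where a="(0, hcoef M D i X ?z)"]
      by (simp add: \<eta>_eq)
    ultimately show "hess (C.energy_rep i) ?z (0, V X u i) (0, V X u i) = 0" by simp
  qed
  then show ?thesis by (rule beta_eq[OF X])
qed

section \<open>The Cartan connection\<close>

locale cartan = finsler M L + regular_conn M D
  for M :: "('i, 'm, 'e::euclidean_space) atlas" and L and D +
  assumes cartan: "cartan_connection M L D"
begin

text \<open>The condition \<open>\<nabla>g = 0\<close> in a chart. The derivatives of the components of \<open>Y\<close> and \<open>Z\<close> are absorbed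
  in the deviation, which leaves the derivative of the metric coefficients, a third derivative of the
  energy, on the left.\<close>

lemma metric:
  assumes X: "X \<in> vector_fields (slit M)" and Y: "Y \<in> psections M" and Z: "Z \<in> psections M"
    and u: "u \<in> cdom (slit M) i"
  shows "third (energy_rep i) (cmap (slit M) i u) (X u i) (0, Y u i) (0, Z u i)
    = hess (energy_rep i) (cmap (slit M) i u) (0, chart_deviation M D i X Y u) (0, Z u i)
      + hess (energy_rep i) (cmap (slit M) i u) (0, Y u i) (0, chart_deviation M D i X Z u)"
proof -
  let ?z = "cmap (slit M) i u" and ?U = "chart_image (slit M) i"
  let ?Y = "local_rep (slit M) i Y" and ?Z = "local_rep (slit M) i Z"
  let ?g = "\<lambda>u. finsler_metric L u (Y u) (Z u)"
  have z: "?z \<in> ?U" using u by blast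
  have uc: "u \<in> mcarrier (slit M)" by (rule slit_domD[OF u])
  have loc: "?Y ?z = Y u i" "?Z ?z = Z u i" using u by simp_all
  have d: "((\<lambda>x. (0::'e, local_rep (slit M) i W x)) has_derivative
      (\<lambda>c. (0, dder (local_rep (slit M) i W) ?z c))) (at ?z)" if "W \<in> psections M" for W
    by (intro has_derivative_Pair has_derivative_const smooth_on_has_derivative[OF psectionsD(3)[OF that] z])
  have "((\<lambda>x. hess (energy_rep i) x (0, ?Y x) (0, ?Z x)) has_derivative
      (\<lambda>c. third (energy_rep i) ?z c (0, ?Y ?z) (0, ?Z ?z) + hess (energy_rep i) ?z (0, ?Y ?z) (0, dder ?Z ?z c)
        + hess (energy_rep i) ?z (0, dder ?Y ?z c) (0, ?Z ?z))) (at ?z)"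
    by (rule e.has_derivative_hess_apply[OF z d[OF Y] d[OF Z]])
  then have g: "((?g \<circ> cinv (slit M) i) has_derivative
      (\<lambda>c. third (energy_rep i) ?z c (0, ?Y ?z) (0, ?Z ?z) + hess (energy_rep i) ?z (0, ?Y ?z) (0, dder ?Z ?z c)
        + hess (energy_rep i) ?z (0, dder ?Y ?z c) (0, ?Z ?z))) (at ?z)"
    by (rule has_derivative_cong_open[OF slit.open_chart_image z, THEN iffD2, rotated])
      (simp add: finsler_metric_chart[OF slit.cinv_in_cdom] psectionsD(1)[OF Y] psectionsD(1)[OF Z]
        slit.cinv_in_carrier)
  have "fun_differential (slit M) ?g u (X u) = dder (?g \<circ> cinv (slit M) i) ?z (X u i)"
    using g by (intro slit.fun_differential_chart[OF u slit.vector_fieldsD(1)[OF X uc]])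
      (auto simp: differentiable_def)
  then have "third (energy_rep i) ?z (X u i) (0, Y u i) (0, Z u i) + hess (energy_rep i) ?z (0, Y u i) (0, dder ?Z ?z (X u i))
        + hess (energy_rep i) ?z (0, dder ?Y ?z (X u i)) (0, Z u i)
      = fun_differential (slit M) ?g u (X u)"
    unfolding dder_eqI[OF g] loc by simp
  also have "\<dots> = finsler_metric L u (cov M D X Y u) (Z u) + finsler_metric L u (Y u) (cov M D X Z u)"
    using cartan X Y Z uc unfolding cartan_connection_def by (simp add: algebra_simps)
  also have "\<dots> = hess (energy_rep i) ?z (0, cov M D X Y u i) (0, Z u i) + hess (energy_rep i) ?z (0, Y u i) (0, cov M D X Z u i)"
    using psectionsD(1)[OF cov_in_psections[OF X Y] uc] psectionsD(1)[OF cov_in_psections[OF X Z] uc]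
      psectionsD(1)[OF Y uc] psectionsD(1)[OF Z uc]
    by (simp add: finsler_metric_chart[OF u])
  finally show ?thesis
    using hess_e_vertical_diff[OF z, where a="(0, Y u i)" and v="cov M D X Z u i"]
      hess_e_vertical_diff[OF z, where a="(0, Z u i)" and v="cov M D X Y u i"]
      e.hess_sym[OF z, where b="(0, Z u i)"]
    by (simp add: chart_deviation_def)
qed

text \<open>Along vertical fields the deviation is the mixed torsion.\<close>

lemma deviation_selfadjoint:
  assumes X: "X \<in> psections M" and Y: "Y \<in> psections M" and Z: "Z \<in> psections M"
    and u: "u \<in> cdom (slit M) i"
  shows "hess (energy_rep i) (cmap (slit M) i u) (0, chart_deviation M D i (gamF M X) Y u) (0, Z u i)
    = hess (energy_rep i) (cmap (slit M) i u) (0, chart_deviation M D i (gamF M X) Z u) (0, Y u i)"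
proof -
  have uc: "u \<in> mcarrier (slit M)" by (rule slit_domD[OF u])
  have "finsler_metric L u (hv_torsion M D X Y u) (Z u) = finsler_metric L u (hv_torsion M D X Z u) (Y u)"
    using cartan X Y Z uc unfolding cartan_connection_def by blast
  then show ?thesis
    using psectionsD(1)[OF hv_torsion_in_psections[OF X Y] uc] psectionsD(1)[OF Y uc]
      psectionsD(1)[OF hv_torsion_in_psections[OF X Z] uc] psectionsD(1)[OF Z uc]
    by (simp add: finsler_metric_chart[OF u] hv_torsion_component[OF X _ u] Y Z)
qed

text \<open>Metricity and self-adjointness give \<open>2 g(T(X, \<eta>), Z) = (\<partial>\<^sub>X g)(\<eta>, Z)\<close>, and the right-hand side
  vanishes because the metric is homogeneous of degree zero. The section \<open>Z = T(X, \<eta>)\<close> concludes.\<close>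

lemma hv_torsion_fundamental:
  assumes X: "X \<in> psections M"
  shows "hv_torsion M D X (fundamental_section M) = 0"
proof (rule section_eq_zeroI)
  let ?\<eta> = "fundamental_section M"
  have \<eta>: "?\<eta> \<in> psections M" by (rule fundamental_section_in_psections)
  let ?Z = "hv_torsion M D X ?\<eta>"
  show Z: "?Z \<in> psections M" by (rule hv_torsion_in_psections[OF X \<eta>])
  fix i u assume u: "u \<in> cdom (slit M) i"
  let ?z = "cmap (slit M) i u"
  have z: "?z \<in> chart_image (slit M) i" using u by blast
  have "third (energy_rep i) ?z (0, X u i) (0, ?\<eta> u i) (0, ?Z u i) = 0"
    using e_euler_third[OF z, where c="(0, X u i)" and w="?Z u i"] e.hess_sym[OF z, where b="(0, ?Z u i)"]
      e.third_sym_right[OF z, where b="(0, ?Z u i)"]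
    by (simp add: fundamental_section_component[OF u])
  then show "hess (energy_rep i) ?z (0, ?Z u i) (0, ?Z u i) = 0"
    using metric[OF gamF_in_vector_fields[OF X] \<eta> Z u] deviation_selfadjoint[OF X \<eta> Z u]
      e.hess_sym[OF z, where b="(0, ?\<eta> u i)"]
    by (simp add: gamF_component[OF u] flip: hv_torsion_component[OF X \<eta> u])
qed

text \<open>The torsion \<open>T(X, \<eta>)\<close> is \<open>K\<gamma>X - X\<close>.\<close>

sublocale normal_conn M D
proof
  fix X assume X: "X \<in> psections M"
  show "KF M D (gamF M X) = X"
  proof (rule psection_eqI[OF KF_in_psections[OF gamF_in_vector_fields[OF X]] X])
    fix i u assume u: "u \<in> cdom (slit M) i"
    show "KF M D (gamF M X) u i = X u i"
      using hv_torsion_component[OF X fundamental_section_in_psections u] hv_torsion_fundamental[OF X]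
      by (simp add: chart_deviation_fundamental[OF u] gamF_component[OF u])
  qed
qed

text \<open>All three conditions are instances of metricity. With \<open>g(\<eta>, \<eta>) = 2E\<close>, the pair \<open>\<eta>\<close>, \<open>\<eta>\<close> and the
  field \<open>\<beta>Y\<close> give the first one. The pair \<open>Z\<close>, \<open>\<eta>\<close> and the field \<open>\<beta>Y\<close> express \<open>H((0, Z), \<beta>Y)\<close> by the
  deviation of \<open>Z\<close> along \<open>\<beta>Y\<close>, which is symmetric since \<open>Q = 0\<close>. The field \<open>\<beta>\<eta>\<close> gives the last one,
  since by the same symmetry the deviation of \<open>Y\<close> along \<open>\<beta>\<eta>\<close> is that of \<open>\<eta>\<close> along \<open>\<beta>Y\<close>, that is
  \<open>K\<beta>Y - b = - b\<close>.\<close>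

sublocale barthel M L D
proof
  let ?\<eta> = "fundamental_section M"
  have \<eta>: "?\<eta> \<in> psections M" by (rule fundamental_section_in_psections)
  fix i u assume u: "u \<in> cdom (slit M) i"
  let ?z = "cmap (slit M) i u" and ?y = "snd (cmap (slit M) i u)"
  have z: "?z \<in> chart_image (slit M) i" using u by blast
  note \<eta>_comp = fundamental_section_component[OF u]
  have Q: "h_torsion M D X Y = 0" if "X \<in> psections M" "Y \<in> psections M" for X Y
    using cartan that unfolding cartan_connection_def by blast
  fix Y assume Y: "Y \<in> psections M"
  let ?b = "hcoef M D i Y ?z"
  have \<beta>: "betaF M D Y u i = (Y u i, ?b)" by (rule betaF_component[OF Y u])
  have euler: "hess (energy_rep i) ?z (0, ?y) (0, w) = dder (energy_rep i) ?z (0, w)"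
      "hess (energy_rep i) ?z (0, w) (0, ?y) = dder (energy_rep i) ?z (0, w)" for w
    using e_euler_hess_vertical[OF z, of w] e.hess_sym[OF z, where b="(0, w)"] by simp_all
  show "dder (energy_rep i) ?z (betaF M D Y u i) = 0"
    using metric[OF betaF_in_vector_fields[OF Y] \<eta> \<eta> u] e_euler_third[OF z, where c="betaF M D Y u i" and w="?y"]
      e_euler_hess[OF z, where a="betaF M D Y u i"]
    by (simp add: chart_deviation_betaF_fundamental[OF Y u] \<eta>_comp \<beta> euler
        dder_e_vertical_minus[OF z])
  fix Z assume Z: "Z \<in> psections M"
  have mixed: "hess (energy_rep i) ?z (betaF M D Y u i) (0, Z u i)
      = dder (energy_rep i) ?z (0, chart_deviation M D i (betaF M D Y) Z u)"
    if Y: "Y \<in> psections M" and Z: "Z \<in> psections M" for Y Z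
    using metric[OF betaF_in_vector_fields[OF Y] Z \<eta> u] e_euler_third[OF z, where c="betaF M D Y u i" and w="Z u i"]
    by (simp add: chart_deviation_betaF_fundamental[OF Y u] \<eta>_comp betaF_component[OF Y u] euler
        hess_e_vertical_minus[OF z])
  show "hess (energy_rep i) ?z (0, Z u i) (betaF M D Y u i) = hess (energy_rep i) ?z (0, Y u i) (betaF M D Z u i)"
    using mixed[OF Y Z] mixed[OF Z Y] chart_deviation_symmetric[OF Y Z u Q[OF Y Z]]
      e.hess_sym[OF z, where a="(0, Z u i)"] e.hess_sym[OF z, where a="(0, Y u i)"]
    by simp
  have dev: "chart_deviation M D i (betaF M D ?\<eta>) W u = - hcoef M D i W ?z" if W: "W \<in> psections M" for W
    using chart_deviation_symmetric[OF \<eta> W u Q[OF \<eta> W]] chart_deviation_betaF_fundamental[OF W u] by simp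
  show "third (energy_rep i) ?z (betaF M D ?\<eta> u i) (0, Y u i) (0, Z u i)
      = - hess (energy_rep i) ?z (0, ?b) (0, Z u i) - hess (energy_rep i) ?z (0, Y u i) (0, hcoef M D i Z ?z)"
    using metric[OF betaF_in_vector_fields[OF \<eta>] Y Z u] hess_e_vertical_minus[OF z, where a="(0, Y u i)"]
      hess_e_vertical_minus[OF z, where a="(0, Z u i)"] e.hess_sym[OF z, where b="(0, Z u i)"]
    by (simp add: dev[OF Y] dev[OF Z])
qed

end

section \<open>The Berwald connection\<close>

locale berwald = finsler M L + regular_conn M D
  for M :: "('i, 'm, 'e::euclidean_space) atlas" and L and D +
  assumes berwald: "berwald_connection M L D"
begin

lemma torsion_free: "X \<in> vector_fields (slit M) \<Longrightarrow> Y \<in> vector_fields (slit M) \<Longrightarrow> torsion M D X Y = 0"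
  using berwald unfolding berwald_connection_def by blast

lemma cov_gamF:
  assumes X: "X \<in> psections M" and Y: "Y \<in> psections M"
  shows "cov M D (gamF M X) Y = rhoF M (bracket (slit M) (gamF M X) (betaF M D Y))"
  using torsion_free[OF gamF_in_vector_fields[OF X] betaF_in_vector_fields[OF Y]]
    hv_torsion_eq[OF X Y] by (simp add: hv_torsion_def)

lemma cov_gamF_component:
  assumes X: "X \<in> psections M" and Y: "Y \<in> psections M" and u: "u \<in> cdom (slit M) i"
  shows "cov M D (gamF M X) Y u i = dder (local_rep (slit M) i Y) (cmap (slit M) i u) (0, X u i)"
  by (simp add: cov_gamF[OF X Y] rhoF_bracket_gamF_betaF[OF X Y u])

text \<open>Vanishing torsion makes the vertical covariant derivative the derivative of the components in a
  chart, and the components of \<open>\<eta>\<close> are the fibre coordinates.\<close>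

sublocale normal_conn M D
proof
  fix X assume X: "X \<in> psections M"
  note \<eta> = fundamental_section_in_psections
  show "KF M D (gamF M X) = X"
  proof (rule psection_eqI[OF KF_in_psections[OF gamF_in_vector_fields[OF X]] X])
    fix i u assume u: "u \<in> cdom (slit M) i"
    have "cmap (slit M) i u \<in> chart_image (slit M) i" using u by blast
    then show "KF M D (gamF M X) u i = X u i"
      by (simp add: KF_eq_cov cov_gamF_component[OF X \<eta> u] dder_fundamental_section)
  qed
qed

lemma cov_betaF:
  assumes X: "X \<in> psections M" and Y: "Y \<in> psections M"
  shows "cov M D (betaF M D X) Y = KF M D (bracket (slit M) (betaF M D X) (gamF M Y))"
  using berwald X Y vhv_torsion_eq[OF X Y] unfolding berwald_connection_def by simp

lemma conservative_component:
  assumes Y: "Y \<in> psections M" and u: "u \<in> cdom (slit M) i"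
  shows "dder (energy_rep i) (cmap (slit M) i u) (betaF M D Y u i) = 0"
proof -
  have uc: "u \<in> mcarrier (slit M)" by (rule slit_domD[OF u])
  have z: "cmap (slit M) i u \<in> chart_image (slit M) i" using u by blast
  note \<beta> = betaF_in_vector_fields[OF Y]
  have "horizontal_projector M D u (betaF M D Y u) = betaF M D Y u"
    using fun_cong[OF rhoF_betaF[OF Y], of u] uc by (simp add: horizontal_projector_def fieldwise_in)
  then have "fun_differential (slit M) L u (betaF M D Y u) = 0"
    using berwald \<beta> uc unfolding berwald_connection_def by metis
  then show ?thesis
    using slit.fun_differential_chart[OF u slit.vector_fieldsD(1)[OF \<beta> uc] smooth_on_differentiable[OF L_smooth z]]
    by (simp add: dder_e_eq_L[OF z])
qed

text \<open>By \<open>cov_betaF\<close>, the horizontal covariant derivative depends on the horizontal distribution alone.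
  Computing the bracket in a chart identifies the Christoffel symbols with the vertical derivatives
  of the coefficients of the distribution, the classical description of the Berwald connection. The
  term with \<open>D\<^bsub>\<gamma>Y\<^esub> X\<close> accounts for the variation of the components of \<open>X\<close>.\<close>

lemma dder_hcoef:
  assumes X: "X \<in> psections M" and Y: "Y \<in> psections M" and u: "u \<in> cdom (slit M) i"
  shows "dder (hcoef M D i X) (cmap (slit M) i u) (0, Y u i)
    = hcoef M D i (cov M D (gamF M Y) X) (cmap (slit M) i u) - chart_deviation M D i (betaF M D X) Y u"
proof -
  let ?z = "cmap (slit M) i u"
  let ?W = "bracket (slit M) (gamF M Y) (betaF M D X)"
  have z: "?z \<in> chart_image (slit M) i" using u by blast
  have uc: "u \<in> mcarrier (slit M)" by (rule slit_domD[OF u])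
  note vf = gamF_in_vector_fields[OF Y] betaF_in_vector_fields[OF X]
  have W: "?W \<in> vector_fields (slit M)" by (rule slit.bracket_in_vector_fields[OF vf])
  have "cov M D (betaF M D X) Y u = - KF M D ?W u"
    unfolding cov_betaF[OF X Y] KF_eq_cov cov_in[OF uc] slit.bracket_antisym[of "betaF M D X" "gamF M Y"]
    by (rule conn_minus[OF fundamental_section_in_psections uc slit.vector_fieldsD(1)[OF W uc]])
  then have "cov M D (betaF M D X) Y u i = - (snd (?W u i) - hcoef M D i (rhoF M ?W) ?z)"
    using KF_component[OF W u] by simp
  then show ?thesis
    using u by (simp add: chart_deviation_def cov_gamF[OF Y X] slit.bracket_component
        dder_gamF[OF Y z] dder_betaF[OF X z] gamF_component)
qed

text \<open>The energy is constant along \<open>\<beta>X\<close> at every point; this is the vertical derivative of that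
  identity along \<open>Y\<close>. The derivative of the vector \<open>\<beta>X\<close> is the horizontal vector \<open>\<beta>(D\<^bsub>\<gamma>Y\<^esub> X)\<close>, which is
  again annihilated by the differential of the energy, minus the deviation.\<close>

lemma hess_deviation:
  assumes X: "X \<in> psections M" and Y: "Y \<in> psections M" and u: "u \<in> cdom (slit M) i"
  shows "hess (energy_rep i) (cmap (slit M) i u) (0, Y u i) (betaF M D X u i)
    = dder (energy_rep i) (cmap (slit M) i u) (0, chart_deviation M D i (betaF M D X) Y u)"
proof -
  let ?z = "cmap (slit M) i u" and ?V = "cov M D (gamF M Y) X"
  let ?A = "chart_deviation M D i (betaF M D X) Y u" and ?\<beta> = "local_rep (slit M) i (betaF M D X)"
  have z: "?z \<in> chart_image (slit M) i" using u by blast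
  have V: "?V \<in> psections M" by (rule cov_in_psections[OF gamF_in_vector_fields[OF Y] X])
  note \<beta> = betaF_in_vector_fields[OF X]
  have "((\<lambda>x. dder (energy_rep i) x (?\<beta> x)) has_derivative
      (\<lambda>c. hess (energy_rep i) ?z c (?\<beta> ?z) + dder (energy_rep i) ?z (dder ?\<beta> ?z c))) (at ?z)"
    by (rule e.has_derivative_dder_apply[OF z smooth_on_has_derivative[OF slit.vector_fieldsD(3)[OF \<beta>] z]])
  moreover have "((\<lambda>x. dder (energy_rep i) x (?\<beta> x)) has_derivative (\<lambda>c. 0)) (at ?z)"
    by (rule has_derivative_cong_open[OF slit.open_chart_image z, THEN iffD2, rotated, OF has_derivative_const])
      (use conservative_component[OF X slit.cinv_in_cdom] in simp)
  ultimately have "hess (energy_rep i) ?z (0, Y u i) (?\<beta> ?z) + dder (energy_rep i) ?z (dder ?\<beta> ?z (0, Y u i)) = 0"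
    by (rule fun_cong[OF has_derivative_unique])
  moreover have "dder ?\<beta> ?z (0, Y u i) = betaF M D ?V u i - (0, ?A)"
    unfolding dder_betaF[OF X z] dder_hcoef[OF X Y u] betaF_component[OF V u]
    by (simp add: cov_gamF_component[OF Y X u])
  ultimately show ?thesis
    using u conservative_component[OF V u] by (simp add: linear_diff[OF e.dder_linear[OF z]])
qed

text \<open>The Lagrangian condition holds since the deviation is symmetric. It implies the spray equation,
  whose vertical derivative along \<open>Y\<close> yields the last condition: the spray coefficients \<open>b\<^sub>\<eta>\<close> have
  the derivative \<open>2 b\<^sub>Y\<close>, and the mixed second derivatives of the energy that appear are replaced by
  metric terms with the help of the Lagrangian condition.\<close>

sublocale barthel M L D
proof
  let ?\<eta> = "fundamental_section M"
  have \<eta>: "?\<eta> \<in> psections M" by (rule fundamental_section_in_psections)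
  have Q: "h_torsion M D X Y = 0" if "X \<in> psections M" "Y \<in> psections M" for X Y
    unfolding h_torsion_def by (intro torsion_free betaF_in_vector_fields that)
  fix i u assume u: "u \<in> cdom (slit M) i"
  let ?z = "cmap (slit M) i u"
  have z: "?z \<in> chart_image (slit M) i" using u by blast
  fix Y assume Y: "Y \<in> psections M"
  show "dder (energy_rep i) ?z (betaF M D Y u i) = 0" by (rule conservative_component[OF Y u])
  have lagr: "hess (energy_rep i) (cmap (slit M) i u) (0, Z u i) (betaF M D Y u i)
      = hess (energy_rep i) (cmap (slit M) i u) (0, Y u i) (betaF M D Z u i)"
    if Y: "Y \<in> psections M" and Z: "Z \<in> psections M" and u: "u \<in> cdom (slit M) i" for Y Z u
    by (simp add: hess_deviation[OF Y Z u] hess_deviation[OF Z Y u] chart_deviation_symmetric[OF Y Z u Q[OF Y Z]])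
  fix Z assume Z: "Z \<in> psections M"
  show "hess (energy_rep i) ?z (0, Z u i) (betaF M D Y u i) = hess (energy_rep i) ?z (0, Y u i) (betaF M D Z u i)"
    by (rule lagr[OF Y Z u])
  let ?bY = "hcoef M D i Y ?z" and ?bZ = "hcoef M D i Z ?z"
  let ?S = "local_rep (slit M) i (betaF M D ?\<eta>)" and ?Z = "local_rep (slit M) i Z"
  let ?V = "cov M D (gamF M Y) Z"
  have V: "?V \<in> psections M" by (rule cov_in_psections[OF gamF_in_vector_fields[OF Y] Z])
  have spray: "hess (energy_rep i) (cmap (slit M) i u) (0, W u i) (betaF M D ?\<eta> u i)
      = dder (energy_rep i) (cmap (slit M) i u) (W u i, 0)" if W: "W \<in> psections M" and u: "u \<in> cdom (slit M) i" for W u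
    by (rule spray_equation[OF regular_conn_axioms conservative_component[OF W u] lagr[OF \<eta> W u] u W])
  have dZ: "(?Z has_derivative dder ?Z ?z) (at ?z)"
    by (rule smooth_on_has_derivative[OF psectionsD(3)[OF Z] z])
  have dZ1: "((\<lambda>x. (0::'e, ?Z x)) has_derivative (\<lambda>c. (0, dder ?Z ?z c))) (at ?z)"
    and dZ2: "((\<lambda>x. (?Z x, 0::'e)) has_derivative (\<lambda>c. (dder ?Z ?z c, 0))) (at ?z)"
    by (intro has_derivative_Pair has_derivative_const dZ)+
  have dS: "(?S has_derivative dder ?S ?z) (at ?z)"
    by (rule smooth_on_has_derivative[OF slit.vector_fieldsD(3)[OF betaF_in_vector_fields[OF \<eta>]] z])
  have "((\<lambda>x. hess (energy_rep i) x (0, ?Z x) (?S x)) has_derivative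
      (\<lambda>c. third (energy_rep i) ?z c (0, ?Z ?z) (?S ?z) + hess (energy_rep i) ?z (0, ?Z ?z) (dder ?S ?z c)
        + hess (energy_rep i) ?z (0, dder ?Z ?z c) (?S ?z))) (at ?z)"
    by (rule e.has_derivative_hess_apply[OF z dZ1 dS])
  moreover have "((\<lambda>x. hess (energy_rep i) x (0, ?Z x) (?S x)) has_derivative
      (\<lambda>c. hess (energy_rep i) ?z c (?Z ?z, 0) + dder (energy_rep i) ?z (dder ?Z ?z c, 0))) (at ?z)"
  proof (rule has_derivative_cong_open[OF slit.open_chart_image z, THEN iffD2, rotated])
    show "((\<lambda>x. dder (energy_rep i) x (?Z x, 0)) has_derivative
        (\<lambda>c. hess (energy_rep i) ?z c (?Z ?z, 0) + dder (energy_rep i) ?z (dder ?Z ?z c, 0))) (at ?z)"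
      by (rule e.has_derivative_dder_apply[OF z dZ2])
    show "hess (energy_rep i) x (0, ?Z x) (?S x) = dder (energy_rep i) x (?Z x, 0)" if x: "x \<in> chart_image (slit M) i" for x
      using spray[OF Z slit.cinv_in_cdom[OF x]] slit.cmap_cinv[OF x] by simp
  qed
  ultimately have "third (energy_rep i) ?z (0, Y u i) (0, ?Z ?z) (?S ?z) + hess (energy_rep i) ?z (0, ?Z ?z) (dder ?S ?z (0, Y u i))
        + hess (energy_rep i) ?z (0, dder ?Z ?z (0, Y u i)) (?S ?z)
      = hess (energy_rep i) ?z (0, Y u i) (?Z ?z, 0) + dder (energy_rep i) ?z (dder ?Z ?z (0, Y u i), 0)"
    by (rule fun_cong[OF has_derivative_unique])
  \<comment> \<open>One \<open>b\<^sub>Y\<close> comes from \<open>D\<^bsub>\<gamma>Y\<^esub> \<eta> = Y\<close>, the other from the deviation \<open>- b\<^sub>Y\<close>.\<close>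
  moreover have "dder ?S ?z (0, Y u i) = (Y u i, ?bY + ?bY)"
  proof -
    have "cov M D (gamF M Y) ?\<eta> = Y" using KF_gamF[OF Y] by (simp add: KF_eq_cov)
    moreover have "chart_deviation M D i (betaF M D ?\<eta>) Y u = - ?bY"
      using chart_deviation_symmetric[OF \<eta> Y u Q[OF \<eta> Y]] chart_deviation_betaF_fundamental[OF Y u] by simp
    ultimately show ?thesis
      by (simp add: dder_betaF[OF \<eta> z] dder_hcoef[OF \<eta> Y u] dder_fundamental_section[OF z])
  qed
  moreover have "hess (energy_rep i) ?z (0, ?V u i) (?S ?z) = dder (energy_rep i) ?z (?V u i, 0)"
    using spray[OF V u] u by simp
  ultimately have "third (energy_rep i) ?z (0, Y u i) (0, Z u i) (betaF M D ?\<eta> u i)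
        + hess (energy_rep i) ?z (0, Z u i) (Y u i, ?bY + ?bY) = hess (energy_rep i) ?z (0, Y u i) (Z u i, 0)"
    using u by (simp add: cov_gamF_component[OF Y Z u])
  moreover have "third (energy_rep i) ?z (0, Y u i) (0, Z u i) (betaF M D ?\<eta> u i)
      = third (energy_rep i) ?z (betaF M D ?\<eta> u i) (0, Y u i) (0, Z u i)"
    using e.third_sym_right[OF z, where a="(0, Z u i)"] e.third_sym_left[OF z, where a="betaF M D ?\<eta> u i"]
    by simp
  moreover have "hess (energy_rep i) ?z (0, Z u i) (0, ?bY + ?bY)
      = hess (energy_rep i) ?z (0, Z u i) (0, ?bY) + hess (energy_rep i) ?z (0, Z u i) (0, ?bY)"
    using linear_add[OF e.hess_linear_right[OF z], of "(0, ?bY)" "(0, ?bY)" "(0, Z u i)"] by simp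
  ultimately show "third (energy_rep i) ?z (betaF M D ?\<eta> u i) (0, Y u i) (0, Z u i)
      = - hess (energy_rep i) ?z (0, ?bY) (0, Z u i) - hess (energy_rep i) ?z (0, Y u i) (0, ?bZ)"
    using lagr[OF Y Z u, unfolded betaF_component[OF Y u] betaF_component[OF Z u]]
      hess_e_split[OF z, where a="(0, Z u i)" and v="Y u i" and w="?bY"]
      hess_e_split[OF z, where a="(0, Z u i)" and v="Y u i" and w="?bY + ?bY"]
      hess_e_split[OF z, where a="(0, Y u i)" and v="Z u i" and w="?bZ"]
      e.hess_sym[OF z, where a="(0, ?bY)" and b="(0, Z u i)"]
    by linarith
qed

end

section \<open>The Berwald connection in terms of the Cartan connection\<close>

theorem theorem4p4:
  fixes M :: "('i, 'm, 'e::euclidean_space) atlas"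
    and L :: "('i, 'm, 'e) tpoint \<Rightarrow> real"
    and C B :: "('i, 'm, 'e) connection"
  assumes "finsler_manifold M L"
    and "cartan_connection M L C"
    and "berwald_connection M L B"
  shows "(\<forall>X\<in>vector_fields (slit M). \<forall>Y\<in>psections M.
            cov M B X Y = cov M C X Y + vhv_torsion M C (rhoF M X) Y - hv_torsion M C (KF M C X) Y) \<and>
         (\<forall>X\<in>psections M. \<forall>Y\<in>psections M.
            cov M B (gamF M X) Y = cov M C (gamF M X) Y - hv_torsion M C X Y \<and>
            cov M B (gamF M X) Y = rhoF M (bracket (slit M) (gamF M X) (betaF M C Y))) \<and>
         (\<forall>X\<in>psections M. \<forall>Y\<in>psections M.
            cov M B (betaF M C X) Y = cov M C (betaF M C X) Y + vhv_torsion M C X Y \<and>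
            cov M B (betaF M C X) Y = KF M C (bracket (slit M) (betaF M C X) (gamF M Y)))"
proof -
  have atlas: "smooth_atlas M"
    using assms(1) by (simp add: finsler_manifold_def smooth_manifold_atlas)
  interpret C: cartan M L C
    using assms atlas
    by (simp add: cartan_def finsler_def slit_atlas_def regular_conn_def finsler_axioms_def
        regular_conn_axioms_def cartan_axioms_def cartan_connection_def)
  interpret B: berwald M L B
    using assms atlas
    by (simp add: berwald_def finsler_def slit_atlas_def regular_conn_def finsler_axioms_def
        regular_conn_axioms_def berwald_axioms_def berwald_connection_def)
  have \<beta>: "betaF M C X = betaF M B X" if "X \<in> psections M" for X
    by (rule barthel_unique[OF C.barthel_axioms B.barthel_axioms that])
  have K: "KF M C W = KF M B W" if W: "W \<in> vector_fields (slit M)" for W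
    by (rule C.psection_eqI[OF C.KF_in_psections[OF W] B.KF_in_psections[OF W]])
      (simp add: C.KF_component[OF W] B.KF_component[OF W] hcoef_def \<beta> C.rhoF_in_psections[OF W])
  have a2: "cov M B (gamF M X) Y = rhoF M (bracket (slit M) (gamF M X) (betaF M C Y))"
    and a1: "cov M B (gamF M X) Y = cov M C (gamF M X) Y - hv_torsion M C X Y"
    if X: "X \<in> psections M" and Y: "Y \<in> psections M" for X Y
    by (simp_all add: B.cov_gamF[OF X Y] C.hv_torsion_eq[OF X Y] \<beta>[OF Y])
  have b2: "cov M B (betaF M C X) Y = KF M C (bracket (slit M) (betaF M C X) (gamF M Y))"
    if X: "X \<in> psections M" and Y: "Y \<in> psections M" for X Y
    using B.cov_betaF[OF X Y]
    by (simp add: \<beta>[OF X] K C.slit.bracket_in_vector_fields B.betaF_in_vector_fields[OF X]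
        C.gamF_in_vector_fields[OF Y])
  have b1: "cov M B (betaF M C X) Y = cov M C (betaF M C X) Y + vhv_torsion M C X Y"
    if X: "X \<in> psections M" and Y: "Y \<in> psections M" for X Y
    by (simp add: b2[OF X Y] C.vhv_torsion_eq[OF X Y])
  have main: "cov M B X Y = cov M C X Y + vhv_torsion M C (rhoF M X) Y - hv_torsion M C (KF M C X) Y"
    if X: "X \<in> vector_fields (slit M)" and Y: "Y \<in> psections M" for X Y
  proof -
    note \<rho>X = C.rhoF_in_psections[OF X] and KX = C.KF_in_psections[OF X]
    note dec = Y C.betaF_in_vector_fields[OF \<rho>X] C.gamF_in_vector_fields[OF KX]
      C.vector_field_decomposition[OF X]
    have "cov M B X Y = cov M B (betaF M C (rhoF M X)) Y + cov M B (gamF M (KF M C X)) Y"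
      by (rule B.cov_add[OF dec])
    moreover have "cov M C X Y = cov M C (betaF M C (rhoF M X)) Y + cov M C (gamF M (KF M C X)) Y"
      by (rule C.cov_add[OF dec])
    ultimately show ?thesis
      by (simp add: b1[OF \<rho>X Y] a1[OF KX Y])
  qed
  show ?thesis using main a1 a2 b1 b2 by blast
qed

end
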